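(* Let $(1,x,y)\in\mathbb{Z}_{\ge0}^3$. (a) $(1,x,y)$ is the $\mathbf d$-vector of a Gorenstein* poset of rank $5$ if and only if $y\le \frac{(x-1)^2}{4}$ or there exist non-negative integers $a,b$ with $x=a+b$ and $y=ab$. (b) $(1,x,y)$ is the $\mathbf d$-vector of a Gorenstein* poset of rank $6$ if and only if $y\le\frac{x^2}{4}$.
   Context: Let $P$ be a finite graded poset of rank $n+1$ with minimum $\hat 0$, maximum $\hat 1$ and rank function $r$. Its order complex $\mathcal{O}(P)$ is the simplicial complex whose faces are the chains of $P-\{\hat 0,\hat 1\}$. For $S\subseteq[n]$, $f_S(P)$ is the number of chains in $P-\{\hat0,\hat1\}$ whose set of ranks is exactly $S$, and $h_S(P)=\sum_{T\subseteq S}(-1)^{|S|-|T|}f_T(P)$. With $u_S=u_1\cdots u_n$, $u_i=\mathbf b$ if $i\in S$ and $u_i=\mathbf a$ otherwise, set $\Psi_P(\mathbf a,\mathbf b)=\sum_S h_S(P)u_S$. $P$ is Gorenstein* if $\mathcal O(P)$ is a Gorenstein* simplicial complex over a fixed field (a homology sphere over that field in the sense that every link, including the whole complex, has the homology of a sphere of its dimension). For Gorenstein* $P$, $\Psi_P$ is uniquely a non-commutative polynomial $\Phi_P(\mathbf c,\mathbf d)$ in $\mathbf c=\mathbf a+\mathbf b$, $\mathbf d=\mathbf{ab}+\mathbf{ba}$ (the $\mathbf{cd}$-index). The $\mathbf d$-vector $(\delta_0,\dots,\delta_{\lfloor n/2\rfloor})$ of $P$ is defined by $\Phi_P(1,\mathbf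 d)=\sum_i\delta_i\mathbf d^i$ (substitute $\mathbf c=1$). *)

theory Defs
  imports Complex_Main "HOL-Library.Function_Algebras"
begin

definition finite_poset :: "nat set \<Rightarrow> (nat \<Rightarrow> nat \<Rightarrow> bool) \<Rightarrow> bool" where
  "finite_poset P le \<longleftrightarrow> finite P \<and> (\<forall>x\<in>P. le x x)
     \<and> (\<forall>x\<in>P. \<forall>y\<in>P. le x y \<and> le y x \<longrightarrow> x = y)
     \<and> (\<forall>x\<in>P. \<forall>y\<in>P. \<forall>z\<in>P. le x y \<and> le y z \<longrightarrow> le x z)"

definition covers :: "nat set \<Rightarrow> (nat \<Rightarrow> nat \<Rightarrow> bool) \<Rightarrow> nat \<Rightarrow> nat \<Rightarrow> bool" where
  "covers P le x y \<longleftrightarrow> x \<in> P \<and> y \<in> P \<and> le x y \<and> x \<noteq> y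
     \<and> \<not> (\<exists>z\<in>P. le x z \<and> le z y \<and> z \<noteq> x \<and> z \<noteq> y)"

definition graded_poset ::
  "nat set \<Rightarrow> (nat \<Rightarrow> nat \<Rightarrow> bool) \<Rightarrow> nat \<Rightarrow> nat \<Rightarrow> (nat \<Rightarrow> nat) \<Rightarrow> nat \<Rightarrow> bool" where
  "graded_poset P le z t r n \<longleftrightarrow> finite_poset P le \<and> z \<in> P \<and> t \<in> P
     \<and> (\<forall>x\<in>P. le z x \<and> le x t)
     \<and> r z = 0 \<and> r t = n + 1
     \<and> (\<forall>x\<in>P. \<forall>y\<in>P. covers P le x y \<longrightarrow> r y = r x + 1)"

definition is_chain :: "nat set \<Rightarrow> (nat \<Rightarrow> nat \<Rightarrow> bool) \<Rightarrow> nat set \<Rightarrow> bool" where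
  "is_chain Q le C \<longleftrightarrow> C \<subseteq> Q \<and> (\<forall>x\<in>C. \<forall>y\<in>C. le x y \<or> le y x)"

definition order_complex :: "nat set \<Rightarrow> (nat \<Rightarrow> nat \<Rightarrow> bool) \<Rightarrow> nat \<Rightarrow> nat \<Rightarrow> nat set set" where
  "order_complex P le z t = {C. is_chain (P - {z, t}) le C}"

definition link :: "nat set set \<Rightarrow> nat set \<Rightarrow> nat set set" where
  "link K F = {G \<in> K. G \<inter> F = {} \<and> G \<union> F \<in> K}"

definition chain_space :: "'k::field itself \<Rightarrow> nat set set \<Rightarrow> nat \<Rightarrow> (nat set \<Rightarrow> 'k) set" where
  "chain_space _ K j = {f. \<forall>G. f G \<noteq> 0 \<longrightarrow> G \<in> K \<and> card G = j}"

text \<open>Simplicial boundary (vertices oriented by the order of nat), from cardinality j to j - 1.\<close>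
definition boundary :: "nat set set \<Rightarrow> nat \<Rightarrow> (nat set \<Rightarrow> 'k::field) \<Rightarrow> (nat set \<Rightarrow> 'k)" where
  "boundary K j f = (\<lambda>H. if H \<in> K \<and> card H + 1 = j then
      (\<Sum>v\<in>{v. v \<notin> H \<and> insert v H \<in> K}.
          (-1) ^ card {w \<in> H. w < v} * f (insert v H))
    else 0)"

definition fscale :: "'k::field \<Rightarrow> (nat set \<Rightarrow> 'k) \<Rightarrow> (nat set \<Rightarrow> 'k)" where
  "fscale c f = (\<lambda>x. c * f x)"

text \<open>Dimension over 'k of the reduced homology in degree j - 1 (faces of cardinality j).\<close>
definition red_betti :: "'k::field itself \<Rightarrow> nat set set \<Rightarrow> nat \<Rightarrow> nat" where
  "red_betti T K j =
     vector_space.dim (fscale :: 'k \<Rightarrow> _)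
       {f \<in> chain_space T K j. j = 0 \<or> boundary K j f = 0}
   - vector_space.dim (fscale :: 'k \<Rightarrow> _)
       (boundary K (j + 1) ` chain_space T K (j + 1))"

text \<open>K (of dimension d) is a homology d-sphere over 'k with all links homology spheres of the
  right dimension: Gorenstein*. Index j = dimension + 1.\<close>
definition gorenstein_star_complex :: "'k::field itself \<Rightarrow> nat set set \<Rightarrow> nat \<Rightarrow> bool" where
  "gorenstein_star_complex T K dplus1 \<longleftrightarrow>
     (\<forall>F\<in>K. card F \<le> dplus1 \<and>
        (\<forall>j. red_betti T (link K F) j = (if j = dplus1 - card F then 1 else 0)))"

definition gorenstein_star_poset ::
  "'k::field itself \<Rightarrow> nat set \<Rightarrow> (nat \<Rightarrow> nat \<Rightarrow> bool) \<Rightarrow> nat \<Rightarrow> nat \<Rightarrow> (nat \<Rightarrow> nat) \<Rightarrow> nat \<Rightarrow> bool" where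
  "gorenstein_star_poset T P le z t r n \<longleftrightarrow>
     graded_poset P le z t r n \<and> gorenstein_star_complex T (order_complex P le z t) n"

definition flag_f :: "nat set \<Rightarrow> (nat \<Rightarrow> nat \<Rightarrow> bool) \<Rightarrow> nat \<Rightarrow> nat \<Rightarrow> (nat \<Rightarrow> nat) \<Rightarrow> nat set \<Rightarrow> int" where
  "flag_f P le z t r S = int (card {C \<in> order_complex P le z t. r ` C = S})"

definition flag_h :: "nat set \<Rightarrow> (nat \<Rightarrow> nat \<Rightarrow> bool) \<Rightarrow> nat \<Rightarrow> nat \<Rightarrow> (nat \<Rightarrow> nat) \<Rightarrow> nat set \<Rightarrow> int" where
  "flag_h P le z t r S = (\<Sum>T\<in>Pow S. (-1) ^ (card S - card T) * flag_f P le z t r T)"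

datatype cd = C | D

fun cd_deg :: "cd list \<Rightarrow> nat" where
  "cd_deg [] = 0"
| "cd_deg (C # w) = cd_deg w + 1"
| "cd_deg (D # w) = cd_deg w + 2"

text \<open>match w k S: the ab-monomial u_S (positions k, k+1, ...; b at positions in S) occurs
  (with coefficient 1) in the expansion of the cd-monomial w, where c = a+b, d = ab+ba.\<close>
fun cd_match :: "cd list \<Rightarrow> nat \<Rightarrow> nat set \<Rightarrow> bool" where
  "cd_match [] k S = True"
| "cd_match (C # w) k S = cd_match w (k + 1) S"
| "cd_match (D # w) k S = ((k \<in> S) \<noteq> (k + 1 \<in> S) \<and> cd_match w (k + 2) S)"

definition cd_words :: "nat \<Rightarrow> cd list set" where
  "cd_words n = {w. cd_deg w = n}"

text \<open>Phi is a cd-index for P: Psi_P(a,b) = sum_S h_S u_S equals Phi(a+b, ab+ba).\<close>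
definition is_cd_index ::
  "nat set \<Rightarrow> (nat \<Rightarrow> nat \<Rightarrow> bool) \<Rightarrow> nat \<Rightarrow> nat \<Rightarrow> (nat \<Rightarrow> nat) \<Rightarrow> nat \<Rightarrow> (cd list \<Rightarrow> int) \<Rightarrow> bool" where
  "is_cd_index P le z t r n Phi \<longleftrightarrow>
     (\<forall>S\<subseteq>{1..n}. flag_h P le z t r S =
        (\<Sum>w\<in>cd_words n. if cd_match w 1 S then Phi w else 0))"

text \<open>d-vector [delta_0, ..., delta_{n div 2}] from Phi(1,d) = sum_i delta_i d^i.\<close>
definition d_vector_of :: "nat \<Rightarrow> (cd list \<Rightarrow> int) \<Rightarrow> int list" where
  "d_vector_of n Phi =
     map (\<lambda>i. \<Sum>w\<in>{w \<in> cd_words n. count_list w D = i}. Phi w) [0..<n div 2 + 1]"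

definition is_d_vector_of_gorenstein :: "'k::field itself \<Rightarrow> nat \<Rightarrow> int list \<Rightarrow> bool" where
  "is_d_vector_of_gorenstein T n dv \<longleftrightarrow>
     (\<exists>P le z t r Phi. gorenstein_star_poset T P le z t r n
        \<and> is_cd_index P le z t r n Phi \<and> d_vector_of n Phi = dv)"

end

theory Submission
  imports Defs
begin

text \<open>A single subdivision of the edge \<open>u\<close>--\<open>v\<close> of the order complex
  would need a vertex of rank strictly between \<open>r u\<close> and \<open>r v\<close>; two
  vertices fit, with the two ranks alternating along the path. At c = 1 the new term is (1 + k1 d +
  ...) d (1 + k2 d + ...), whence the increments of x and y. The extra unit in rank 5 has this
  origin: two elements of rank 3 with a + 2 and q + 2 atoms below them are needed, but atoms are
  added below an element p of rank 2 under both, and making the counts differ costs one split that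
  detaches p from one of them. In rank 6, a and q are d-coefficients of intervals below elements of
  ranks 4 and 3, and the former can be raised without the latter, so nothing has to be detached.
  Betti numbers are compared by cancelling pairs of faces that differ in one vertex, as in discrete
  Morse theory, which works over every field. For necessity only two consequences of the sphere
  condition are used: open intervals of rank difference 2 have exactly two elements, and longer ones
  are connected.\<close>

text \<open>Sufficiency. Replace a cover \<open>u < v\<close> of proper elements by \<open>u < b > a < v\<close>, with \<open>a\<close> and \<open>b\<close> copies
  of \<open>u\<close> and \<open>v\<close>. On the order complex this subdivides an edge twice, so being Gorenstein* is preserved,
  and the \<open>cd\<close>-index becomes \<open>\<Phi> + \<Phi>1 d \<Phi>2\<close>, where \<open>\<Phi>1\<close> and \<open>\<Phi>2\<close> belong to the intervals below \<open>u\<close> and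
  above \<open>v\<close>. Hence \<open>x\<close> grows by 1 and \<open>y\<close> by the sum of the \<open>d\<close>-coefficients of \<open>\<Phi>1\<close> and \<open>\<Phi>2\<close>; starting from
  two elements in each rank (with \<open>cd\<close>-index a power of \<open>c\<close>), suitable sequences of such steps yield
  \<open>y = b a + q\<close> with \<open>q \<le> a\<close> at the cost \<open>x = a + b + 2\<close> in rank 5 and \<open>x = a + b + 1\<close> in rank 6.

  Necessity. In rank 6, counting pairs of comparable elements of ranks 2 and 4 gives \<open>y \<le> p q\<close> where
  \<open>p + 2\<close> and \<open>q + 2\<close> are the numbers of elements of these ranks and \<open>p + q = x\<close>. In rank 5, comparable
  pairs of atoms and coatoms give \<open>y \<le> a1 a3\<close> where \<open>x = a1 + a2 + a3\<close>, the \<open>ai\<close> being the coefficients of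
  the three words with one \<open>d\<close>. Finally \<open>a2 \<ge> 0\<close>, and if \<open>a2 = 0\<close> then the elements of ranks 1 and 2 form
  a cycle and all atoms lie below all coatoms, so that \<open>y = a1 a3\<close>.\<close>

section \<open>Chains, cycles and boundaries\<close>

interpretation FV: vector_space "fscale :: 'k::field \<Rightarrow> (nat set \<Rightarrow> 'k) \<Rightarrow> (nat set \<Rightarrow> 'k)"
  by standard (auto simp: fscale_def fun_eq_iff algebra_simps)

lemma sum_fun_apply: "(\<Sum>i\<in>I. (g i :: nat set \<Rightarrow> 'k::field)) x = (\<Sum>i\<in>I. g i x)"
  by (induction I rule: infinite_finite_induct) auto

definition single :: "nat set \<Rightarrow> nat set \<Rightarrow> 'k::field" where
  "single G = (\<lambda>H. if H = G then 1 else 0)"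

definition cycles :: "'k::field itself \<Rightarrow> nat set set \<Rightarrow> nat \<Rightarrow> (nat set \<Rightarrow> 'k) set" where
  "cycles T K j = {f \<in> chain_space T K j. j = 0 \<or> boundary K j f = 0}"

definition boundaries :: "'k::field itself \<Rightarrow> nat set set \<Rightarrow> nat \<Rightarrow> (nat set \<Rightarrow> 'k) set" where
  "boundaries T K j = boundary K (j + 1) ` chain_space T K (j + 1)"

lemma red_betti_eq:
  "red_betti (T::'k::field itself) K j = FV.dim (cycles T K j) - FV.dim (boundaries T K j)"
  by (simp add: red_betti_def cycles_def boundaries_def)

lemma chain_spaceD: "f \<in> chain_space T K j \<Longrightarrow> G \<notin> K \<or> card G \<noteq> j \<Longrightarrow> f G = 0"
  unfolding chain_space_def by blast

lemma chain_spaceI: "(\<And>G. f G \<noteq> 0 \<Longrightarrow> G \<in> K \<and> card G = j) \<Longrightarrow> f \<in> chain_space T K j"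
  unfolding chain_space_def by blast

lemma subspace_chain_space: "FV.subspace (chain_space T K j)"
  by (rule FV.subspaceI) (force simp: chain_space_def fscale_def)+

lemma boundary_add: "boundary K j (f + g) = boundary K j f + boundary K j g"
  by (auto simp: boundary_def fun_eq_iff distrib_left sum.distrib)

lemma boundary_fscale: "boundary K j (fscale c f) = fscale c (boundary K j f)"
  by (auto simp: boundary_def fun_eq_iff fscale_def sum_distrib_left algebra_simps)

lemma linear_boundary: "Vector_Spaces.linear fscale fscale (boundary K j)"
  by (simp add: Vector_Spaces.linear_iff boundary_add boundary_fscale FV.vector_space_axioms)

lemma boundary_diff: "boundary K j (f - g) = boundary K j f - boundary K j g"
  by (auto simp: boundary_def fun_eq_iff right_diff_distrib sum_subtractf)

lemma boundary_0 [simp]: "boundary K j 0 = 0"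
  by (auto simp: boundary_def fun_eq_iff)

lemma boundary_in_chain_space: "boundary K (j + 1) f \<in> chain_space T K j"
  by (rule chain_spaceI) (auto simp: boundary_def split: if_splits)

lemma subspace_cycles: "FV.subspace (cycles T K j)"
  by (rule FV.subspaceI)
     (use FV.subspace_0[OF subspace_chain_space] FV.subspace_add[OF subspace_chain_space]
        FV.subspace_scale[OF subspace_chain_space] in
       \<open>auto simp: cycles_def boundary_add boundary_fscale\<close>)

lemma subspace_boundaries: "FV.subspace (boundaries (T::'k::field itself) K j)"
proof -
  interpret b: Vector_Spaces.linear "fscale :: 'k \<Rightarrow> (nat set \<Rightarrow> 'k) \<Rightarrow> _"
    "fscale :: 'k \<Rightarrow> (nat set \<Rightarrow> 'k) \<Rightarrow> _" "boundary K (j + 1)"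
    by (rule linear_boundary)
  show ?thesis
    unfolding boundaries_def by (rule b.subspace_image[OF subspace_chain_space])
qed

lemma chain_space_finite_span:
  assumes "finite K"
  shows "chain_space (T::'k::field itself) K j \<subseteq> FV.span (single ` K)"
proof
  fix f assume f: "f \<in> chain_space T K j"
  have "f = (\<Sum>G\<in>K. fscale (f G) (single G))"
  proof
    fix H
    have "(\<Sum>G\<in>K. fscale (f G) (single G)) H = (\<Sum>G\<in>K. if H = G then f G else 0)"
      unfolding sum_fun_apply by (rule sum.cong) (auto simp: fscale_def single_def)
    also have "\<dots> = f H"
      using assms chain_spaceD[OF f, of H] by auto
    finally show "f H = (\<Sum>G\<in>K. fscale (f G) (single G)) H" by simp
  qed
  moreover have "(\<Sum>G\<in>K. fscale (f G) (single G)) \<in> FV.span (single ` K)"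
    by (intro FV.span_sum FV.span_scale FV.span_base) auto
  ultimately show "f \<in> FV.span (single ` K)" by simp
qed

text \<open>A basis of \<open>A\<close> together with \<open>x\<close> is a basis of
  \<open>B\<close>. The finite set \<open>F\<close> ensures that the basis is finite: an
  infinite-dimensional space has \<open>dim\<close> 0.\<close>

lemma dim_add_line:
  fixes A B :: "(nat set \<Rightarrow> 'k::field) set"
  assumes A: "FV.subspace A" "A \<subseteq> FV.span F" "finite F" and x: "x \<notin> A"
    and B: "B = {f. \<exists>c. f - fscale c x \<in> A}"
  shows "FV.dim B = FV.dim A + 1"
proof -
  obtain b where b: "b \<subseteq> A" "FV.independent b" "A \<subseteq> FV.span b" "card b = FV.dim A"
    using FV.basis_exists by blast
  have sb: "FV.span b = A"
    using b A(1) by (simp add: FV.span_subspace)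
  have fin: "finite b"
    using FV.independent_span_bound[OF A(3) b(2)] b A(2) by blast
  have "B = FV.span (insert x b)"
    unfolding B FV.span_insert sb ..
  moreover have "FV.independent (insert x b)"
    using b x sb by (simp add: FV.independent_insertI)
  moreover have "x \<notin> b" using x b by blast
  ultimately show ?thesis
    using FV.dim_span_eq_card_independent[of "insert x b"] b fin by simp
qed

lemma dim_inj_image:
  fixes A :: "(nat set \<Rightarrow> 'k::field) set"
  assumes A: "FV.subspace A" and lin: "Vector_Spaces.linear fscale fscale (p :: (nat set \<Rightarrow> 'k) \<Rightarrow> _)"
    and inj: "\<And>f. f \<in> A \<Longrightarrow> p f = 0 \<Longrightarrow> f = 0"
  shows "FV.dim (p ` A) = FV.dim A"
proof -
  interpret p: Vector_Spaces.linear "fscale :: 'k \<Rightarrow> (nat set \<Rightarrow> 'k) \<Rightarrow> _" "fscale :: 'k \<Rightarrow> (nat set \<Rightarrow> 'k) \<Rightarrow> _" p by fact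
  obtain b where b: "b \<subseteq> A" "FV.independent b" "A \<subseteq> FV.span b" "card b = FV.dim A"
    using FV.basis_exists by blast
  have sb: "FV.span b = A"
    using b A(1) by (simp add: FV.span_subspace)
  have "inj_on p A"
  proof (rule inj_onI)
    fix f g assume "f \<in> A" "g \<in> A" "p f = p g"
    then have "f - g \<in> A" "p (f - g) = 0"
      using A by (auto simp: FV.subspace_diff p.diff)
    then show "f = g" using inj by fastforce
  qed
  then have "FV.independent (p ` b)" "card (p ` b) = card b"
    using p.dependent_inj_imageD[of b] b sb by (auto simp: card_image inj_on_subset)
  moreover have "FV.span (p ` b) = p ` A"
    using sb by (simp add: p.span_image)
  ultimately show ?thesis
    using FV.dim_span_eq_card_independent[of "p ` b"] b by simp
qed

text \<open>Otherwise a basis of \<open>A\<close> together with some \<open>x\<close> in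
  \<open>B\<close> outside \<open>A\<close> would be independent and larger than a basis of
  \<open>B\<close>.\<close>

lemma subspace_dim_eq:
  fixes A B :: "(nat set \<Rightarrow> 'k::field) set"
  assumes "FV.subspace A" "FV.subspace B" "A \<subseteq> B" "B \<subseteq> FV.span F" "finite F"
    "FV.dim B \<le> FV.dim A"
  shows "A = B"
proof (rule ccontr)
  assume "A \<noteq> B"
  then obtain x where x: "x \<in> B" "x \<notin> A" using assms(3) by blast
  obtain b where b: "b \<subseteq> A" "FV.independent b" "A \<subseteq> FV.span b" "card b = FV.dim A"
    using FV.basis_exists by blast
  have sb: "FV.span b = A"
    using b assms(1) by (simp add: FV.span_subspace)
  have i: "FV.independent (insert x b)"
    using b x sb by (simp add: FV.independent_insertI)
  obtain e where e: "e \<subseteq> B" "FV.independent e" "B \<subseteq> FV.span e" "card e = FV.dim B"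
    using FV.basis_exists by blast
  have "finite e"
    using FV.independent_span_bound[OF assms(5) e(2)] e assms(4) by blast
  moreover have "insert x b \<subseteq> FV.span e" using x b assms(3) e by blast
  ultimately have "finite (insert x b) \<and> card (insert x b) \<le> card e"
    by (intro FV.independent_span_bound i)
  moreover have "x \<notin> b" using x b by blast
  ultimately show False using b e assms(6) by auto
qed

text \<open>Each pair cancels against its reversal. The sum is split by \<open>v < w\<close> instead
  of being shown equal to its own negative, so that the argument also works in characteristic
  2.\<close>

lemma antisymmetric_sum_0:
  fixes a :: "nat \<Rightarrow> nat \<Rightarrow> 'k::field"
  assumes "finite X" "\<And>v w. (v, w) \<in> X \<Longrightarrow> v \<noteq> w \<and> (w, v) \<in> X \<and> a v w = - a w v"
  shows "(\<Sum>(v,w)\<in>X. a v w) = 0"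
proof -
  let ?L = "{(v,w)\<in>X. v < w}" and ?G = "{(v,w)\<in>X. w < v}"
  have X: "X = ?L \<union> ?G" and disj: "?L \<inter> ?G = {}" using assms(2) by (auto simp: neq_iff)
  have fin: "finite ?L" "finite ?G" by (rule finite_subset[OF _ assms(1)], blast)+
  have "(\<Sum>(v,w)\<in>X. a v w) = (\<Sum>(v,w)\<in>?L \<union> ?G. a v w)"
    by (rule arg_cong[OF X])
  also have "\<dots> = (\<Sum>(v,w)\<in>?L. a v w) + (\<Sum>(v,w)\<in>?G. a v w)"
    by (rule sum.union_disjoint[OF fin disj])
  also have "(\<Sum>(v,w)\<in>?G. a v w) = (\<Sum>(v,w)\<in>?L. - a v w)"
    by (rule sum.reindex_bij_witness[of _ "\<lambda>(v,w). (w,v)" "\<lambda>(v,w). (w,v)"])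
       (auto dest: assms(2))
  also have "\<dots> = - (\<Sum>(v,w)\<in>?L. a v w)"
    by (simp add: sum_negf case_prod_unfold)
  finally show ?thesis by simp
qed

section \<open>The square of the boundary map\<close>

text \<open>While pairs of faces are being cancelled, the remaining faces need not form a simplicial complex,
  but convexity suffices for the square of the boundary map to vanish.\<close>

definition convex_family :: "nat set set \<Rightarrow> bool" where
  "convex_family Q \<longleftrightarrow> finite Q \<and> (\<forall>G\<in>Q. finite G)
     \<and> (\<forall>A\<in>Q. \<forall>B\<in>Q. \<forall>X. A \<subseteq> X \<and> X \<subseteq> B \<longrightarrow> X \<in> Q)"

lemma convex_family_finite:
  assumes "convex_family Q" shows "finite Q" "G \<in> Q \<Longrightarrow> finite G" "finite (\<Union>Q)"
  using assms by (auto simp: convex_family_def)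

lemma card_below_insert:
  assumes "finite H" "v \<notin> H"
  shows "card {x \<in> insert v H. x < w} = card {x \<in> H. x < w} + (if v < w then 1 else 0)"
proof -
  have "{x \<in> insert v H. x < w} = (if v < w then insert v {x \<in> H. x < w} else {x \<in> H. x < w})"
    by auto
  then show ?thesis using assms by auto
qed

text \<open>Two vertices can be added to \<open>H\<close> in either order, with opposite signs.
  Convexity of \<open>Q\<close> guarantees that if one intermediate face is present, so is the
  other.\<close>

lemma boundary_boundary:
  fixes f :: "nat set \<Rightarrow> 'k::field"
  assumes Q: "convex_family Q"
  shows "boundary Q j (boundary Q (j + 1) f) = 0"
proof
  fix H
  show "boundary Q j (boundary Q (j + 1) f) H = 0 H"
  proof (cases "H \<in> Q \<and> card H + 1 = j")
    case True
    let ?s = "\<lambda>v H. (-1::'k) ^ card {w \<in> H. w < v}"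
    let ?V = "{v. v \<notin> H \<and> insert v H \<in> Q}"
    let ?W = "\<lambda>v. {w. w \<notin> insert v H \<and> insert w (insert v H) \<in> Q}"
    let ?a = "\<lambda>v w. ?s v H * (?s w (insert v H) * f (insert w (insert v H)))"
    have fH: "finite H" using True Q convex_family_finite by blast
    have fV: "finite ?V" and fW: "finite (?W v)" for v
      by (rule finite_subset[OF _ convex_family_finite(3)[OF Q]], blast)+
    have "boundary Q j (boundary Q (j + 1) f) H = (\<Sum>v\<in>?V. \<Sum>w\<in>?W v. ?a v w)"
      using True fH unfolding boundary_def
      by (auto simp: sum_distrib_left intro!: sum.cong)
    also have "\<dots> = (\<Sum>(v,w)\<in>Sigma ?V ?W. ?a v w)"
      by (rule sum.Sigma) (use fV fW in auto)
    also have "\<dots> = 0"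
    proof (rule antisymmetric_sum_0)
      show "finite (Sigma ?V ?W)" using fV fW by blast
    next
      fix v w assume vw: "(v, w) \<in> Sigma ?V ?W"
      then have ne: "v \<noteq> w" "v \<notin> H" "w \<notin> H" "insert v H \<in> Q" "insert w (insert v H) \<in> Q" by auto
      have "insert w H \<in> Q"
        using Q True ne unfolding convex_family_def by (meson insert_mono subset_insertI)
      then have "(w, v) \<in> Sigma ?V ?W" using ne by (auto simp: insert_commute)
      moreover have "?a v w = - ?a w v"
        using ne card_below_insert[OF fH, of v w] card_below_insert[OF fH, of w v]
        by (cases "v < w") (auto simp: insert_commute)
      ultimately show "v \<noteq> w \<and> (w, v) \<in> Sigma ?V ?W \<and> ?a v w = - ?a w v"
        using ne by blast
    qed
    finally show ?thesis by simp
  next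
    case False
    then show ?thesis unfolding boundary_def[of Q j] by (simp only: if_False zero_fun_apply)
  qed
qed

lemma boundaries_subset_cycles:
  assumes "convex_family Q" shows "boundaries T Q j \<subseteq> cycles T Q j"
  unfolding boundaries_def cycles_def
  using boundary_boundary[OF assms] boundary_in_chain_space by auto

section \<open>Cancelling pairs of faces\<close>

lemma boundary_apply:
  "H \<in> K \<Longrightarrow> card H + 1 = j \<Longrightarrow> boundary K j f H =
     (\<Sum>v\<in>{v. v \<notin> H \<and> insert v H \<in> K}. (-1) ^ card {w \<in> H. w < v} * f (insert v H))"
  by (simp add: boundary_def)

lemma boundary_outside: "H \<notin> K \<or> card H + 1 \<noteq> j \<Longrightarrow> boundary K j f H = 0"
  by (auto simp: boundary_def)

lemma boundary_subfamily:
  assumes "finite (\<Union>Q)" "Q' \<subseteq> Q" "\<And>G. G \<in> Q - Q' \<Longrightarrow> f G = 0" "H \<in> Q'"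
  shows "boundary Q' j f H = boundary Q j f H"
proof (cases "card H + 1 = j")
  case True
  have "(\<Sum>v\<in>{v. v \<notin> H \<and> insert v H \<in> Q'}. (-1) ^ card {w \<in> H. w < v} * f (insert v H))
      = (\<Sum>v\<in>{v. v \<notin> H \<and> insert v H \<in> Q}. (-1) ^ card {w \<in> H. w < v} * f (insert v H))"
  proof (rule sum.mono_neutral_left)
    show "finite {v. v \<notin> H \<and> insert v H \<in> Q}"
      by (rule finite_subset[OF _ assms(1)]) blast
  qed (use assms in auto)
  moreover have "H \<in> Q" using assms by blast
  ultimately show ?thesis using True assms(4) by (simp only: boundary_apply)
qed (simp add: boundary_outside)

text \<open>The exception made for degree 0 disappears because the boundary map out of degree 0 is
  zero: \<open>card H + 1 = 0\<close> is impossible.\<close>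

lemma cycles_alt: "cycles T K j = {f \<in> chain_space T K j. boundary K j f = 0}"
  by (cases j) (auto simp: cycles_def boundary_def fun_eq_iff)

lemma red_betti_same:
  assumes "cycles (T::'k::field itself) Q j = cycles T Q' j" "boundaries T Q j = boundaries T Q' j"
  shows "red_betti T Q j = red_betti T Q' j"
  using assms by (simp add: red_betti_eq)

lemma cycles_finite_span: "finite K \<Longrightarrow> cycles (T::'k::field itself) K j \<subseteq> FV.span (single ` K)"
  using chain_space_finite_span[of K] by (auto simp: cycles_def)

lemma boundaries_finite_span:
  "finite K \<Longrightarrow> boundaries (T::'k::field itself) K j \<subseteq> FV.span (single ` K)"
  using chain_space_finite_span[of K T j] boundary_in_chain_space[of K j _ T] by (auto simp: boundaries_def)

text \<open>Cycles and boundaries both gain the line of \<open>x\<close>, so the difference of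
  dimensions is unchanged, even as a truncated subtraction of natural numbers.\<close>

lemma red_betti_line:
  fixes T :: "'k::field itself"
  assumes "finite Q'" "x \<notin> cycles T Q' j" "x \<notin> boundaries T Q' j"
    "cycles T Q j = {f. \<exists>c. f - fscale c x \<in> cycles T Q' j}"
    "boundaries T Q j = {f. \<exists>c. f - fscale c x \<in> boundaries T Q' j}"
  shows "red_betti T Q j = red_betti T Q' j"
proof -
  have "FV.dim (cycles T Q j) = FV.dim (cycles T Q' j) + 1"
    by (rule dim_add_line[OF subspace_cycles cycles_finite_span[OF assms(1)] _ assms(2,4)])
       (use assms in auto)
  moreover have "FV.dim (boundaries T Q j) = FV.dim (boundaries T Q' j) + 1"
    by (rule dim_add_line[OF subspace_boundaries boundaries_finite_span[OF assms(1)] _ assms(3,5)])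
       (use assms in auto)
  ultimately show ?thesis by (simp add: red_betti_eq)
qed

lemma subspace_add_line:
  "FV.subspace A \<Longrightarrow> f \<in> A \<Longrightarrow> g \<in> A \<Longrightarrow> f + fscale c g \<in> A"
  by (rule FV.subspace_add) (auto intro: FV.subspace_scale)

lemma subspace_diff_line:
  "FV.subspace A \<Longrightarrow> f \<in> A \<Longrightarrow> g \<in> A \<Longrightarrow> f - fscale c g \<in> A"
  by (rule FV.subspace_diff) (auto intro: FV.subspace_scale)

lemma minus_one_power_square: "((-1::'k::field) ^ n) * ((-1) ^ n) = 1"
  by (simp flip: power_add mult_2)

text \<open>An elementary collapse. The boundary \<open>bt\<close> of the larger face \<tau> has the
  invertible coefficient \<epsilon> at \<sigma>, so no cycle involves \<tau>, and a cycle can be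
  freed of \<sigma> by subtracting a multiple of \<open>bt\<close>. In degree
  \<open>card \<sigma>\<close> both cycles and boundaries lose exactly the line of
  \<open>bt\<close>; in the other degrees nothing changes.\<close>

lemma red_betti_cancel_unique_coface:
  fixes T :: "'k::field itself"
  assumes Q: "convex_family Q" and s: "\<sigma> \<in> Q" and c: "c \<notin> \<sigma>" and t: "insert c \<sigma> \<in> Q"
    and uniq: "\<And>v. v \<notin> \<sigma> \<Longrightarrow> insert v \<sigma> \<in> Q \<Longrightarrow> v = c"
  shows "red_betti T (Q - {\<sigma>, insert c \<sigma>}) j = red_betti T Q j"
proof -
  define \<tau> where "\<tau> = insert c \<sigma>"
  define Q' where "Q' = Q - {\<sigma>, \<tau>}"
  define \<epsilon> :: 'k where "\<epsilon> = (-1) ^ card {w \<in> \<sigma>. w < c}"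
  define bt :: "nat set \<Rightarrow> 'k" where "bt = boundary Q (card \<sigma> + 1) (single \<tau>)"
  note fin = convex_family_finite[OF Q]
  have fs: "finite \<sigma>" using fin s by blast
  have ct: "card \<tau> = card \<sigma> + 1" using fs c by (simp add: \<tau>_def)
  have st: "\<sigma> \<noteq> \<tau>" using c by (auto simp: \<tau>_def)
  have ee: "\<epsilon> * \<epsilon> = 1" unfolding \<epsilon>_def by (rule minus_one_power_square)
  \<comment> \<open>By convexity a coface \<open>insert v \<tau>\<close> would produce the second
    coface \<open>insert v \<sigma>\<close> of \<sigma>.\<close>
  have tmax: "insert v \<tau> \<notin> Q" if "v \<notin> \<tau>" for v
  proof
    assume "insert v \<tau> \<in> Q"
    then have "insert v \<sigma> \<in> Q" using Q s unfolding convex_family_def \<tau>_def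
      by (meson insert_mono subset_insertI)
    then show False using uniq that by (auto simp: \<tau>_def)
  qed
  have cof: "{v. v \<notin> \<sigma> \<and> insert v \<sigma> \<in> Q} = {c}" using uniq c t by blast
  have at_s: "boundary Q (card \<sigma> + 1) f \<sigma> = \<epsilon> * f \<tau>" for f
    using boundary_apply[OF s refl, of f] unfolding cof by (simp add: \<epsilon>_def \<tau>_def)
  have no_cof: "{v. v \<notin> \<tau> \<and> insert v \<tau> \<in> Q} = {}" using tmax by blast
  have at_t: "boundary Q i f \<tau> = 0" for i and f :: "nat set \<Rightarrow> 'k"
    unfolding boundary_def no_cof by simp
  have at_s': "boundary Q i f \<sigma> = 0" if "f \<tau> = 0" for i and f :: "nat set \<Rightarrow> 'k"
    using that at_s[of f] by (cases "card \<sigma> + 1 = i") (auto simp: boundary_outside)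
  have bQ': "boundary Q' i f = boundary Q i f" if "f \<sigma> = 0" "f \<tau> = 0" for i and f :: "nat set \<Rightarrow> 'k"
  proof
    fix H show "boundary Q' i f H = boundary Q i f H"
    proof (cases "H \<in> Q'")
      case True
      then show ?thesis
        by (intro boundary_subfamily[OF fin(3)]) (use that in \<open>auto simp: Q'_def\<close>)
    next
      case False
      then have "boundary Q' i f H = 0" by (simp add: boundary_outside)
      moreover have "boundary Q i f H = 0"
        using False that at_s' at_t by (cases "H \<in> Q") (auto simp: Q'_def boundary_outside)
      ultimately show ?thesis by simp
    qed
  qed
  have ch': "chain_space T Q' i = {f \<in> chain_space T Q i. f \<sigma> = 0 \<and> f \<tau> = 0}" for i
    unfolding chain_space_def Q'_def by blast
  have ch_s: "f \<sigma> = 0" if "f \<in> chain_space T Q i" "i \<noteq> card \<sigma>" for f i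
    by (rule chain_spaceD[OF that(1)]) (use that(2) in simp)
  have ch_t: "f \<tau> = 0" if "f \<in> chain_space T Q i" "i \<noteq> card \<sigma> + 1" for f i
    by (rule chain_spaceD[OF that(1)]) (use that(2) ct in simp)
  have cyc': "cycles T Q' i = {f \<in> cycles T Q i. f \<sigma> = 0 \<and> f \<tau> = 0}" for i
    unfolding cycles_def ch' using bQ' by auto
  \<comment> \<open>At \<sigma> the boundary of \<open>f\<close> is \<epsilon> times the coefficient
    at \<tau>, which therefore vanishes for a cycle.\<close>
  have cyc_t: "f \<tau> = 0" if "f \<in> cycles T Q i" for f i
  proof (cases "i = card \<sigma> + 1")
    case True
    then have "boundary Q (card \<sigma> + 1) f = 0" using that by (auto simp: cycles_def)
    then have "\<epsilon> * f \<tau> = 0" using at_s[of f] by simp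
    then show ?thesis using ee by auto
  qed (use that ch_t in \<open>auto simp: cycles_def\<close>)
  have bd: "boundaries T Q' i = boundary Q (i + 1) ` chain_space T Q' (i + 1)" for i
    unfolding boundaries_def by (rule image_cong) (auto simp: ch' intro: bQ')
  have sing: "single \<tau> \<in> chain_space T Q (card \<sigma> + 1)"
    using t ct by (auto simp: chain_space_def single_def \<tau>_def)
  have bts: "bt \<sigma> = \<epsilon>" unfolding bt_def at_s by (simp add: single_def)
  have btt: "bt \<tau> = 0" unfolding bt_def by (rule at_t)
  have bt_cyc: "bt \<in> cycles T Q (card \<sigma>)"
    using boundaries_subset_cycles[OF Q] sing unfolding bt_def boundaries_def by blast
  show ?thesis
  proof (cases "j = card \<sigma>")
    case False
    have "cycles T Q j = cycles T Q' j"
      unfolding cyc' using cyc_t ch_s[OF _ False] by (auto simp: cycles_def)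
    moreover have "boundaries T Q j = boundaries T Q' j"
    proof (cases "j + 1 = card \<sigma>")
      case False2: False
      have "chain_space T Q (j + 1) = chain_space T Q' (j + 1)"
        unfolding ch' using ch_s ch_t False False2 by auto
      then show ?thesis unfolding bd by (simp add: boundaries_def)
    next
      case True
      show ?thesis
      proof
        show "boundaries T Q' j \<subseteq> boundaries T Q j" unfolding bd unfolding boundaries_def ch' by auto
      next
        show "boundaries T Q j \<subseteq> boundaries T Q' j"
        proof
          fix g assume "g \<in> boundaries T Q j"
          then obtain f where f: "f \<in> chain_space T Q (j + 1)" "g = boundary Q (j + 1) f"
            unfolding boundaries_def by blast
          \<comment> \<open>As \<epsilon> is its own inverse, this removes the coefficient at
            \<sigma>; since \<open>bt\<close> is a cycle, the boundary stays the same.\<close>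
          let ?f = "f - fscale (f \<sigma> * \<epsilon>) bt"
          have "bt \<in> chain_space T Q (j + 1)" using bt_cyc True by (simp add: cycles_def)
          then have "?f \<in> chain_space T Q (j + 1)"
            using f by (intro subspace_diff_line subspace_chain_space)
          moreover have "?f \<sigma> = 0" using bts ee by (simp add: fscale_def mult.assoc)
          moreover have "?f \<tau> = 0"
            using ch_t[OF f(1)] True btt by (simp add: fscale_def)
          moreover have "boundary Q (j + 1) bt = 0"
            using bt_cyc True by (auto simp: cycles_def)
          then have "boundary Q (j + 1) ?f = g"
            using f by (simp only: boundary_diff boundary_fscale FV.scale_zero_right diff_zero)
          ultimately show "g \<in> boundaries T Q' j" unfolding bd ch' by blast
        qed
      qed
    qed
    ultimately show ?thesis
      using red_betti_same unfolding Q'_def \<tau>_def by blast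
  next
    case True
    have b0: "bt \<sigma> \<noteq> 0" using bts ee by auto
    have "cycles T Q j = {f. \<exists>k. f - fscale k bt \<in> cycles T Q' j}" (is "_ = ?R")
    proof
      show "cycles T Q j \<subseteq> ?R"
      proof
        fix f assume f: "f \<in> cycles T Q j"
        let ?f = "f - fscale (f \<sigma> * \<epsilon>) bt"
        have "?f \<in> cycles T Q j"
          using f bt_cyc[folded True] by (intro subspace_diff_line subspace_cycles)
        moreover have "?f \<sigma> = 0" using bts ee by (simp add: fscale_def mult.assoc)
        moreover have "?f \<tau> = 0" using cyc_t[OF calculation(1)] .
        ultimately show "f \<in> ?R" unfolding cyc' by blast
      qed
    next
      show "?R \<subseteq> cycles T Q j"
      proof
        fix f assume "f \<in> ?R"
        then obtain k where "f - fscale k bt \<in> cycles T Q j" unfolding cyc' by blast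
        then have "(f - fscale k bt) + fscale k bt \<in> cycles T Q j"
          using bt_cyc[folded True] by (intro subspace_add_line subspace_cycles)
        then show "f \<in> cycles T Q j" by simp
      qed
    qed
    moreover have "boundaries T Q j = {f. \<exists>k. f - fscale k bt \<in> boundaries T Q' j}" (is "_ = ?R")
    proof
      show "boundaries T Q j \<subseteq> ?R"
      proof
        fix g assume "g \<in> boundaries T Q j"
        then obtain f where f: "f \<in> chain_space T Q (j + 1)" "g = boundary Q (j + 1) f"
          unfolding boundaries_def by blast
        let ?f = "f - fscale (f \<tau>) (single \<tau>)"
        have h1: "?f \<in> chain_space T Q (j + 1)"
          using f sing[folded True] by (intro subspace_diff_line subspace_chain_space)
        have h2: "?f \<tau> = 0" by (simp add: fscale_def single_def)
        have h3: "?f \<sigma> = 0"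
          using ch_s[OF f(1)] True st by (simp add: fscale_def single_def)
        have h4: "g - fscale (f \<tau>) bt = boundary Q (j + 1) ?f"
          using f True by (simp add: boundary_diff boundary_fscale bt_def)
        show "g \<in> ?R"
          unfolding bd ch' by (rule CollectI exI image_eqI[where x = ?f and f = "boundary Q (j + 1)", OF h4] conjI h1 h2 h3)+
      qed
    next
      show "?R \<subseteq> boundaries T Q j"
      proof
        fix f assume "f \<in> ?R"
        then obtain k where "f - fscale k bt \<in> boundaries T Q j"
          unfolding bd unfolding ch' boundaries_def by blast
        moreover have "bt \<in> boundaries T Q j"
          using sing True unfolding bt_def boundaries_def by blast
        ultimately have "(f - fscale k bt) + fscale k bt \<in> boundaries T Q j"
          by (intro subspace_add_line subspace_boundaries)
        then show "f \<in> boundaries T Q j" by simp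
      qed
    qed
    moreover have "bt \<notin> cycles T Q' j" using b0 by (auto simp: cyc')
    moreover have "bt \<notin> boundaries T Q' j"
      using b0 boundary_outside[of \<sigma> Q' "j + 1"] unfolding boundaries_def Q'_def by auto
    moreover have "finite Q'" using fin by (simp add: Q'_def)
    ultimately show ?thesis
      unfolding Q'_def \<tau>_def by (intro red_betti_line[symmetric])
  qed
qed

text \<open>Here \<sigma> has no facet in \<open>Q\<close> and the boundary of \<tau> is a unit
  times \<sigma>, so the two span an acyclic subcomplex and deleting them amounts to taking the
  quotient. The chain map \<open>pr\<close> is onto for cycles and boundaries, and its kernel on
  cycles is the line of \<sigma>, which occurs only in degree \<open>card \<sigma>\<close> and
  consists of boundaries.\<close>

lemma red_betti_cancel_unique_facet:
  fixes T :: "'k::field itself"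
  assumes Q: "convex_family Q" and s: "\<sigma> \<in> Q" and c: "c \<notin> \<sigma>" and t: "insert c \<sigma> \<in> Q"
    and uniq: "\<And>v. v \<in> \<sigma> \<Longrightarrow> insert c \<sigma> - {v} \<notin> Q"
  shows "red_betti T (Q - {\<sigma>, insert c \<sigma>}) j = red_betti T Q j"
proof -
  define \<tau> where "\<tau> = insert c \<sigma>"
  define Q' where "Q' = Q - {\<sigma>, \<tau>}"
  define \<epsilon> :: 'k where "\<epsilon> = (-1) ^ card {w \<in> \<sigma>. w < c}"
  define pr :: "(nat set \<Rightarrow> 'k) \<Rightarrow> (nat set \<Rightarrow> 'k)"
    where "pr = (\<lambda>f G. if G = \<sigma> \<or> G = \<tau> then 0 else f G)"
  note fin = convex_family_finite[OF Q]
  have fs: "finite \<sigma>" using fin s by blast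
  have ct: "card \<tau> = card \<sigma> + 1" using fs c by (simp add: \<tau>_def)
  have st: "\<sigma> \<noteq> \<tau>" using c by (auto simp: \<tau>_def)
  have ee: "\<epsilon> * \<epsilon> = 1" unfolding \<epsilon>_def by (rule minus_one_power_square)
  have facet_t: "H = \<sigma>" if "H \<in> Q" "v \<notin> H" "insert v H = \<tau>" for H v
  proof -
    have H: "H = \<tau> - {v}" "v \<in> \<tau>" using that by auto
    then have "v = c" using uniq that unfolding \<tau>_def by blast
    then show ?thesis using H c by (auto simp: \<tau>_def)
  qed
  \<comment> \<open>If \<open>H\<close> were a facet of \<sigma> missing \<open>v\<close>, then
    \<open>\<tau> - {v}\<close> would lie between \<open>H\<close> and \<tau>, hence in
    \<open>Q\<close> by convexity.\<close>
  have facet_s: "insert v H \<noteq> \<sigma>" if "H \<in> Q" "v \<notin> H" for H v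
  proof
    assume "insert v H = \<sigma>"
    then have v: "v \<in> \<sigma>" "H \<subseteq> \<tau> - {v}" "\<tau> - {v} \<subseteq> \<tau>" using that by (auto simp: \<tau>_def)
    then have "\<tau> - {v} \<in> Q" using Q that(1) t unfolding convex_family_def \<tau>_def by meson
    then show False using uniq v unfolding \<tau>_def by blast
  qed
  have bs: "boundary Q i (fscale a (single \<sigma>)) = 0" for i and a :: 'k
  proof
    fix H show "boundary Q i (fscale a (single \<sigma>)) H = 0 H"
      unfolding boundary_def using facet_s
      by (auto simp: fscale_def single_def intro!: sum.neutral)
  qed
  have bt: "boundary Q (card \<sigma> + 1) (fscale a (single \<tau>)) = fscale (\<epsilon> * a) (single \<sigma>)" for a
  proof
    fix H show "boundary Q (card \<sigma> + 1) (fscale a (single \<tau>)) H = fscale (\<epsilon> * a) (single \<sigma>) H"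
    proof (cases "H = \<sigma>")
      case True
      have "(\<Sum>v\<in>{v. v \<notin> \<sigma> \<and> insert v \<sigma> \<in> Q}. (-1) ^ card {w \<in> \<sigma>. w < v} * fscale a (single \<tau>) (insert v \<sigma>))
         = (\<Sum>v\<in>{c}. (-1) ^ card {w \<in> \<sigma>. w < v} * fscale a (single \<tau>) (insert v \<sigma>))"
      proof (rule sum.mono_neutral_right)
        show "finite {v. v \<notin> \<sigma> \<and> insert v \<sigma> \<in> Q}"
          by (rule finite_subset[OF _ fin(3)]) blast
      qed (use c t in \<open>auto simp: fscale_def single_def \<tau>_def\<close>)
      then show ?thesis
        using True boundary_apply[OF s refl, of "fscale a (single \<tau>)"]
        by (simp add: fscale_def single_def \<epsilon>_def \<tau>_def)
    next
      case False
      have "fscale a (single \<tau>) (insert v H) = 0" if "H \<in> Q" "v \<notin> H" for v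
        using facet_t[OF that] False by (auto simp: fscale_def single_def)
      then have "boundary Q (card \<sigma> + 1) (fscale a (single \<tau>)) H = 0"
        unfolding boundary_def by (auto intro!: sum.neutral)
      then show ?thesis using False by (simp add: fscale_def single_def)
    qed
  qed
  have lin: "Vector_Spaces.linear fscale fscale pr"
    unfolding Vector_Spaces.linear_iff
    by (auto simp: FV.vector_space_axioms pr_def fun_eq_iff fscale_def)
  have pr_add: "pr (f + g) = pr f + pr g" for f g
    by (auto simp: pr_def fun_eq_iff)
  have pr_id: "pr f = f" if "f \<sigma> = 0" "f \<tau> = 0" for f
    using that by (auto simp: pr_def fun_eq_iff)
  have dec: "f = pr f + fscale (f \<sigma>) (single \<sigma>) + fscale (f \<tau>) (single \<tau>)" for f
    using st by (auto simp: pr_def fscale_def single_def fun_eq_iff)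
  have bQ': "boundary Q' i f = pr (boundary Q i f)" if "f \<sigma> = 0" "f \<tau> = 0" for i and f :: "nat set \<Rightarrow> 'k"
  proof
    fix H show "boundary Q' i f H = pr (boundary Q i f) H"
    proof (cases "H \<in> Q'")
      case True
      then have "boundary Q' i f H = boundary Q i f H"
        by (intro boundary_subfamily[OF fin(3)]) (use that in \<open>auto simp: Q'_def\<close>)
      then show ?thesis using True by (auto simp: pr_def Q'_def)
    next
      case False
      then have "boundary Q' i f H = 0" by (simp add: boundary_outside)
      moreover have "pr (boundary Q i f) H = 0"
        using False by (cases "H \<in> Q") (auto simp: Q'_def boundary_outside pr_def)
      ultimately show ?thesis by simp
    qed
  qed
  have ch': "chain_space T Q' i = {f \<in> chain_space T Q i. f \<sigma> = 0 \<and> f \<tau> = 0}" for i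
    unfolding chain_space_def Q'_def by blast
  have pr_ch: "pr f \<in> chain_space T Q' i" if "f \<in> chain_space T Q i" for f i
    using that unfolding chain_space_def Q'_def pr_def by auto
  have ch_s: "f \<sigma> = 0" if "f \<in> chain_space T Q i" "i \<noteq> card \<sigma>" for f i
    by (rule chain_spaceD[OF that(1)]) (use that(2) in simp)
  have ch_t: "f \<tau> = 0" if "f \<in> chain_space T Q i" "i \<noteq> card \<sigma> + 1" for f i
    by (rule chain_spaceD[OF that(1)]) (use that(2) ct in simp)
  have bch: "boundary Q (i + 1) f \<in> chain_space T Q i" for i f
    by (rule boundary_in_chain_space)
  have single_t: "fscale a (single \<tau>) \<in> chain_space T Q (card \<sigma> + 1)" for a
    using t ct by (auto simp: chain_space_def single_def fscale_def \<tau>_def)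
  have sub: "chain_space T Q' i \<subseteq> chain_space T Q i" for i unfolding ch' by blast
  have pr0: "pr 0 = 0" by (simp add: pr_def fun_eq_iff)
  have sep: "f = fscale (f \<sigma>) (single \<sigma>) + fscale (f \<tau>) (single \<tau>)" if "pr f = 0" for f
    using dec[of f] that by simp
  have eb: "b = 0" if "fscale (\<epsilon> * b) (single \<sigma>) = (0 :: nat set \<Rightarrow> 'k)" for b
    using fun_cong[OF that, of \<sigma>] ee by (auto simp: fscale_def single_def)
  have chain_map: "boundary Q' i (pr f) = pr (boundary Q i f)" if f: "f \<in> chain_space T Q i" for f i
  proof -
    have t0: "pr (boundary Q i (fscale (f \<tau>) (single \<tau>))) = 0"
    proof (cases "i = card \<sigma> + 1")
      case True
      then show ?thesis unfolding True bt by (auto simp: pr_def fscale_def single_def fun_eq_iff)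
    next
      case False
      then have "f \<tau> = 0" using ch_t[OF f] by simp
      then show ?thesis by (simp add: pr0)
    qed
    have "pr (boundary Q i f) = pr (boundary Q i (pr f))"
      using arg_cong[OF dec[of f], of "\<lambda>f. pr (boundary Q i f)"]
      by (simp only: boundary_add pr_add bs t0 pr0 add_0_right)
    then show ?thesis using bQ'[of "pr f" i] by (simp add: pr_def)
  qed
  have cyc: "cycles T Q' j = pr ` cycles T Q j"
  proof
    show "pr ` cycles T Q j \<subseteq> cycles T Q' j"
      using chain_map pr_ch pr0 by (auto simp: cycles_alt)
    show "cycles T Q' j \<subseteq> pr ` cycles T Q j"
    proof
      fix g assume "g \<in> cycles T Q' j"
      then have g: "g \<in> chain_space T Q' j" "boundary Q' j g = 0" by (auto simp: cycles_alt)
      then have g0: "g \<sigma> = 0" "g \<tau> = 0" and gQ: "g \<in> chain_space T Q j" by (auto simp: ch')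
      let ?h = "boundary Q j g"
      have h: "?h = fscale (?h \<sigma>) (single \<sigma>) + fscale (?h \<tau>) (single \<tau>)"
        using sep[of ?h] bQ'[OF g0, of j] g(2) by simp
      have hc: "?h \<in> chain_space T Q (j - 1)" if "j \<noteq> 0" using bch[of "j - 1" g] that by simp
      have hj: "?h = 0" if "j = 0" using that by (auto simp: boundary_def)
      \<comment> \<open>Taking the boundary once more gives 0 on one side and \<epsilon> times this
        coefficient at \<sigma> on the other.\<close>
      have "?h \<tau> = 0"
      proof (cases "j = card \<sigma> + 2")
        case True
        have "fscale (\<epsilon> * ?h \<tau>) (single \<sigma>) = boundary Q (card \<sigma> + 1) ?h"
          using arg_cong[OF h, of "boundary Q (card \<sigma> + 1)"] by (simp only: boundary_add bs bt add_0_left)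
        also have "\<dots> = 0" using boundary_boundary[OF Q, of "card \<sigma> + 1" g] True by simp
        finally show ?thesis by (rule eb)
      next
        case False
        then show ?thesis using ch_t[OF hc] hj by (cases "j = 0") auto
      qed
      then have h: "?h = fscale (?h \<sigma>) (single \<sigma>)" using h by simp
      show "g \<in> pr ` cycles T Q j"
      proof (cases "j = card \<sigma> + 1")
        case True
        \<comment> \<open>The remaining defect is a multiple of \<sigma>, hence of the boundary of
          \<tau>. Correcting \<open>g\<close> by a multiple of \<tau> makes it a cycle of
          \<open>Q\<close> with the same image under \<open>pr\<close>.\<close>
        let ?f = "g - fscale (\<epsilon> * ?h \<sigma>) (single \<tau>)"
        have "boundary Q j ?f = ?h - fscale (?h \<sigma>) (single \<sigma>)"
          using bt[of "\<epsilon> * ?h \<sigma>"] ee True by (simp add: boundary_diff mult.assoc[symmetric])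
        then have "boundary Q j ?f = 0" using h by simp
        moreover have "?f \<in> chain_space T Q j"
          using FV.subspace_diff[OF subspace_chain_space gQ single_t[of "\<epsilon> * ?h \<sigma>", folded True]] .
        moreover have "pr ?f = g"
          using g0 st by (auto simp: pr_def fscale_def single_def fun_eq_iff)
        ultimately show ?thesis by (intro image_eqI[where x = ?f]) (simp_all add: cycles_alt)
      next
        case False
        then have "?h \<sigma> = 0" using ch_s[OF hc] hj by (cases "j = 0") auto
        then have "?h = 0" using h by simp
        then show ?thesis using gQ pr_id[OF g0] by (intro image_eqI[where x = g]) (simp_all add: cycles_alt)
      qed
    qed
  qed
  have bnd: "boundaries T Q' j = pr ` boundaries T Q j"
  proof
    show "pr ` boundaries T Q j \<subseteq> boundaries T Q' j"
      using chain_map[of _ "j + 1"] pr_ch[of _ "j + 1"] by (force simp: boundaries_def)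
    show "boundaries T Q' j \<subseteq> pr ` boundaries T Q j"
    proof
      fix f assume "f \<in> boundaries T Q' j"
      then obtain g where g: "g \<in> chain_space T Q' (j + 1)" "f = boundary Q' (j + 1) g"
        unfolding boundaries_def by blast
      then have "f = pr (boundary Q (j + 1) g)" using bQ'[of g "j + 1"] by (simp add: ch')
      then show "f \<in> pr ` boundaries T Q j" using g sub unfolding boundaries_def by blast
    qed
  qed
  have ker: "f = fscale (f \<sigma>) (single \<sigma>)" if f: "f \<in> cycles T Q j" "pr f = 0" for f
  proof -
    have fc: "f \<in> chain_space T Q j" "boundary Q j f = 0" using f by (auto simp: cycles_alt)
    have "f \<tau> = 0"
    proof (cases "j = card \<sigma> + 1")
      case True
      have "fscale (\<epsilon> * f \<tau>) (single \<sigma>) = boundary Q j f"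
        using arg_cong[OF sep[OF f(2)], of "boundary Q j"] True by (simp only: boundary_add bs bt add_0_left)
      also have "\<dots> = 0" by (rule fc(2))
      finally show ?thesis by (rule eb)
    qed (rule ch_t[OF fc(1)])
    then show ?thesis using sep[OF f(2)] by simp
  qed
  show ?thesis
  proof (cases "j = card \<sigma>")
    case True
    have line: "V = {f. \<exists>c. f - fscale c (single \<sigma>) \<in> pr ` V}"
      if V: "FV.subspace V" "V \<subseteq> chain_space T Q j" "single \<sigma> \<in> V" for V
    proof -
      have pr_V: "pr f = f - fscale (f \<sigma>) (single \<sigma>)" if "f \<in> V" for f
      proof -
        have "f \<tau> = 0" using ch_t[of f j] V(2) that True by auto
        then show ?thesis using dec[of f] by (simp add: algebra_simps)
      qed
      show ?thesis
      proof (intro set_eqI iffI)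
        fix f assume f: "f \<in> V"
        then have "f - fscale (f \<sigma>) (single \<sigma>) \<in> pr ` V" using pr_V by (metis imageI)
        then show "f \<in> {f. \<exists>c. f - fscale c (single \<sigma>) \<in> pr ` V}" by blast
      next
        fix f assume "f \<in> {f. \<exists>c. f - fscale c (single \<sigma>) \<in> pr ` V}"
        then obtain c g where g: "g \<in> V" "f - fscale c (single \<sigma>) = pr g" by auto
        then have "f - fscale c (single \<sigma>) \<in> V" using pr_V subspace_diff_line[OF V(1) _ V(3)] by simp
        then have "(f - fscale c (single \<sigma>)) + fscale c (single \<sigma>) \<in> V"
          by (rule subspace_add_line[OF V(1) _ V(3)])
        then show "f \<in> V" by simp
      qed
    qed
    have "boundary Q (card \<sigma> + 1) (fscale \<epsilon> (single \<tau>)) = single \<sigma>" using bt[of \<epsilon>] ee by simp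
    then have sB: "single \<sigma> \<in> boundaries T Q j"
      using single_t[of \<epsilon>] True unfolding boundaries_def by (metis imageI)
    have "single \<sigma> \<notin> chain_space T Q' j" by (auto simp: ch' single_def)
    then have n: "single \<sigma> \<notin> cycles T Q' j" "single \<sigma> \<notin> boundaries T Q' j"
      using boundary_in_chain_space[of Q' j _ T] by (auto simp: cycles_def boundaries_def)
    have B: "boundaries T Q j \<subseteq> cycles T Q j" by (rule boundaries_subset_cycles[OF Q])
    have Z: "cycles T Q j \<subseteq> chain_space T Q j" by (auto simp: cycles_def)
    have "finite Q'" using fin by (simp add: Q'_def)
    have sZ: "single \<sigma> \<in> cycles T Q j" and BC: "boundaries T Q j \<subseteq> chain_space T Q j"
      using sB B Z by blast+
    have "red_betti T Q j = red_betti T Q' j"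
      by (rule red_betti_line[OF \<open>finite Q'\<close> n])
         (unfold cyc bnd, rule line[OF subspace_cycles Z sZ], rule line[OF subspace_boundaries BC sB])
    then show ?thesis unfolding Q'_def \<tau>_def by simp
  next
    case False
    have inj: "f = 0" if f: "f \<in> cycles T Q j" "pr f = 0" for f
    proof -
      have "f \<sigma> = 0" using ch_s[of f j] f False by (simp add: cycles_def)
      then show ?thesis using ker[OF f] by simp
    qed
    have "FV.dim (cycles T Q' j) = FV.dim (cycles T Q j)"
      unfolding cyc by (rule dim_inj_image[OF subspace_cycles lin inj])
    moreover have "FV.dim (boundaries T Q' j) = FV.dim (boundaries T Q j)"
      unfolding bnd
      by (rule dim_inj_image[OF subspace_boundaries lin]) (use inj boundaries_subset_cycles[OF Q] in blast)
    ultimately show ?thesis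
      unfolding red_betti_eq Q'_def \<tau>_def by simp
  qed
qed

text \<open>By convexity every member of \<open>Q\<close> that contains \<sigma> is one of the two
  removed faces, so neither of them can lie between two surviving members.\<close>

lemma convex_family_remove_upper_pair:
  assumes Q: "convex_family Q" and s: "\<sigma> \<in> Q"
    and uniq: "\<And>v. v \<notin> \<sigma> \<Longrightarrow> insert v \<sigma> \<in> Q \<Longrightarrow> v = c"
  shows "convex_family (Q - {\<sigma>, insert c \<sigma>})"
proof -
  have up: "B = \<sigma> \<or> B = insert c \<sigma>" if "B \<in> Q" "\<sigma> \<subseteq> B" for B
  proof -
    have "v = c" if v: "v \<in> B - \<sigma>" for v
    proof (rule uniq)
      show "insert v \<sigma> \<in> Q"
        using Q s \<open>B \<in> Q\<close> \<open>\<sigma> \<subseteq> B\<close> v unfolding convex_family_def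
        by (metis DiffE insert_subset subset_insertI)
    qed (use v in auto)
    then show ?thesis using that by blast
  qed
  show ?thesis
    unfolding convex_family_def
  proof (intro conjI ballI allI impI)
    fix A B X assume AB: "A \<in> Q - {\<sigma>, insert c \<sigma>}" "B \<in> Q - {\<sigma>, insert c \<sigma>}" "A \<subseteq> X \<and> X \<subseteq> B"
    then have "X \<in> Q" using Q unfolding convex_family_def by blast
    moreover have "X \<noteq> \<sigma>" "X \<noteq> insert c \<sigma>" using up[of B] AB by blast+
    ultimately show "X \<in> Q - {\<sigma>, insert c \<sigma>}" by blast
  qed (use Q in \<open>auto simp: convex_family_def\<close>)
qed

lemma convex_family_remove_lower_pair:
  assumes Q: "convex_family Q" and c: "c \<notin> \<sigma>" and t: "insert c \<sigma> \<in> Q"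
    and uniq: "\<And>v. v \<in> \<sigma> \<Longrightarrow> insert c \<sigma> - {v} \<notin> Q"
  shows "convex_family (Q - {\<sigma>, insert c \<sigma>})"
proof -
  have dn: "A = \<sigma> \<or> A = insert c \<sigma>" if "A \<in> Q" "A \<subseteq> insert c \<sigma>" for A
  proof -
    have False if v: "v \<in> \<sigma> - A" for v
    proof -
      have "insert c \<sigma> - {v} \<in> Q"
        using Q t \<open>A \<in> Q\<close> \<open>A \<subseteq> insert c \<sigma>\<close> v unfolding convex_family_def
        by (metis Diff_subset DiffE subset_Diff_insert Diff_empty)
      then show False using uniq v by blast
    qed
    then show ?thesis using that c by blast
  qed
  show ?thesis
    unfolding convex_family_def
  proof (intro conjI ballI allI impI)
    fix A B X assume AB: "A \<in> Q - {\<sigma>, insert c \<sigma>}" "B \<in> Q - {\<sigma>, insert c \<sigma>}" "A \<subseteq> X \<and> X \<subseteq> B"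
    then have "X \<in> Q" using Q unfolding convex_family_def by blast
    moreover have "X \<noteq> \<sigma>" "X \<noteq> insert c \<sigma>" using dn[of A] AB by blast+
    ultimately show "X \<in> Q - {\<sigma>, insert c \<sigma>}" by blast
  qed (use Q in \<open>auto simp: convex_family_def\<close>)
qed

text \<open>Adding or deleting \<open>c\<close> matches the faces of \<open>R\<close> in pairs.
  Since \<open>R\<close> is closed upwards, a face without \<open>c\<close> of largest cardinality
  has its partner as its only coface in \<open>Q\<close>. This pair is cancelled first, and the rest
  satisfies the same hypotheses.\<close>

lemma red_betti_remove_upper_cone:
  fixes T :: "'k::field itself"
  assumes "convex_family Q" "R \<subseteq> Q" "\<And>G H. G \<in> R \<Longrightarrow> H \<in> Q \<Longrightarrow> G \<subseteq> H \<Longrightarrow> H \<in> R"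
    "\<And>G. G \<in> R \<Longrightarrow> insert c G \<in> R \<and> G - {c} \<in> R"
  shows "red_betti T (Q - R) j = red_betti T Q j"
  using assms
proof (induction "card R" arbitrary: Q R rule: less_induct)
  case less
  have fR: "finite R" using less.prems(1,2) convex_family_finite finite_subset by blast
  show ?case
  proof (cases "R = {}")
    case False
    let ?M = "{G \<in> R. c \<notin> G}"
    have M: "finite ?M" "?M \<noteq> {}" using fR False less.prems(4) by auto
    then have "Max (card ` ?M) \<in> card ` ?M" by (intro Max_in) auto
    then obtain \<sigma> where s: "\<sigma> \<in> ?M" "card \<sigma> = Max (card ` ?M)" by force
    then have smax: "card G \<le> card \<sigma>" if "G \<in> ?M" for G
      using that M Max_ge[of "card ` ?M" "card G"] by simp
    have sQ: "\<sigma> \<in> Q" "c \<notin> \<sigma>" "insert c \<sigma> \<in> Q" "insert c \<sigma> \<in> R" "\<sigma> \<in> R"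
      using s less.prems(2,4) by blast+
    have fs: "finite \<sigma>" using sQ(1) less.prems(1) convex_family_finite by blast
    have uniq: "v = c" if "v \<notin> \<sigma>" "insert v \<sigma> \<in> Q" for v
    proof (rule ccontr)
      assume "v \<noteq> c"
      then have "insert v \<sigma> \<in> ?M" using less.prems(3)[of \<sigma> "insert v \<sigma>"] sQ that by blast
      then show False using smax[of "insert v \<sigma>"] that fs by simp
    qed
    let ?Q = "Q - {\<sigma>, insert c \<sigma>}" and ?R = "R - {\<sigma>, insert c \<sigma>}"
    have cR: "card ?R < card R"
      by (rule psubset_card_mono[OF fR]) (use sQ in blast)
    have cQ: "convex_family ?Q"
      by (rule convex_family_remove_upper_pair[OF less.prems(1) sQ(1) uniq])
    have cone: "insert c G \<in> ?R \<and> G - {c} \<in> ?R" if "G \<in> ?R" for G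
      using less.prems(4)[of G] that sQ(2) by (auto simp: insert_absorb)
    have closed: "H \<in> ?R" if "G \<in> ?R" "H \<in> ?Q" "G \<subseteq> H" for G H
      using less.prems(3)[of G H] that by blast
    have "?R \<subseteq> ?Q" using less.prems(2) by blast
    then have "red_betti T (?Q - ?R) j = red_betti T ?Q j"
      by (rule less.hyps[OF cR cQ _ closed cone])
    also have "\<dots> = red_betti T Q j"
      by (rule red_betti_cancel_unique_coface[OF less.prems(1) sQ(1-3) uniq])
    also have "?Q - ?R = Q - R" using sQ by blast
    finally show ?thesis .
  qed simp
qed

text \<open>The dual argument starts with a smallest face of \<open>R\<close> without
  \<open>c\<close>: it is the only facet in \<open>Q\<close> of its partner.\<close>

lemma red_betti_remove_lower_cone:
  fixes T :: "'k::field itself"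
  assumes "convex_family Q" "R \<subseteq> Q" "\<And>G H. G \<in> R \<Longrightarrow> H \<in> Q \<Longrightarrow> H \<subseteq> G \<Longrightarrow> H \<in> R"
    "\<And>G. G \<in> R \<Longrightarrow> insert c G \<in> R \<and> G - {c} \<in> R"
  shows "red_betti T (Q - R) j = red_betti T Q j"
  using assms
proof (induction "card R" arbitrary: Q R rule: less_induct)
  case less
  have fR: "finite R" using less.prems(1,2) convex_family_finite finite_subset by blast
  show ?case
  proof (cases "R = {}")
    case False
    let ?M = "{G \<in> R. c \<notin> G}"
    have "\<exists>G. G \<in> ?M" using False less.prems(4) by blast
    then obtain \<sigma> where s: "\<sigma> \<in> ?M" and smin: "\<And>G. G \<in> ?M \<Longrightarrow> card \<sigma> \<le> card G"
      using ex_has_least_nat[of "\<lambda>G. G \<in> ?M" _ card] by blast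
    have sQ: "\<sigma> \<in> Q" "c \<notin> \<sigma>" "insert c \<sigma> \<in> Q" "insert c \<sigma> \<in> R" "\<sigma> \<in> R"
      using s less.prems(2,4) by blast+
    have fs: "finite \<sigma>" using sQ(1) less.prems(1) convex_family_finite by blast
    have uniq: "insert c \<sigma> - {v} \<notin> Q" if "v \<in> \<sigma>" for v
    proof
      assume "insert c \<sigma> - {v} \<in> Q"
      then have "insert c \<sigma> - {v} \<in> R" using less.prems(3)[of "insert c \<sigma>"] sQ by blast
      then have "insert c \<sigma> - {v} - {c} \<in> R" using less.prems(4) by blast
      moreover have "insert c \<sigma> - {v} - {c} = \<sigma> - {v}" using sQ(2) by blast
      ultimately have "\<sigma> - {v} \<in> ?M" using sQ by auto
      then have "card \<sigma> \<le> card (\<sigma> - {v})" by (rule smin)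
      then show False using that fs by (metis card_Diff1_less not_le)
    qed
    let ?Q = "Q - {\<sigma>, insert c \<sigma>}" and ?R = "R - {\<sigma>, insert c \<sigma>}"
    have cR: "card ?R < card R"
      by (rule psubset_card_mono[OF fR]) (use sQ in blast)
    have cQ: "convex_family ?Q"
      by (rule convex_family_remove_lower_pair[OF less.prems(1) sQ(2,3) uniq])
    have cone: "insert c G \<in> ?R \<and> G - {c} \<in> ?R" if "G \<in> ?R" for G
      using less.prems(4)[of G] that sQ(2) by (auto simp: insert_absorb)
    have closed: "H \<in> ?R" if "G \<in> ?R" "H \<in> ?Q" "H \<subseteq> G" for G H
      using less.prems(3)[of G H] that by blast
    have "?R \<subseteq> ?Q" using less.prems(2) by blast
    then have "red_betti T (?Q - ?R) j = red_betti T ?Q j"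
      by (rule less.hyps[OF cR cQ _ closed cone])
    also have "\<dots> = red_betti T Q j"
      by (rule red_betti_cancel_unique_facet[OF less.prems(1) sQ(1-3) uniq])
    also have "?Q - ?R = Q - R" using sQ by blast
    finally show ?thesis .
  qed simp
qed

text \<open>Adding \<open>p\<close> to every face raises the degree by one. The sign
  \<open>e\<close> records the position of \<open>p\<close> among the vertices; with it the shift
  \<open>Sh\<close> anticommutes with the boundary, which suffices to match kernels and
  images.\<close>

lemma red_betti_cone_shift:
  fixes T :: "'k::field itself"
  assumes fin: "finite K" "\<And>G. G \<in> K \<Longrightarrow> finite G" and p: "\<And>G. G \<in> K \<Longrightarrow> p \<notin> G"
  shows "red_betti T (insert p ` K) (Suc j) = red_betti T K j" "red_betti T (insert p ` K) 0 = 0"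
proof -
  let ?L = "insert p ` K"
  define e :: "nat set \<Rightarrow> 'k" where "e = (\<lambda>G. (-1) ^ card {w \<in> G. w < p})"
  define Sh :: "(nat set \<Rightarrow> 'k) \<Rightarrow> (nat set \<Rightarrow> 'k)"
    where "Sh = (\<lambda>f G. if p \<in> G then e (G - {p}) * f (G - {p}) else 0)"
  have ee: "e G * e G = 1" for G unfolding e_def by (rule minus_one_power_square)
  have Sh_ins: "Sh f (insert p G) = e G * f G" if "p \<notin> G" for f G
    using that by (simp add: Sh_def)
  have lin: "Vector_Spaces.linear fscale fscale Sh"
    unfolding Vector_Spaces.linear_iff
    by (auto simp: FV.vector_space_axioms Sh_def fun_eq_iff fscale_def algebra_simps)
  have L: "insert p G \<in> ?L \<longleftrightarrow> G \<in> K" if "p \<notin> G" for G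
  proof
    assume "insert p G \<in> ?L"
    then obtain G' where "G' \<in> K" "insert p G = insert p G'" by blast
    then show "G \<in> K" using p that by (metis insert_ident)
  qed blast
  have b: "boundary ?L (Suc i) (Sh f) = - Sh (boundary K i f)" for i f
  proof
    fix H
    show "boundary ?L (Suc i) (Sh f) H = (- Sh (boundary K i f)) H"
    proof (cases "H \<in> ?L")
      case True
      then obtain H0 where H0: "H = insert p H0" "H0 \<in> K" "p \<notin> H0" "finite H0" using p fin by blast
      show ?thesis
      proof (cases "card H0 + 1 = i")
        case i: True
        have set: "{v. v \<notin> H \<and> insert v H \<in> ?L} = {v. v \<notin> H0 \<and> insert v H0 \<in> K}"
        proof (intro set_eqI iffI)
          fix v assume v: "v \<in> {v. v \<notin> H \<and> insert v H \<in> ?L}"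
          then have "insert p (insert v H0) \<in> ?L" "p \<notin> insert v H0" using H0 by (auto simp: insert_commute)
          then have "insert v H0 \<in> K" using L by metis
          then show "v \<in> {v. v \<notin> H0 \<and> insert v H0 \<in> K}" using v H0 by simp
        next
          fix v assume v: "v \<in> {v. v \<notin> H0 \<and> insert v H0 \<in> K}"
          then have "v \<noteq> p" using p by blast
          then show "v \<in> {v. v \<notin> H \<and> insert v H \<in> ?L}" using v H0 by (auto simp: insert_commute)
        qed
        have tm: "(-1) ^ card {w \<in> H. w < v} * Sh f (insert v H)
            = - e H0 * ((-1) ^ card {w \<in> H0. w < v} * f (insert v H0))"
          if v: "v \<notin> H0" "insert v H0 \<in> K" for v
        proof -
          have vp: "v \<noteq> p" using p v by blast
          have "Sh f (insert v H) = e (insert v H0) * f (insert v H0)"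
            using Sh_ins[of "insert v H0" f] vp H0 by (simp add: insert_commute)
          moreover have "(-1) ^ card {w \<in> H. w < v} * e (insert v H0)
              = - e H0 * (-1) ^ card {w \<in> H0. w < v}"
            unfolding e_def H0(1)
            using card_below_insert[OF H0(4,3), of v] card_below_insert[OF H0(4) v(1), of p] vp
            by (cases "v < p") auto
          ultimately show ?thesis by (simp only: mult.assoc[symmetric])
        qed
        have "boundary ?L (Suc i) (Sh f) H =
            (\<Sum>v\<in>{v. v \<notin> H0 \<and> insert v H0 \<in> K}. (-1) ^ card {w \<in> H. w < v} * Sh f (insert v H))"
          using boundary_apply[OF True, of "Suc i" "Sh f"] i H0 unfolding set by simp
        also have "\<dots> = (\<Sum>v\<in>{v. v \<notin> H0 \<and> insert v H0 \<in> K}. - e H0 * ((-1) ^ card {w \<in> H0. w < v} * f (insert v H0)))"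
          by (rule sum.cong[OF refl], rule tm) auto
        also have "\<dots> = - e H0 * boundary K i f H0"
          using boundary_apply[OF H0(2) i, of f] by (simp only: sum_distrib_left)
        finally show ?thesis using Sh_ins[OF H0(3)] H0(1) by simp
      next
        case False
        then have "boundary K i f H0 = 0" "boundary ?L (Suc i) (Sh f) H = 0"
          using H0 by (auto simp: boundary_outside)
        then show ?thesis using Sh_ins[OF H0(3)] H0(1) by simp
      qed
    next
      case False
      then have "Sh (boundary K i f) H = 0"
        using L[of "H - {p}"] by (cases "p \<in> H") (simp_all add: Sh_def insert_absorb boundary_outside)
      then show ?thesis using False by (simp add: boundary_outside)
    qed
  qed
  have ch: "chain_space T ?L (Suc i) = Sh ` chain_space T K i" for i
  proof
    show "Sh ` chain_space T K i \<subseteq> chain_space T ?L (Suc i)"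
    proof clarify
      fix f assume f: "f \<in> chain_space T K i"
      show "Sh f \<in> chain_space T ?L (Suc i)"
      proof (rule chain_spaceI)
        fix G assume G: "Sh f G \<noteq> 0"
        then have "p \<in> G" "f (G - {p}) \<noteq> 0" by (auto simp: Sh_def split: if_splits)
        then have "p \<in> G" "G - {p} \<in> K" "card (G - {p}) = i"
          using chain_spaceD[OF f] by blast+
        moreover have "card (insert p (G - {p})) = Suc (card (G - {p}))"
          by (rule card_insert_disjoint) (use fin(2)[OF \<open>G - {p} \<in> K\<close>] in auto)
        ultimately show "G \<in> ?L \<and> card G = Suc i"
          using L[of "G - {p}"] by (simp add: insert_absorb)
      qed
    qed
  next
    show "chain_space T ?L (Suc i) \<subseteq> Sh ` chain_space T K i"
    proof
      fix g assume g: "g \<in> chain_space T ?L (Suc i)"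
      define f where "f = (\<lambda>G. if p \<in> G then 0 else e G * g (insert p G))"
      have "f \<in> chain_space T K i"
      proof (rule chain_spaceI)
        fix G assume "f G \<noteq> 0"
        then have G: "p \<notin> G" "g (insert p G) \<noteq> 0" by (auto simp: f_def split: if_splits)
        then have "insert p G \<in> ?L" "card (insert p G) = Suc i" using chain_spaceD[OF g] by blast+
        then show "G \<in> K \<and> card G = i" using L[OF G(1)] fin(2)[of G] G(1) by simp
      qed
      moreover have "g = Sh f"
      proof
        fix G show "g G = Sh f G"
        proof (cases "p \<in> G")
          case True
          then show ?thesis using ee[of "G - {p}"]
            by (simp add: Sh_def f_def insert_absorb mult.assoc[symmetric])
        next
          case False
          then have "G \<notin> ?L" by blast
          then show ?thesis using False chain_spaceD[OF g] by (simp add: Sh_def)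
        qed
      qed
      ultimately show "g \<in> Sh ` chain_space T K i" by blast
    qed
  qed
  have inj: "f = 0" if "f \<in> chain_space T K i" "Sh f = 0" for f i
  proof
    fix G show "f G = 0 G"
    proof (cases "G \<in> K")
      case True
      then have "e G * f G = 0" using fun_cong[OF that(2), of "insert p G"] Sh_ins[of G f] p by simp
      then show ?thesis using ee[of G] by auto
    qed (simp add: chain_spaceD[OF that(1)])
  qed
  have Sh0: "Sh 0 = 0" by (auto simp: Sh_def)
  have Shm: "Sh (- f) = - Sh f" for f by (auto simp: Sh_def)
  have bK: "boundary K i f \<in> chain_space T K (i - 1)" if "i > 0" for i f
    using boundary_in_chain_space[of K "i - 1" f T] that by simp
  have b0: "boundary K 0 f = 0" for f :: "nat set \<Rightarrow> 'k"
    by (auto simp: boundary_def)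
  have bz: "boundary K i f = 0 \<longleftrightarrow> boundary ?L (Suc i) (Sh f) = 0" for i f
    unfolding b using inj[OF bK[of i f]] Sh0 b0 by (cases "i = 0") auto
  have "cycles T ?L (Suc j) = Sh ` cycles T K j"
    unfolding cycles_alt ch using bz by blast
  then have "FV.dim (cycles T ?L (Suc j)) = FV.dim (cycles T K j)"
    using dim_inj_image[OF subspace_cycles lin, of T K j] inj by (auto simp: cycles_alt)
  moreover have "boundaries T ?L (Suc j) = Sh ` boundaries T K j"
  proof -
    have "boundary ?L (Suc j + 1) (Sh f) = Sh (boundary K (j + 1) (- f))" for f
    proof -
      have "boundary K (j + 1) (- f) = - boundary K (j + 1) f"
        using boundary_diff[of K "j + 1" 0 f] by simp
      then show ?thesis using b[of "j + 1" f] Shm by simp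
    qed
    \<comment> \<open>The sign from the anticommutation is absorbed because the space of chains is
      closed under negation.\<close>
    moreover have "uminus ` chain_space T K (j + 1) = chain_space T K (j + 1)"
    proof -
      have m: "- f \<in> chain_space T K (j + 1)" if "f \<in> chain_space T K (j + 1)" for f
        using that by (auto simp: chain_space_def)
      show ?thesis
      proof
        show "chain_space T K (j + 1) \<subseteq> uminus ` chain_space T K (j + 1)"
        proof
          fix f assume "f \<in> chain_space T K (j + 1)"
          then show "f \<in> uminus ` chain_space T K (j + 1)"
            using m by (intro image_eqI[where x = "- f"]) auto
        qed
      qed (use m in blast)
    qed
    ultimately show ?thesis
      unfolding boundaries_def Suc_eq_plus1[symmetric] ch
      by (metis (no_types, lifting) image_cong image_image)
  qed
  then have "FV.dim (boundaries T ?L (Suc j)) = FV.dim (boundaries T K j)"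
    using dim_inj_image[OF subspace_boundaries lin, of T K j] inj boundary_in_chain_space[of K j _ T]
    by (auto simp: boundaries_def)
  ultimately show "red_betti T ?L (Suc j) = red_betti T K j" by (simp add: red_betti_eq)
  \<comment> \<open>Every face contains \<open>p\<close>, and finiteness matters because infinite
    sets also have \<open>card\<close> 0.\<close>
  have "chain_space T ?L 0 \<subseteq> FV.span {}"
  proof
    fix f assume f: "f \<in> chain_space T ?L 0"
    have "f G = 0" for G
      by (rule chain_spaceD[OF f]) (use fin(2) in \<open>auto simp: card_gt_0_iff\<close>)
    then have "f = 0" by (auto simp: fun_eq_iff)
    then show "f \<in> FV.span {}" by simp
  qed
  then have "cycles T ?L 0 \<subseteq> FV.span {}" by (auto simp: cycles_def)
  then have "FV.dim (cycles T ?L 0) \<le> 0" using FV.dim_le_card[of "cycles T ?L 0" "{}"] by simp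
  then show "red_betti T ?L 0 = 0" by (simp add: red_betti_eq)
qed

section \<open>Clique complexes\<close>

text \<open>An order complex is the clique complex of the comparability graph, and links in clique
  complexes are again clique complexes, of sets of common neighbours. Thus the sphere conditions and
  the subdivision can be treated in terms of graphs alone.\<close>

definition clique :: "nat set \<Rightarrow> (nat \<Rightarrow> nat \<Rightarrow> bool) \<Rightarrow> nat set set" where
  "clique V E = {C. C \<subseteq> V \<and> (\<forall>x\<in>C. \<forall>y\<in>C. x = y \<or> E x y)}"

definition common_nbrs :: "nat set \<Rightarrow> (nat \<Rightarrow> nat \<Rightarrow> bool) \<Rightarrow> nat set \<Rightarrow> nat set" where
  "common_nbrs V E F = {w \<in> V - F. \<forall>x\<in>F. E x w}"

definition betti_sphere :: "'k::field itself \<Rightarrow> nat set set \<Rightarrow> nat \<Rightarrow> bool" where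
  "betti_sphere T K d \<longleftrightarrow> (\<forall>j. red_betti T K j = (if j = d then 1 else 0))"

definition gor_graph :: "'k::field itself \<Rightarrow> nat set \<Rightarrow> (nat \<Rightarrow> nat \<Rightarrow> bool) \<Rightarrow> nat \<Rightarrow> bool" where
  "gor_graph T V E d \<longleftrightarrow>
     (\<forall>F\<in>clique V E. card F \<le> d \<and> betti_sphere T (clique (common_nbrs V E F) E) (d - card F))"

lemma convex_family_clique: "finite V \<Longrightarrow> convex_family (clique V E)"
  unfolding convex_family_def clique_def
  by (auto intro: finite_subset) (meson subset_iff)+

lemma clique_cong:
  assumes "\<And>x y. x \<in> V \<Longrightarrow> y \<in> V \<Longrightarrow> x \<noteq> y \<Longrightarrow> E x y = E' x y"
  shows "clique V E = clique V E'"
  using assms unfolding clique_def by (metis (no_types, lifting) subset_iff)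

lemma clique_subset: "G \<in> clique V E \<Longrightarrow> H \<subseteq> G \<Longrightarrow> H \<in> clique V E"
  by (auto simp: clique_def)

lemma clique_insertI:
  assumes "\<And>x y. E x y \<longleftrightarrow> E y x" "G \<in> clique V E" "x \<in> V" "\<And>y. y \<in> G \<Longrightarrow> y \<noteq> x \<Longrightarrow> E x y"
  shows "insert x G \<in> clique V E"
proof -
  have "E y x" if "y \<in> G" "y \<noteq> x" for y
    using assms(1)[of x y] assms(4)[OF that] by simp
  note E = this assms(4)
  have G: "G \<subseteq> V" "\<And>y z. y \<in> G \<Longrightarrow> z \<in> G \<Longrightarrow> y = z \<or> E y z"
    using assms(2) by (auto simp: clique_def)
  show ?thesis
    unfolding clique_def
  proof (intro CollectI conjI ballI)
    fix y z assume yz: "y \<in> insert x G" "z \<in> insert x G"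
    show "y = z \<or> E y z"
    proof (cases "y = x")
      case True
      then show ?thesis using E(2)[of z] yz(2) by (cases "z = x") simp_all
    next
      case False
      then show ?thesis using E(1)[of y] G(2)[of y z] yz by (cases "z = x") simp_all
    qed
  qed (use G assms(3) in simp)
qed

lemma link_clique:
  assumes "\<And>x y. E x y \<longleftrightarrow> E y x" "F \<in> clique V E"
  shows "link (clique V E) F = clique (common_nbrs V E F) E"
proof (intro set_eqI iffI)
  fix G assume G: "G \<in> link (clique V E) F"
  have "E x w" if "x \<in> F" "w \<in> G" for x w
  proof -
    have "x \<in> G \<union> F" "w \<in> G \<union> F" "x \<noteq> w" using that G unfolding link_def by auto
    then show ?thesis using G unfolding link_def clique_def by blast
  qed
  then show "G \<in> clique (common_nbrs V E F) E"
    using G unfolding link_def clique_def common_nbrs_def by auto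
next
  fix G assume G: "G \<in> clique (common_nbrs V E F) E"
  have E: "E x w \<and> E w x" if "x \<in> F" "w \<in> G" for x w
    using G that assms(1)[of x w] by (auto simp: clique_def common_nbrs_def)
  have "G \<subseteq> V" "F \<subseteq> V" "G \<inter> F = {}"
    using G assms(2) by (auto simp: clique_def common_nbrs_def)
  moreover have "y = z \<or> E y z" if "y \<in> G \<union> F" "z \<in> G \<union> F" for y z
    using that E[of y z] E[of z y] G assms(2) by (auto simp: clique_def)
  ultimately show "G \<in> link (clique V E) F"
    unfolding link_def clique_def by simp
qed

lemma gorenstein_star_complex_clique:
  assumes "\<And>x y. E x y \<longleftrightarrow> E y x"
  shows "gorenstein_star_complex T (clique V E) d \<longleftrightarrow> gor_graph T V E d"
  unfolding gorenstein_star_complex_def gor_graph_def betti_sphere_def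
  by (rule ball_cong[OF refl]) (simp add: link_clique[OF assms])

text \<open>The link of \<open>x\<close> is a cone with apex \<open>y\<close>: the faces containing
  \<open>x\<close> are closed upwards and under adding or deleting \<open>y\<close>.\<close>

lemma red_betti_dominated_vertex:
  assumes V: "finite V" and sym: "\<And>x y. E x y \<longleftrightarrow> E y x" and xy: "y \<in> V" "x \<noteq> y" "E x y"
    and dom: "\<And>z. z \<in> V \<Longrightarrow> z \<noteq> x \<Longrightarrow> z \<noteq> y \<Longrightarrow> E x z \<Longrightarrow> E y z"
  shows "red_betti T (clique (V - {x}) E) j = red_betti T (clique V E) j"
proof -
  let ?R = "{G \<in> clique V E. x \<in> G}"
  have "insert y G \<in> ?R \<and> G - {y} \<in> ?R" if G: "G \<in> ?R" for G
  proof -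
    have "E y z" if "z \<in> G" "z \<noteq> y" for z
    proof (cases "z = x")
      case False
      have "z \<in> V" "E x z" using G that False unfolding clique_def by auto
      then show ?thesis using dom False that by simp
    qed (use sym[of x y] xy(3) in simp)
    then have "insert y G \<in> clique V E"
      using G xy by (intro clique_insertI sym) auto
    then show ?thesis using G xy clique_subset[of G V E "G - {y}"] by auto
  qed
  then have "red_betti T (clique V E - ?R) j = red_betti T (clique V E) j"
    by (intro red_betti_remove_upper_cone[where c = y] convex_family_clique V) auto
  moreover have "clique V E - ?R = clique (V - {x}) E" by (auto simp: clique_def)
  ultimately show ?thesis by simp
qed

text \<open>The link of the edge \<open>x\<close>--\<open>y\<close> is a cone with apex
  \<open>z\<close>, so the faces containing this edge cancel in pairs that differ in
  \<open>z\<close>.\<close>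

lemma red_betti_remove_edge:
  assumes V: "finite V" and sym: "\<And>x y. E x y \<longleftrightarrow> E y x" and xyz: "z \<in> V" "x \<noteq> y" "z \<noteq> x" "z \<noteq> y" "E x z" "E y z"
    and dom: "\<And>w. w \<in> V \<Longrightarrow> w \<noteq> x \<Longrightarrow> w \<noteq> y \<Longrightarrow> w \<noteq> z \<Longrightarrow> E x w \<Longrightarrow> E y w \<Longrightarrow> E z w"
    and E': "\<And>a b. a \<in> V \<Longrightarrow> b \<in> V \<Longrightarrow> a \<noteq> b \<Longrightarrow> E' a b \<longleftrightarrow> E a b \<and> {a, b} \<noteq> {x, y}"
  shows "red_betti T (clique V E') j = red_betti T (clique V E) j"
proof -
  let ?R = "{G \<in> clique V E. x \<in> G \<and> y \<in> G}"
  have "insert z G \<in> ?R \<and> G - {z} \<in> ?R" if G: "G \<in> ?R" for G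
  proof -
    have "E z w" if "w \<in> G" "w \<noteq> z" for w
    proof (cases "w = x \<or> w = y")
      case False
      have "w \<in> V" "E x w" "E y w" using G that False unfolding clique_def by auto
      then show ?thesis using dom False that by simp
    qed (use sym[of x z] sym[of y z] xyz(5,6) in auto)
    then have "insert z G \<in> clique V E"
      using G xyz by (intro clique_insertI sym) auto
    then show ?thesis using G xyz clique_subset[of G V E "G - {z}"] by auto
  qed
  then have "red_betti T (clique V E - ?R) j = red_betti T (clique V E) j"
    by (intro red_betti_remove_upper_cone[where c = z] convex_family_clique V) auto
  moreover have "clique V E - ?R = clique V E'"
  proof (intro set_eqI iffI)
    fix G assume G: "G \<in> clique V E - ?R"
    have "E' a b" if "a \<in> G" "b \<in> G" "a \<noteq> b" for a b
    proof -
      have "a \<in> V" "b \<in> V" "E a b" "{a, b} \<noteq> {x, y}" using G that by (auto simp: clique_def doubleton_eq_iff)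
      then show ?thesis using E' that by simp
    qed
    then show "G \<in> clique V E'" using G by (auto simp: clique_def)
  next
    fix G assume G: "G \<in> clique V E'"
    have *: "E a b \<and> {a, b} \<noteq> {x, y}" if "a \<in> G" "b \<in> G" "a \<noteq> b" for a b
      using G that E'[of a b] by (auto simp: clique_def)
    then have "\<not> (x \<in> G \<and> y \<in> G)" using xyz by blast
    then show "G \<in> clique V E - ?R" using G * by (auto simp: clique_def)
  qed
  ultimately show ?thesis by simp
qed

text \<open>The faces without \<open>p\<close> form a cone with apex \<open>q\<close> and can be
  cancelled from below, the empty face included. What remains is the family of faces of
  \<open>N\<close> enlarged by \<open>p\<close>, whose homology is shifted by one.\<close>

lemma betti_sphere_suspension:
  assumes N: "finite N" and sym: "\<And>x y. E x y \<longleftrightarrow> E y x" and pq: "p \<notin> N" "q \<notin> N" "p \<noteq> q" "\<not> E p q"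
    and adj: "\<And>n. n \<in> N \<Longrightarrow> E p n \<and> E q n" and sph: "betti_sphere T (clique N E) d"
  shows "betti_sphere T (clique (insert p (insert q N)) E) (Suc d)"
proof -
  let ?V = "insert p (insert q N)"
  let ?R = "{G \<in> clique ?V E. p \<notin> G}"
  have "insert q G \<in> ?R \<and> G - {q} \<in> ?R" if G: "G \<in> ?R" for G
  proof -
    have "E q z" if "z \<in> G" "z \<noteq> q" for z
      using that G adj unfolding clique_def by blast
    then have "insert q G \<in> clique ?V E"
      using G by (intro clique_insertI sym) auto
    then show ?thesis using G pq clique_subset[of G ?V E "G - {q}"] by auto
  qed
  then have "red_betti T (clique ?V E - ?R) j = red_betti T (clique ?V E) j" for j
    using N by (intro red_betti_remove_lower_cone[where c = q] convex_family_clique) (auto intro: clique_subset)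
  moreover have "clique ?V E - ?R = insert p ` clique N E"
  proof (intro set_eqI iffI)
    fix G assume G: "G \<in> clique ?V E - ?R"
    then have "q \<notin> G" "p \<in> G" using pq unfolding clique_def by auto
    then have "G = insert p (G - {p})" "G - {p} \<in> clique N E" using G by (auto simp: clique_def)
    then show "G \<in> insert p ` clique N E" by blast
  next
    fix G assume "G \<in> insert p ` clique N E"
    then obtain H where H: "G = insert p H" "H \<in> clique N E" by blast
    then have "H \<in> clique ?V E" by (auto simp: clique_def)
    then have "insert p H \<in> clique ?V E"
      by (intro clique_insertI sym) (use H adj in \<open>auto simp: clique_def\<close>)
    then show "G \<in> clique ?V E - ?R" using H by blast
  qed
  moreover have "finite (clique N E)" "\<And>G. G \<in> clique N E \<Longrightarrow> finite G"
    using convex_family_finite[OF convex_family_clique[OF N]] by blast+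
  moreover have "p \<notin> G" if "G \<in> clique N E" for G using that pq by (auto simp: clique_def)
  ultimately have "red_betti T (clique ?V E) (Suc j) = red_betti T (clique N E) j"
    "red_betti T (clique ?V E) 0 = 0" for j
    using red_betti_cone_shift[of "clique N E" p T] by metis+
  then show ?thesis
    using sph unfolding betti_sphere_def
    by (intro allI) (case_tac j, auto)
qed

lemma card_clique_insert: "finite V \<Longrightarrow> G \<in> clique V E \<Longrightarrow> x \<notin> G \<Longrightarrow> card (insert x G) = Suc (card G)"
  by (auto simp: clique_def finite_subset)

text \<open>A face contains at most one of the nonadjacent apexes. If it contains one, its link is
  the link in \<open>N\<close> of the rest; otherwise its link is the suspension of its link in
  \<open>N\<close>.\<close>

lemma gor_graph_suspension:
  assumes N: "finite N" and sym: "\<And>x y. E x y \<longleftrightarrow> E y x" and pq: "p \<notin> N" "q \<notin> N" "p \<noteq> q" "\<not> E p q"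
    and adj: "\<And>n. n \<in> N \<Longrightarrow> E p n \<and> E q n" and gor: "gor_graph T N E d"
  shows "gor_graph T (insert p (insert q N)) E (Suc d)"
  unfolding gor_graph_def
proof
  let ?V = "insert p (insert q N)"
  fix F assume F: "F \<in> clique ?V E"
  have adj2: "E n p \<and> E n q" if "n \<in> N" for n
    using adj[OF that] sym[of n p] sym[of n q] by simp
  let ?goal = "card F \<le> Suc d \<and> betti_sphere T (clique (common_nbrs ?V E F) E) (Suc d - card F)"
  have apex: ?goal if x: "x \<in> F" "{x, y} = {p, q}" for x y
  proof -
    have xN: "x \<notin> N" "y \<notin> N" "\<not> E x y" "x \<noteq> y" "\<And>n. n \<in> N \<Longrightarrow> E x n"
      using x pq adj sym[of p q] by (auto simp: doubleton_eq_iff)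
    have V: "?V = insert x (insert y N)" using x(2) by auto
    have H: "F - {x} \<in> clique N E" using F xN x(1) unfolding V by (auto simp: clique_def)
    have cF: "card F = Suc (card (F - {x}))"
      using card_clique_insert[OF N H, of x] x(1) by (simp add: insert_absorb)
    have "common_nbrs ?V E F = common_nbrs N E (F - {x})"
      unfolding V using xN x(1) by (auto simp: common_nbrs_def)
    then show ?goal using gor H cF unfolding gor_graph_def by auto
  qed
  show ?goal
  proof (cases "p \<in> F \<or> q \<in> F")
    case True
    then show ?thesis using apex[of p q] apex[of q p] by blast
  next
    case False
    then have H: "F \<in> clique N E" using F by (auto simp: clique_def)
    then have g: "card F \<le> d" "betti_sphere T (clique (common_nbrs N E F) E) (d - card F)"
      using gor unfolding gor_graph_def by blast+
    have "common_nbrs ?V E F = insert p (insert q (common_nbrs N E F))"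
      using False adj2 H by (auto simp: common_nbrs_def clique_def)
    moreover have "betti_sphere T (clique (insert p (insert q (common_nbrs N E F))) E) (Suc (d - card F))"
      by (rule betti_sphere_suspension[OF _ sym _ _ pq(3,4) _ g(2)])
         (use N pq adj in \<open>auto simp: common_nbrs_def\<close>)
    ultimately show ?thesis using g(1) by (simp add: Suc_diff_le)
  qed
qed

section \<open>Replacing an edge by a path of length three\<close>

text \<open>The edge \<open>u\<close>--\<open>v\<close> is replaced by the path \<open>u\<close>--\<open>b\<close>--\<open>a\<close>--\<open>v\<close>, joined to the link of the edge.\<close>

locale edge_to_path =
  fixes V :: "nat set" and E :: "nat \<Rightarrow> nat \<Rightarrow> bool" and u v a b :: nat and E' :: "nat \<Rightarrow> nat \<Rightarrow> bool"
  assumes uv: "u \<in> V" "v \<in> V" "u \<noteq> v" "E u v" "a \<notin> V" "b \<notin> V" "a \<noteq> b"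
    and symE: "\<And>x y. E x y \<longleftrightarrow> E y x" and symE': "\<And>x y. E' x y \<longleftrightarrow> E' y x"
    and EV: "\<And>x y. x \<in> V \<Longrightarrow> y \<in> V \<Longrightarrow> E' x y \<longleftrightarrow> E x y \<and> {x, y} \<noteq> {u, v}"
    and Ea: "\<And>y. y \<in> V \<Longrightarrow> E' a y \<longleftrightarrow> y = v \<or> (y \<noteq> u \<and> y \<noteq> v \<and> E u y \<and> E v y)"
    and Eb: "\<And>y. y \<in> V \<Longrightarrow> E' b y \<longleftrightarrow> y = u \<or> (y \<noteq> u \<and> y \<noteq> v \<and> E u y \<and> E v y)"
    and Eab: "E' a b"
begin

text \<open>Reversing the path exchanges \<open>u\<close> with \<open>v\<close> and \<open>a\<close>
  with \<open>b\<close>, which halves the case distinction over faces.\<close>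

lemma swap: "edge_to_path V E v u b a E'"
proof
  show "E v u" "E' b a" using uv(4) symE[of u v] Eab symE'[of a b] by simp_all
  show "E' x y \<longleftrightarrow> E x y \<and> {x, y} \<noteq> {v, u}" if "x \<in> V" "y \<in> V" for x y
    using EV[OF that] by (simp add: insert_commute)
  show "E' a y \<longleftrightarrow> y = v \<or> (y \<noteq> v \<and> y \<noteq> u \<and> E v y \<and> E u y)" if "y \<in> V" for y
    using Ea[OF that] by blast
  show "E' b y \<longleftrightarrow> y = u \<or> (y \<noteq> v \<and> y \<noteq> u \<and> E v y \<and> E u y)" if "y \<in> V" for y
    using Eb[OF that] by blast
qed (use uv in \<open>simp_all\<close>, rule symE, rule symE')

text \<open>This allows the comparison of Betti numbers to be applied inside the link of a face
  whose link contains both \<open>u\<close> and \<open>v\<close>.\<close>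

lemma induced:
  assumes "W \<subseteq> V" "u \<in> W" "v \<in> W"
  shows "edge_to_path W E u v a b E'"
proof
  show "E x y \<longleftrightarrow> E y x" "E' x y \<longleftrightarrow> E' y x" for x y by (rule symE symE')+
  show "E' x y \<longleftrightarrow> E x y \<and> {x, y} \<noteq> {u, v}" if "x \<in> W" "y \<in> W" for x y
    using EV that assms(1) by blast
  show "E' a y \<longleftrightarrow> y = v \<or> (y \<noteq> u \<and> y \<noteq> v \<and> E u y \<and> E v y)" if "y \<in> W" for y
    using Ea that assms(1) by blast
  show "E' b y \<longleftrightarrow> y = u \<or> (y \<noteq> u \<and> y \<noteq> v \<and> E u y \<and> E v y)" if "y \<in> W" for y
    using Eb that assms(1) by blast
qed (use uv Eab assms in auto)

text \<open>Both clique complexes are obtained from the one of the graph with the additional edges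
  \<open>u\<close>--\<open>v\<close> and \<open>v\<close>--\<open>b\<close>, by deleting vertices or edges whose link is a cone.\<close>

lemma red_betti_eq_old:
  assumes V: "finite V"
  shows "red_betti T (clique (insert a (insert b V)) E') j = red_betti T (clique V E) j"
proof -
  let ?V = "insert a (insert b V)"
  define E1 where "E1 = (\<lambda>x y. E' x y \<or> {x, y} = {v, b})"
  define E2 where "E2 = (\<lambda>x y. E1 x y \<or> {x, y} = {u, v})"
  have sym1: "E1 x y \<longleftrightarrow> E1 y x" and sym2: "E2 x y \<longleftrightarrow> E2 y x" for x y
    unfolding E2_def E1_def using symE' by (auto simp: insert_commute)
  have E2V: "E2 x y \<longleftrightarrow> E x y" if "x \<in> V" "y \<in> V" for x y
    unfolding E2_def E1_def using EV[OF that] that uv symE[of u v] by (auto simp: doubleton_eq_iff)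
  have E2a: "E2 a y \<longleftrightarrow> y = v \<or> y \<noteq> u \<and> y \<noteq> v \<and> E u y \<and> E v y" if "y \<in> V" for y
    unfolding E2_def E1_def using Ea[OF that] that uv by (auto simp: doubleton_eq_iff)
  have E2b: "E2 b y \<longleftrightarrow> y = u \<or> y = v \<or> E u y \<and> E v y" if "y \<in> V" for y
    unfolding E2_def E1_def using Eb[OF that] that uv by (auto simp: doubleton_eq_iff)
  have E2ab: "E2 a b" unfolding E2_def E1_def using Eab by simp
  have fV: "finite ?V" using V by simp
  \<comment> \<open>With both extra edges present, all neighbours of \<open>a\<close> are neighbours
    of \<open>v\<close>; once \<open>a\<close> is gone, all neighbours of \<open>b\<close> are
    neighbours of \<open>u\<close>.\<close>
  have "red_betti T (clique (?V - {a}) E2) j = red_betti T (clique ?V E2) j"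
  proof (rule red_betti_dominated_vertex[OF fV sym2, of v])
    fix z assume z: "z \<in> ?V" "z \<noteq> a" "z \<noteq> v" "E2 a z"
    show "E2 v z"
    proof (cases "z = b")
      case True then show ?thesis using E2b[of v] sym2[of v b] uv by blast
    next
      case False
      then have "z \<in> V" using z by blast
      then show ?thesis using z E2a E2V uv by blast
    qed
  qed (use uv E2a in auto)
  moreover have "?V - {a} = insert b V" using uv by auto
  moreover have "red_betti T (clique (insert b V - {b}) E2) j = red_betti T (clique (insert b V) E2) j"
  proof (rule red_betti_dominated_vertex[OF _ sym2, of _ u])
    fix z assume z: "z \<in> insert b V" "z \<noteq> b" "z \<noteq> u" "E2 b z"
    then show "E2 u z" using E2b E2V uv by blast
  qed (use uv E2b V in auto)
  moreover have "insert b V - {b} = V" using uv by auto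
  moreover have "clique V E2 = clique V E" by (rule clique_cong) (simp add: E2V)
  ultimately have 1: "red_betti T (clique ?V E2) j = red_betti T (clique V E) j" by simp
  \<comment> \<open>The new vertex \<open>b\<close> is adjacent to \<open>u\<close>, to
    \<open>v\<close> and to all their common neighbours, hence is the apex for the edge
    \<open>u\<close>--\<open>v\<close>. After this deletion \<open>u\<close> no longer neighbours
    \<open>v\<close>, and \<open>a\<close> becomes an apex for the edge
    \<open>v\<close>--\<open>b\<close>.\<close>
  have 2: "red_betti T (clique ?V E1) j = red_betti T (clique ?V E2) j"
  proof (rule red_betti_remove_edge[OF fV sym2, of b u v])
    fix w assume w: "w \<in> ?V" "w \<noteq> u" "w \<noteq> v" "w \<noteq> b" "E2 u w" "E2 v w"
    show "E2 b w"
    proof (cases "w = a")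
      case True then show ?thesis using E2ab sym2[of a b] by blast
    next
      case False
      then have "w \<in> V" using w by blast
      then show ?thesis using w E2b E2V uv by blast
    qed
  next
    fix x y assume "x \<in> ?V" "y \<in> ?V" "x \<noteq> y"
    have "\<not> E1 u v" "\<not> E1 v u"
      unfolding E1_def using EV[of u v] EV[of v u] uv by (auto simp: doubleton_eq_iff)
    then show "E1 x y \<longleftrightarrow> E2 x y \<and> {x, y} \<noteq> {u, v}"
      unfolding E2_def by (auto simp: doubleton_eq_iff)
  qed (use uv E2b sym2[of u b] sym2[of v b] in auto)
  have E1V: "E1 x y \<longleftrightarrow> E' x y" if "x \<noteq> b" "y \<noteq> b" for x y
    unfolding E1_def using that by (auto simp: doubleton_eq_iff)
  have E1b: "E1 b y \<longleftrightarrow> y = v \<or> E' b y" for y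
    unfolding E1_def using uv by (auto simp: doubleton_eq_iff)
  have 3: "red_betti T (clique ?V E') j = red_betti T (clique ?V E1) j"
  proof (rule red_betti_remove_edge[OF fV sym1, of a v b])
    fix w assume w: "w \<in> ?V" "w \<noteq> v" "w \<noteq> b" "w \<noteq> a" "E1 v w" "E1 b w"
    then have "w \<in> V" by blast
    moreover have "w \<noteq> u" using w E1V[of v u] EV[of v u] uv by auto
    ultimately show "E1 a w" using w E1b Eb Ea E1V uv by blast
  next
    fix x y assume "x \<in> ?V" "y \<in> ?V" "x \<noteq> y"
    have "\<not> E' v b" "\<not> E' b v" using Eb[of v] symE'[of v b] uv by auto
    then show "E' x y \<longleftrightarrow> E1 x y \<and> {x, y} \<noteq> {v, b}"
      unfolding E1_def by (auto simp: doubleton_eq_iff)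
  next
    show "E1 v a" "E1 b a" unfolding E1_def using Ea[of v] Eab symE'[of v a] symE'[of b a] uv by blast+
  qed (use uv in auto)
  show ?thesis using 1 2 3 by simp
qed

lemma clique_old:
  assumes W: "W \<subseteq> V" "\<not> (u \<in> W \<and> v \<in> W)"
  shows "clique W E' = clique W E"
proof (rule clique_cong)
  fix x y assume "x \<in> W" "y \<in> W"
  then have "x \<in> V" "y \<in> V" "{x, y} \<noteq> {u, v}" using W by (auto simp: doubleton_eq_iff)
  then show "E' x y = E x y" using EV by simp
qed

end

lemma finite_clique: "finite V \<Longrightarrow> F \<in> clique V E \<Longrightarrow> finite F"
  by (auto simp: clique_def finite_subset)

context edge_to_path
begin

text \<open>\<open>H\<close> is the part of a new face that avoids \<open>u\<close>,
  \<open>v\<close>, \<open>a\<close> and \<open>b\<close>. If that face contains a new vertex, its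
  link will be the link of the old face \<open>G\<close>, or a suspension of it.\<close>

lemma edge_link:
  assumes V: "finite V" and H: "H \<subseteq> V" "\<And>y. y \<in> H \<Longrightarrow> y \<noteq> u \<and> y \<noteq> v \<and> E u y \<and> E v y"
    "\<And>x y. x \<in> H \<Longrightarrow> y \<in> H \<Longrightarrow> x \<noteq> y \<Longrightarrow> E' x y"
  defines "G \<equiv> insert u (insert v H)"
  shows "G \<in> clique V E" "card G = card H + 2"
    "w \<in> common_nbrs V E G \<longleftrightarrow> w \<in> V \<and> w \<notin> H \<and> w \<noteq> u \<and> w \<noteq> v \<and> E u w \<and> E v w \<and> (\<forall>x\<in>H. E x w)"
    "clique (common_nbrs V E G) E' = clique (common_nbrs V E G) E"
proof -
  have "E x y" if "x \<in> H" "y \<in> H" "x \<noteq> y" for x y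
    using H(3)[OF that] EV[of x y] H(1) that by blast
  then have "H \<in> clique V E" using H(1) by (auto simp: clique_def)
  then have "insert v H \<in> clique V E"
    by (rule clique_insertI[OF symE]) (use H uv in auto)
  then show "G \<in> clique V E"
    unfolding G_def by (rule clique_insertI[OF symE]) (use H uv in auto)
  have "finite H" using H V finite_subset by blast
  moreover have "u \<notin> insert v H" "v \<notin> H" using H(2) uv by blast+
  ultimately show "card G = card H + 2" by (simp add: G_def)
  show "w \<in> common_nbrs V E G \<longleftrightarrow> w \<in> V \<and> w \<notin> H \<and> w \<noteq> u \<and> w \<noteq> v \<and> E u w \<and> E v w \<and> (\<forall>x\<in>H. E x w)"
    by (auto simp: common_nbrs_def G_def)
  show "clique (common_nbrs V E G) E' = clique (common_nbrs V E G) E"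
    by (rule clique_old) (auto simp: common_nbrs_def G_def)
qed

lemma not_adj: "\<not> E' u a" "\<not> E' v b" "\<not> E' u v"
  using Ea[OF uv(1)] Eb[OF uv(2)] symE'[of u a] symE'[of v b] EV[OF uv(1,2)] uv by auto

lemma E'_V: "x \<in> V \<Longrightarrow> y \<in> V \<Longrightarrow> y \<noteq> u \<Longrightarrow> y \<noteq> v \<Longrightarrow> E' x y \<longleftrightarrow> E x y"
  using EV[of x y] by (auto simp: doubleton_eq_iff)

text \<open>Let \<open>W\<close> be the link of the old face \<open>G\<close>. If \<open>F\<close>
  contains \<open>u\<close>, the edge \<open>u\<close>--\<open>b\<close> plays the part of
  \<open>u\<close>--\<open>v\<close> and the link is \<open>W\<close>. Otherwise \<open>u\<close>
  and \<open>a\<close>, the two neighbours of \<open>b\<close> on the path, are nonadjacent and the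
  link is the suspension of \<open>W\<close> with these apexes.\<close>

lemma gor_case_b:
  assumes V: "finite V" and gor: "gor_graph T V E d"
    and F: "F \<in> clique (insert a (insert b V)) E'" "b \<in> F" "a \<notin> F"
  shows "card F \<le> d \<and> betti_sphere T (clique (common_nbrs (insert a (insert b V)) E' F) E') (d - card F)"
proof -
  let ?V = "insert a (insert b V)"
  define H where "H = F - {b, u}"
  define G where "G = insert u (insert v H)"
  define W where "W = common_nbrs V E G"
  have H1: "H \<subseteq> V" using F by (auto simp: H_def clique_def)
  have E'F: "E' x y" if "x \<in> F" "y \<in> F" "x \<noteq> y" for x y using F that by (auto simp: clique_def)
  have H2: "y \<noteq> u \<and> y \<noteq> v \<and> E u y \<and> E v y" if "y \<in> H" for y
    using Eb[of y] E'F[of b y] that H1 F by (auto simp: H_def)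
  have H3: "E' x y" if "x \<in> H" "y \<in> H" "x \<noteq> y" for x y using E'F that by (auto simp: H_def)
  note l = edge_link[OF V H1 H2 H3, folded G_def, folded W_def]
  have g: "card G \<le> d" "betti_sphere T (clique W E) (d - card G)"
    using gor l(1) unfolding gor_graph_def W_def by blast+
  have fH: "finite H" using V H1 finite_subset by blast
  have bH: "b \<notin> H" "u \<notin> H" "b \<noteq> u" using uv by (auto simp: H_def)
  have H4: "E' x w" if "x \<in> H" "w \<in> W" for x w
    using that l(3)[of w] H1 E'_V[of x w] by blast
  have Wb: "E' b w" "E' u w" "E' a w" if "w \<in> W" for w
    using that l(3)[of w] Eb[of w] Ea[of w] E'_V[of u w] uv by blast+
  have nb: "w \<in> W" if w: "w \<in> V" "w \<noteq> u" "w \<notin> H" "E' b w" "\<And>x. x \<in> H \<Longrightarrow> E' x w" for w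
  proof -
    have n: "w \<noteq> v" "E u w" "E v w" using Eb[OF w(1)] w(2,4) uv by auto
    have "E x w" if "x \<in> H" for x using w(5)[OF that] E'_V[of x w] H1 that w n by blast
    then show ?thesis using l(3)[of w] w n by blast
  qed
  show ?thesis
  proof (cases "u \<in> F")
    case True
    then have F': "F = insert b (insert u H)" using F by (auto simp: H_def)
    then have c: "card F = card G" using l(2) fH bH by simp
    have "common_nbrs ?V E' F = W"
    proof (intro set_eqI iffI)
      fix w assume w: "w \<in> common_nbrs ?V E' F"
      then have "w \<noteq> a" using not_adj(1) True by (auto simp: common_nbrs_def)
      moreover have "w \<noteq> b" "w \<noteq> u" using w F' by (auto simp: common_nbrs_def)
      ultimately show "w \<in> W"
        using w F' by (intro nb) (auto simp: common_nbrs_def)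
    next
      fix w assume w: "w \<in> W"
      have "w \<in> V" "w \<notin> F" using w l(3)[of w] uv unfolding F' by auto
      then show "w \<in> common_nbrs ?V E' F"
        unfolding common_nbrs_def using w Wb H4 F' by auto
    qed
    then show ?thesis using g c l(4) by simp
  next
    case False
    then have F': "F = insert b H" using F by (auto simp: H_def)
    then have c: "card G = card F + 1" using l(2) fH bH by simp
    have "common_nbrs ?V E' F = insert u (insert a W)"
    proof (intro set_eqI iffI)
      fix w assume w: "w \<in> common_nbrs ?V E' F"
      then have "w \<noteq> b" using F' by (auto simp: common_nbrs_def)
      then show "w \<in> insert u (insert a W)"
        using w F' nb[of w] by (auto simp: common_nbrs_def)
    next
      fix w assume w: "w \<in> insert u (insert a W)"
      then consider "w = u" | "w = a" | "w \<in> W" by blast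
      then show "w \<in> common_nbrs ?V E' F"
      proof cases
        case 1
        have "E' x u" if "x \<in> H" for x
          using E'_V[of u x] H2[OF that] H1 that uv symE'[of u x] by blast
        then show ?thesis using 1 Eb[of u] uv F' bH by (auto simp: common_nbrs_def)
      next
        case 2
        have "E' x a" if "x \<in> H" for x
          using Ea[of x] H2[OF that] H1 that symE'[of a x] by blast
        then show ?thesis using 2 Eab symE'[of a b] F F' by (auto simp: common_nbrs_def)
      next
        case 3
        have "w \<in> V" "w \<notin> F" using 3 l(3)[of w] uv unfolding F' by auto
        then show ?thesis
          unfolding common_nbrs_def using 3 Wb H4 F' by auto
      qed
    qed
    moreover have "betti_sphere T (clique (insert u (insert a W)) E') (Suc (d - card G))"
    proof (rule betti_sphere_suspension[OF _ symE'])
      show "finite W" using V by (auto simp: W_def common_nbrs_def)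
      show "u \<notin> W" "a \<notin> W" using l(3)[of u] l(3)[of a] uv by auto
      show "betti_sphere T (clique W E') (d - card G)" using g l(4) by simp
    qed (use not_adj uv Wb in auto)
    ultimately show ?thesis using c g(1) by (simp add: Suc_diff_le Suc_diff_Suc)
  qed
qed

lemma gor_case_ab:
  assumes V: "finite V" and gor: "gor_graph T V E d"
    and F: "F \<in> clique (insert a (insert b V)) E'" "b \<in> F" "a \<in> F"
  shows "card F \<le> d \<and> betti_sphere T (clique (common_nbrs (insert a (insert b V)) E' F) E') (d - card F)"
proof -
  let ?V = "insert a (insert b V)"
  define H where "H = F - {a, b}"
  define G where "G = insert u (insert v H)"
  define W where "W = common_nbrs V E G"
  have H1: "H \<subseteq> V" using F by (auto simp: H_def clique_def)
  have E'F: "E' x y" if "x \<in> F" "y \<in> F" "x \<noteq> y" for x y using F that by (auto simp: clique_def)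
  have link: "w \<noteq> u \<and> w \<noteq> v \<and> E u w \<and> E v w" if "w \<in> V" "E' a w" "E' b w" for w
    using Ea[OF that(1)] Eb[OF that(1)] that uv by auto
  have H2: "y \<noteq> u \<and> y \<noteq> v \<and> E u y \<and> E v y" if "y \<in> H" for y
    using link[of y] E'F[of b y] E'F[of a y] that H1 F by (auto simp: H_def)
  have H3: "E' x y" if "x \<in> H" "y \<in> H" "x \<noteq> y" for x y using E'F that by (auto simp: H_def)
  note l = edge_link[OF V H1 H2 H3, folded G_def, folded W_def]
  have g: "card G \<le> d" "betti_sphere T (clique W E) (d - card G)"
    using gor l(1) unfolding gor_graph_def W_def by blast+
  have fH: "finite H" using V H1 finite_subset by blast
  have F': "F = insert b (insert a H)" using F by (auto simp: H_def)
  have "a \<noteq> b" "a \<notin> H" "b \<notin> H" using uv by (auto simp: H_def)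
  then have c: "card F = card G" using l(2) fH F' by simp
  have "common_nbrs ?V E' F = W"
  proof (intro set_eqI iffI)
    fix w assume w: "w \<in> common_nbrs ?V E' F"
    then have w': "w \<in> V" "E' a w" "E' b w" "w \<notin> H" using F' by (auto simp: common_nbrs_def)
    have "E x w" if "x \<in> H" for x
      using w F' that E'_V[of x w] H1 link[OF w'(1-3)] w' by (auto simp: common_nbrs_def)
    then show "w \<in> W" using l(3)[of w] w' link by blast
  next
    fix w assume w: "w \<in> W"
    have "E' x w" if "x \<in> H" for x
      using that w l(3)[of w] H1 E'_V[of x w] by blast
    moreover have "E' a w" "E' b w" "w \<in> V" "w \<notin> F"
      using w l(3)[of w] Ea[of w] Eb[of w] uv F' by auto
    ultimately show "w \<in> common_nbrs ?V E' F" using F' by (auto simp: common_nbrs_def)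
  qed
  then show ?thesis using g c l(4) by simp
qed

text \<open>Only the place of \<open>v\<close> in the link changes: it is taken by \<open>b\<close>.
  Joining \<open>v\<close> and \<open>b\<close> by an edge (\<open>E1\<close>) makes them dominate
  each other inside the link, so deleting either one gives the same Betti numbers.\<close>

lemma gor_case_u:
  assumes V: "finite V" and gor: "gor_graph T V E d"
    and F: "F \<in> clique (insert a (insert b V)) E'" "a \<notin> F" "b \<notin> F" "u \<in> F"
  shows "card F \<le> d \<and> betti_sphere T (clique (common_nbrs (insert a (insert b V)) E' F) E') (d - card F)"
proof -
  let ?V = "insert a (insert b V)"
  define W where "W = common_nbrs V E F"
  have FV: "F \<subseteq> V" using F by (auto simp: clique_def)
  have E'F: "E' x y" if "x \<in> F" "y \<in> F" "x \<noteq> y" for x y using F that by (auto simp: clique_def)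
  have vF: "v \<notin> F" using E'F[of u v] not_adj(3) F uv by blast
  have EF: "E x y" if "x \<in> F" "y \<in> F" "x \<noteq> y" for x y
    using E'F[OF that] EV[of x y] FV that by blast
  then have "F \<in> clique V E" using FV by (auto simp: clique_def)
  then have g: "card F \<le> d" "betti_sphere T (clique W E) (d - card F)"
    using gor unfolding gor_graph_def W_def by blast+
  have Wi: "w \<in> W \<longleftrightarrow> w \<in> V \<and> w \<notin> F \<and> (\<forall>x\<in>F. E x w)" for w
    by (auto simp: W_def common_nbrs_def)
  have uW: "u \<notin> W" using F by (simp add: Wi)
  have old: "w \<in> common_nbrs ?V E' F \<longleftrightarrow> w \<in> W - {v}" if "w \<in> V" for w
  proof -
    have "E' x w \<longleftrightarrow> E x w" if "x \<in> F" "w \<noteq> v" "w \<notin> F" for x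
      using E'_V[of x w] \<open>w \<in> V\<close> that FV F by blast
    then show ?thesis using that F not_adj(3) by (auto simp: common_nbrs_def Wi)
  qed
  have V': "w \<in> V \<or> w = a \<or> w = b" if "w \<in> common_nbrs ?V E' F" for w
    using that by (auto simp: common_nbrs_def)
  have wold: "W \<subseteq> V" by (auto simp: Wi)
  have na: "a \<notin> common_nbrs ?V E' F" using not_adj(1) F by (auto simp: common_nbrs_def)
  show ?thesis
  proof (cases "v \<in> W")
    case False
    have "b \<notin> common_nbrs ?V E' F"
    proof
      assume bb: "b \<in> common_nbrs ?V E' F"
      have "E x v" if "x \<in> F" for x
      proof (cases "x = u")
        case False
        have "E' b x" using bb that symE'[of b x] by (auto simp: common_nbrs_def)
        then show ?thesis using Eb[of x] FV that False symE[of x v] by blast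
      qed (use uv in simp)
      then show False using False vF uv by (simp add: Wi)
    qed
    then have "common_nbrs ?V E' F = W"
      using na old False V' wold by blast
    moreover have "clique W E' = clique W E"
      by (rule clique_old) (use uW in \<open>auto simp: Wi\<close>)
    ultimately show ?thesis using g by simp
  next
    case True
    have bb: "b \<in> common_nbrs ?V E' F"
    proof -
      have "E' x b" if "x \<in> F" for x
      proof (cases "x = u")
        case True then show ?thesis using Eb[of u] symE'[of u b] uv by simp
      next
        case False
        then show ?thesis
          using Eb[of x] EF[of u x] True that FV F vF symE'[of x b] symE[of x v] by (auto simp: Wi)
      qed
      then show ?thesis using F by (auto simp: common_nbrs_def)
    qed
    have N: "common_nbrs ?V E' F = insert b (W - {v})"
      using na bb old V' wold uv(6) by blast
    define E1 where "E1 = (\<lambda>x y. E' x y \<or> {x, y} = {v, b})"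
    have sym1: "E1 x y \<longleftrightarrow> E1 y x" for x y
      unfolding E1_def using symE'[of x y] by (simp add: insert_commute)
    have fW: "finite (insert b W)" using V by (auto simp: W_def common_nbrs_def)
    have bW: "b \<notin> W" "v \<noteq> b" using uv by (auto simp: Wi)
    have vz: "E1 v z \<longleftrightarrow> E v z" "E1 b z \<longleftrightarrow> E v z" if "z \<in> W" "z \<noteq> v" for z
    proof -
      have z: "z \<in> V" "z \<noteq> u" "z \<noteq> b" "E u z" using that F uv by (auto simp: Wi)
      show "E1 v z \<longleftrightarrow> E v z" unfolding E1_def
        using E'_V[of v z] z uv that by (auto simp: doubleton_eq_iff)
      show "E1 b z \<longleftrightarrow> E v z" unfolding E1_def
        using Eb[of z] z that by (auto simp: doubleton_eq_iff)
    qed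
    have "red_betti T (clique (insert b W - {b}) E1) j = red_betti T (clique (insert b W) E1) j" for j
      by (rule red_betti_dominated_vertex[OF fW sym1, of v])
         (use True bW vz in \<open>auto simp: E1_def\<close>)
    moreover have "red_betti T (clique (insert b W - {v}) E1) j = red_betti T (clique (insert b W) E1) j" for j
      by (rule red_betti_dominated_vertex[OF fW sym1, of b])
         (use True bW vz in \<open>auto simp: E1_def\<close>)
    moreover have "insert b W - {b} = W" "insert b W - {v} = insert b (W - {v})" using bW by auto
    moreover have "clique (insert b (W - {v})) E1 = clique (insert b (W - {v})) E'"
      by (rule clique_cong) (use bW in \<open>auto simp: E1_def doubleton_eq_iff\<close>)
    moreover have "clique W E1 = clique W E'"
      by (rule clique_cong) (use bW in \<open>auto simp: E1_def doubleton_eq_iff\<close>)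
    moreover have "clique W E' = clique W E"
      by (rule clique_old) (use uW in \<open>auto simp: Wi\<close>)
    ultimately show ?thesis using g N by (simp add: betti_sphere_def)
  qed
qed

text \<open>The link is the old one, unless that contains both \<open>u\<close> and
  \<open>v\<close>; then it has undergone the same replacement of an edge by a path.\<close>

lemma gor_case_old:
  assumes V: "finite V" and gor: "gor_graph T V E d"
    and F: "F \<in> clique (insert a (insert b V)) E'" "a \<notin> F" "b \<notin> F" "u \<notin> F" "v \<notin> F"
  shows "card F \<le> d \<and> betti_sphere T (clique (common_nbrs (insert a (insert b V)) E' F) E') (d - card F)"
proof -
  let ?V = "insert a (insert b V)"
  define W where "W = common_nbrs V E F"
  have FV: "F \<subseteq> V" using F by (auto simp: clique_def)
  have E': "E' x w \<longleftrightarrow> E x w" if "x \<in> F" "w \<in> V" for x w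
    using EV[of x w] that FV F by (auto simp: doubleton_eq_iff)
  have "E x y" if "x \<in> F" "y \<in> F" "x \<noteq> y" for x y
    using E'[of x y] F FV that by (auto simp: clique_def)
  then have "F \<in> clique V E" using FV by (auto simp: clique_def)
  then have g: "card F \<le> d" "betti_sphere T (clique W E) (d - card F)"
    using gor unfolding gor_graph_def W_def by blast+
  have Wi: "w \<in> W \<longleftrightarrow> w \<in> V \<and> w \<notin> F \<and> (\<forall>x\<in>F. E x w)" for w
    by (auto simp: W_def common_nbrs_def)
  have old: "w \<in> common_nbrs ?V E' F \<longleftrightarrow> w \<in> W" if "w \<in> V" for w
    using E' that by (auto simp: common_nbrs_def Wi)
  have link: "E' x a \<longleftrightarrow> E x u \<and> E x v" "E' x b \<longleftrightarrow> E x u \<and> E x v" if "x \<in> F" for x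
    using Ea[of x] Eb[of x] symE'[of x a] symE'[of x b] symE[of x u] symE[of x v] that FV F by auto
  have V': "w \<in> V \<or> w = a \<or> w = b" if "w \<in> common_nbrs ?V E' F" for w
    using that by (auto simp: common_nbrs_def)
  have wold: "W \<subseteq> V" by (auto simp: Wi)
  show ?thesis
  proof (cases "u \<in> W \<and> v \<in> W")
    case True
    then have "a \<in> common_nbrs ?V E' F" "b \<in> common_nbrs ?V E' F"
      using link F by (auto simp: common_nbrs_def Wi)
    then have N: "common_nbrs ?V E' F = insert a (insert b W)" using old V' wold by blast
    interpret W: edge_to_path W E u v a b E'
      by (rule induced[OF wold]) (use True in auto)
    have "finite W" using V wold finite_subset by blast
    then show ?thesis using g W.red_betti_eq_old[of T] N by (simp add: betti_sphere_def)
  next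
    case False
    then have "\<not> (\<forall>x\<in>F. E x u \<and> E x v)" using F uv by (auto simp: Wi)
    then have "a \<notin> common_nbrs ?V E' F" "b \<notin> common_nbrs ?V E' F"
      using link by (auto simp: common_nbrs_def)
    then have "common_nbrs ?V E' F = W" using old V' wold by blast
    then show ?thesis using g clique_old[OF wold False] by simp
  qed
qed

theorem gor_graph_edge_to_path:
  assumes V: "finite V" and gor: "gor_graph T V E d"
  shows "gor_graph T (insert a (insert b V)) E' d"
  unfolding gor_graph_def
proof
  let ?V = "insert a (insert b V)"
  fix F assume F: "F \<in> clique ?V E'"
  interpret sw: edge_to_path V E v u b a E' by (rule swap)
  have sV: "insert b (insert a V) = ?V" by (rule insert_commute)
  show "card F \<le> d \<and> betti_sphere T (clique (common_nbrs ?V E' F) E') (d - card F)"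
  proof (cases "a \<in> F \<or> b \<in> F")
    case True
    then show ?thesis
      using gor_case_b[OF V gor F] gor_case_ab[OF V gor F] sw.gor_case_b[OF V gor, unfolded sV, OF F]
      by blast
  next
    case False
    then show ?thesis
      using gor_case_old[OF V gor F] gor_case_u[OF V gor F] sw.gor_case_u[OF V gor, unfolded sV, OF F]
      by blast
  qed
qed

end

section \<open>Ranked posets and splitting a cover\<close>

definition comparable :: "(nat \<Rightarrow> nat \<Rightarrow> bool) \<Rightarrow> nat \<Rightarrow> nat \<Rightarrow> bool" where
  "comparable le x y \<longleftrightarrow> x \<noteq> y \<and> (le x y \<or> le y x)"

lemma comparable_sym: "comparable le x y \<longleftrightarrow> comparable le y x"
  by (auto simp: comparable_def)

definition open_interval :: "nat set \<Rightarrow> (nat \<Rightarrow> nat \<Rightarrow> bool) \<Rightarrow> nat \<Rightarrow> nat \<Rightarrow> nat set" where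
  "open_interval P le x y = {w \<in> P. le x w \<and> le w y \<and> w \<noteq> x \<and> w \<noteq> y}"

text \<open>Gradedness is expressed by \<open>strict\<close> and \<open>dense\<close> instead of
  covers, since these conditions can be checked pair by pair after the order has been modified. The
  lemmas \<open>graded\<close> and \<open>ranked_posetI_graded\<close> connect the two
  versions.\<close>

locale ranked_poset =
  fixes P :: "nat set" and le :: "nat \<Rightarrow> nat \<Rightarrow> bool" and z t :: nat and r :: "nat \<Rightarrow> nat" and n :: nat
  assumes fin: "finite P" and refl: "x \<in> P \<Longrightarrow> le x x"
    and antisym: "x \<in> P \<Longrightarrow> y \<in> P \<Longrightarrow> le x y \<Longrightarrow> le y x \<Longrightarrow> x = y"
    and trans: "x \<in> P \<Longrightarrow> y \<in> P \<Longrightarrow> w \<in> P \<Longrightarrow> le x y \<Longrightarrow> le y w \<Longrightarrow> le x w"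
    and zt: "z \<in> P" "t \<in> P" and bot: "x \<in> P \<Longrightarrow> le z x" and top: "x \<in> P \<Longrightarrow> le x t"
    and rzt: "r z = 0" "r t = n + 1"
    and strict: "x \<in> P \<Longrightarrow> y \<in> P \<Longrightarrow> le x y \<Longrightarrow> x \<noteq> y \<Longrightarrow> r x < r y"
    and dense: "x \<in> P \<Longrightarrow> y \<in> P \<Longrightarrow> le x y \<Longrightarrow> r x + 1 < r y \<Longrightarrow>
      \<exists>w\<in>P. le x w \<and> le w y \<and> r x < r w \<and> r w < r y"
begin

lemma order_complex_eq: "order_complex P le z t = clique (P - {z, t}) (comparable le)"
proof -
  have "le x y \<or> le y x \<longleftrightarrow> x = y \<or> comparable le x y" if "x \<in> C" "C \<subseteq> P - {z, t}" for x y C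
    using refl[of x] that by (auto simp: comparable_def)
  then show ?thesis
    unfolding order_complex_def is_chain_def clique_def
    by (intro Collect_cong conj_cong ball_cong HOL.refl)
qed

lemma open_interval_zt: "open_interval P le z t = P - {z, t}"
  using bot top by (auto simp: open_interval_def)

lemma graded: "graded_poset P le z t r n"
proof -
  have "r y = r x + 1" if "covers P le x y" for x y
  proof (rule ccontr)
    have c: "x \<in> P" "y \<in> P" "le x y" "x \<noteq> y" "\<not> (\<exists>z\<in>P. le x z \<and> le z y \<and> z \<noteq> x \<and> z \<noteq> y)"
      using that unfolding covers_def by blast+
    assume "r y \<noteq> r x + 1"
    then obtain w where "w \<in> P" "le x w" "le w y" "r x < r w" "r w < r y"
      using dense[of x y] strict[of x y] c by force
    then show False using c(5) by auto
  qed
  then show ?thesis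
    unfolding graded_poset_def finite_poset_def
    using fin refl antisym trans zt bot top rzt by blast
qed

lemma gorenstein_star_iff:
  "gorenstein_star_poset T P le z t r n \<longleftrightarrow> gor_graph T (P - {z, t}) (comparable le) n"
  unfolding gorenstein_star_poset_def order_complex_eq
  using graded gorenstein_star_complex_clique[of "comparable le" T "P - {z, t}" n, OF comparable_sym]
  by blast

lemma rank_mono: "x \<in> P \<Longrightarrow> y \<in> P \<Longrightarrow> le x y \<Longrightarrow> r x \<le> r y"
  using strict[of x y] by (cases "x = y") auto

lemma rank_bounds: "x \<in> P \<Longrightarrow> x \<noteq> z \<Longrightarrow> 0 < r x" "x \<in> P \<Longrightarrow> x \<noteq> t \<Longrightarrow> r x < n + 1"
  using strict[of z x] strict[of x t] bot top zt rzt by auto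

lemma rank_inj: "x \<in> P \<Longrightarrow> y \<in> P \<Longrightarrow> comparable le x y \<Longrightarrow> r x \<noteq> r y"
  using strict[of x y] strict[of y x] unfolding comparable_def by auto

lemma rank_eq: "x \<in> P \<Longrightarrow> y \<in> P \<Longrightarrow> le x y \<Longrightarrow> r x = r y \<Longrightarrow> x = y"
  using strict[of x y] by auto

lemma between_rank:
  assumes "x \<in> P" "y \<in> P" "le x y" "r x \<le> i" "i \<le> r y"
  shows "\<exists>w\<in>P. le x w \<and> le w y \<and> r w = i"
  using assms
proof (induction "r y - r x" arbitrary: x y rule: less_induct)
  case less
  show ?case
  proof (cases "r x = i \<or> r y = i")
    case True
    then show ?thesis using less.prems refl by blast
  next
    case False
    then have "r x + 1 < r y" using less.prems by auto
    then obtain w where w: "w \<in> P" "le x w" "le w y" "r x < r w" "r w < r y"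
      using dense less.prems by blast
    show ?thesis
    proof (cases "r w \<le> i")
      case True
      then obtain w' where "w' \<in> P" "le w w'" "le w' y" "r w' = i"
        using less.hyps[of y w] w less.prems diff_less_mono2[of "r x" "r w" "r y"] by auto
      then show ?thesis using trans[of x w w'] w less.prems by blast
    next
      case False
      then obtain w' where "w' \<in> P" "le x w'" "le w' w" "r w' = i"
        using less.hyps[of w x] w less.prems diff_less_mono[of "r w" "r y" "r x"] by auto
      then show ?thesis using trans[of w' w y] w less.prems by blast
    qed
  qed
qed

lemma in_open_interval:
  assumes "x \<in> P" "y \<in> P"
  shows "w \<in> open_interval P le x y \<longleftrightarrow> w \<in> P \<and> le x w \<and> le w y \<and> r x < r w \<and> r w < r y"
  using strict[of x w] strict[of w y] assms unfolding open_interval_def by auto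

end

text \<open>Along a cover the rank grows by one. If \<open>x < y\<close> is not a cover, an
  intermediate element cuts the closed interval into two smaller ones, so strictness follows by
  induction on the size of the interval; a rank gap above one then excludes a cover.\<close>

lemma ranked_posetI_graded:
  assumes "graded_poset P le z t r n"
  shows "ranked_poset P le z t r n"
proof -
  have fin: "finite P" and refl: "\<And>x. x \<in> P \<Longrightarrow> le x x"
    and antisym: "\<And>x y. x \<in> P \<Longrightarrow> y \<in> P \<Longrightarrow> le x y \<Longrightarrow> le y x \<Longrightarrow> x = y"
    and trans: "\<And>x y w. x \<in> P \<Longrightarrow> y \<in> P \<Longrightarrow> w \<in> P \<Longrightarrow> le x y \<Longrightarrow> le y w \<Longrightarrow> le x w"
    and zt: "z \<in> P" "t \<in> P" and bot: "\<And>x. x \<in> P \<Longrightarrow> le z x" and top: "\<And>x. x \<in> P \<Longrightarrow> le x t"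
    and rzt: "r z = 0" "r t = n + 1"
    and cov: "\<And>x y. x \<in> P \<Longrightarrow> y \<in> P \<Longrightarrow> covers P le x y \<Longrightarrow> r y = r x + 1"
    using assms unfolding graded_poset_def finite_poset_def by blast+
  have strict: "r x < r y" if "x \<in> P" "y \<in> P" "le x y" "x \<noteq> y" for x y
    using that
  proof (induction "card {w \<in> P. le x w \<and> le w y}" arbitrary: x y rule: less_induct)
    case less
    show ?case
    proof (cases "covers P le x y")
      case False
      then obtain w where w: "w \<in> P" "le x w" "le w y" "w \<noteq> x" "w \<noteq> y"
        using less.prems unfolding covers_def by blast
      have "card {v \<in> P. le x v \<and> le v w} < card {v \<in> P. le x v \<and> le v y}"
        by (rule psubset_card_mono) (use fin w less.prems trans[of _ w y] antisym[of w y] refl in auto)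
      moreover have "card {v \<in> P. le w v \<and> le v y} < card {v \<in> P. le x v \<and> le v y}"
        by (rule psubset_card_mono) (use fin w less.prems trans[of x w] antisym[of x w] refl in auto)
      ultimately have "r x < r w" "r w < r y"
        using less.hyps w less.prems by blast+
      then show ?thesis by simp
    qed (use cov less.prems in simp)
  qed
  show ?thesis
  proof
    fix x y assume xy: "x \<in> P" "y \<in> P" "le x y" "r x + 1 < r y"
    then have "\<not> covers P le x y" "x \<noteq> y" using cov[of x y] by auto
    then obtain w where "w \<in> P" "le x w" "le w y" "w \<noteq> x" "w \<noteq> y"
      using xy unfolding covers_def by blast
    then show "\<exists>w\<in>P. le x w \<and> le w y \<and> r x < r w \<and> r w < r y"
      using strict xy by blast
  qed (fact fin refl antisym trans zt bot top rzt strict)+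
qed

text \<open>The cover \<open>u < v\<close> is replaced by \<open>u < b > a < v\<close>, where \<open>a\<close> is a copy of \<open>u\<close> and \<open>b\<close> a copy of
  \<open>v\<close> as far as the elements below \<open>u\<close> and above \<open>v\<close> are concerned.\<close>

locale cover_split = ranked_poset +
  fixes u v a b :: nat
  assumes u: "u \<in> P" "u \<noteq> z" and v: "v \<in> P" "v \<noteq> t" and uv: "le u v" "r v = r u + 1"
    and ab: "a \<notin> P" "b \<notin> P" "a \<noteq> b"
begin

text \<open>\<open>a\<close> has below it what is strictly below \<open>u\<close>, and
  \<open>b\<close> has above it what is strictly above \<open>v\<close>. Only the pair
  (\<open>u\<close>, \<open>v\<close>) is deleted; the order stays transitive because nothing lies
  strictly between \<open>u\<close> and \<open>v\<close>.\<close>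

definition le' :: "nat \<Rightarrow> nat \<Rightarrow> bool" where
  "le' x y = (if x = a then y = a \<or> y = b \<or> (y \<in> P \<and> le v y)
    else if x = b then y = b \<or> (y \<in> P \<and> le v y \<and> y \<noteq> v)
    else if y = a then x \<in> P \<and> le x u \<and> x \<noteq> u
    else if y = b then x \<in> P \<and> le x u
    else le x y \<and> \<not> (x = u \<and> y = v))"

definition r' :: "nat \<Rightarrow> nat" where "r' = r(a := r u, b := r v)"

definition P' :: "nat set" where "P' = insert a (insert b P)"

lemma uv_ne: "u \<noteq> v" "v \<noteq> z" "u \<noteq> t" "z \<noteq> t"
  using uv rank_bounds(1)[OF u] rank_bounds(2)[OF v] rzt by auto

lemma ab_ne: "x \<in> P \<Longrightarrow> x \<noteq> a \<and> x \<noteq> b" using ab by blast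

lemma le'_old: "x \<in> P \<Longrightarrow> y \<in> P \<Longrightarrow> le' x y \<longleftrightarrow> le x y \<and> \<not> (x = u \<and> y = v)"
  using ab_ne[of x] ab_ne[of y] by (simp add: le'_def)

lemma le'_new:
  "le' a a" "le' b b" "le' a b" "\<not> le' b a"
  "y \<in> P \<Longrightarrow> le' a y \<longleftrightarrow> le v y" "y \<in> P \<Longrightarrow> le' b y \<longleftrightarrow> le v y \<and> y \<noteq> v"
  "x \<in> P \<Longrightarrow> le' x a \<longleftrightarrow> le x u \<and> x \<noteq> u" "x \<in> P \<Longrightarrow> le' x b \<longleftrightarrow> le x u"
  using ab_ne[of x] ab_ne[of y] ab by (auto simp: le'_def)

lemma r'_simps: "r' a = r u" "r' b = r v" "x \<in> P \<Longrightarrow> r' x = r x"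
  using ab ab_ne[of x] by (auto simp: r'_def)

lemma between_uv: "x \<in> P \<Longrightarrow> le u x \<Longrightarrow> le x v \<Longrightarrow> x = u \<or> x = v"
  using strict[of u x] strict[of x v] u v uv by force

lemma le_uv: "x \<in> P \<Longrightarrow> le x u \<Longrightarrow> le x v" "x \<in> P \<Longrightarrow> le v x \<Longrightarrow> le u x"
  using trans[of x u v] trans[of u v x] u v uv by auto

lemma not_le_uv: "\<not> le v u" using strict[of v u] u v uv uv_ne by auto

lemma strict':
  assumes "x \<in> P'" "y \<in> P'" "le' x y" "x \<noteq> y"
  shows "r' x < r' y"
proof -
  consider "x = a" "y = b" | "x = a" "y \<in> P" | "x = b" "y \<in> P" | "x \<in> P" "y = a" | "x \<in> P" "y = b" | "x \<in> P" "y \<in> P"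
    using assms le'_new(4) unfolding P'_def by blast
  then show ?thesis
  proof cases
    case 1
    then show ?thesis using r'_simps uv by simp
  next
    case 2
    then show ?thesis using assms le'_new(5)[of y] rank_mono[of v y] r'_simps uv v by simp
  next
    case 3
    then show ?thesis using assms le'_new(6)[of y] strict[of v y] r'_simps v by simp
  next
    case 4
    then show ?thesis using assms le'_new(7)[of x] strict[of x u] r'_simps u by simp
  next
    case 5
    then show ?thesis using assms le'_new(8)[of x] rank_mono[of x u] r'_simps uv u by simp
  next
    case 6
    then show ?thesis using assms le'_old[of x y] strict[of x y] r'_simps by simp
  qed
qed

lemma ranked': "ranked_poset P' le' z t r' n"
proof
  show "finite P'" using fin by (simp add: P'_def)
  show "z \<in> P'" "t \<in> P'" using zt by (auto simp: P'_def)
  show "r' z = 0" "r' t = n + 1" using r'_simps(3) zt rzt by auto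
  fix x assume x: "x \<in> P'"
  then have xc: "x = a \<or> x = b \<or> x \<in> P" by (auto simp: P'_def)
  show "le' x x" using xc le'_new(1,2) le'_old refl uv_ne by blast
  show "le' z x" using xc le'_new(7,8)[of z] le'_old[of z x] bot[of u] bot[of x] zt u by auto
  show "le' x t" using xc le'_new(5,6)[of t] le'_old[of x t] top[of v] top[of x] zt v uv_ne by auto
  fix y assume y: "y \<in> P'"
  then have yc: "y = a \<or> y = b \<or> y \<in> P" by (auto simp: P'_def)
  show "r' x < r' y" if "le' x y" "x \<noteq> y" by (rule strict'[OF x y that])
  show "x = y" if "le' x y" "le' y x"
    using strict'[OF x y that(1)] strict'[OF y x that(2)] by (cases "x = y") auto
  show "\<exists>w\<in>P'. le' x w \<and> le' w y \<and> r' x < r' w \<and> r' w < r' y" if xy: "le' x y" "r' x + 1 < r' y"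
  proof -
    consider "x = a" "y \<in> P" | "x = b" "y \<in> P" | "x \<in> P" "y = a" | "x \<in> P" "y = b" | "x \<in> P" "y \<in> P"
      using xc yc xy le'_new(4) r'_simps uv by auto
    then show ?thesis
    proof cases
      case 1
      then have "le v y" "r v < r y" using xy le'_new(5) r'_simps uv by auto
      then show ?thesis
        using 1 le'_new(3) le'_new(6)[of y] r'_simps uv by (intro bexI[of _ b]) (auto simp: P'_def)
    next
      case 2
      then have "le v y" "r v + 1 < r y" using xy le'_new(6) r'_simps by auto
      then obtain w where "w \<in> P" "le v w" "le w y" "r v < r w" "r w < r y"
        using dense v 2 by blast
      then show ?thesis
        using 2 le'_new(6)[of w] le'_old[of w y] r'_simps uv by (intro bexI[of _ w]) (auto simp: P'_def)
    next
      case 3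
      then have "le x u" "r x + 1 < r u" using xy le'_new(7) r'_simps by auto
      then obtain w where "w \<in> P" "le x w" "le w u" "r x < r w" "r w < r u"
        using dense u 3 by blast
      then show ?thesis
        using 3 le'_new(7)[of w] le'_old[of x w] r'_simps uv by (intro bexI[of _ w]) (auto simp: P'_def)
    next
      case 4
      then have "le x u" "r x < r u" using xy le'_new(8) r'_simps uv by auto
      then show ?thesis
        using 4 le'_new(8)[of u] refl[of u] le'_old[of x u] u uv_ne r'_simps uv
        by (intro bexI[of _ u]) (auto simp: P'_def)
    next
      case 5
      then have "le x y" "r x + 1 < r y" using xy le'_old r'_simps by auto
      then obtain w where w: "w \<in> P" "le x w" "le w y" "r x < r w" "r w < r y"
        using dense 5 by blast
      \<comment> \<open>The intermediate element of the old order fails only if it used the deleted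
        pair. Then \<open>b\<close> lies between \<open>u\<close> and \<open>y\<close>, or
        \<open>a\<close> lies between \<open>x\<close> and \<open>v\<close>.\<close>
      consider "x = u" "w = v" | "w = u" "y = v" | "\<not> (x = u \<and> w = v)" "\<not> (w = u \<and> y = v)" by blast
      then show ?thesis
      proof cases
        case 1
        then show ?thesis
          using w 5 le'_new(6)[of y] le'_new(8)[of x] refl[of u] r'_simps uv
          by (intro bexI[of _ b]) (auto simp: P'_def)
      next
        case 2
        then show ?thesis
          using w 5 le'_new(5)[of y] le'_new(7)[of x] refl[of v] r'_simps uv
          by (intro bexI[of _ a]) (auto simp: P'_def)
      next
        case 3
        then show ?thesis
          using w 5 le'_old r'_simps by (intro bexI[of _ w]) (auto simp: P'_def)
      qed
    qed
  qed
  fix w assume w: "w \<in> P'"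
  then have wc: "w = a \<or> w = b \<or> w \<in> P" by (auto simp: P'_def)
  assume xy: "le' x y" and yw: "le' y w"
  have vyu: False if "y \<in> P" "le v y" "le y u" using trans[of v y u] that not_le_uv u v by simp
  consider "x = a" | "x = b" | "x \<in> P" "y = a" | "x \<in> P" "y = b" | "x \<in> P" "y \<in> P" using xc yc by blast
  then show "le' x w"
  proof cases
    case 1
    show ?thesis
    proof (cases "w \<in> P")
      case True
      have "le v w"
      proof (cases "y \<in> P")
        case yP: True
        then have "le v y" "le y w" using 1 xy yw le'_new(5)[of y] le'_old[OF yP True] by auto
        then show ?thesis using trans[of v y w] v yP True by simp
      next
        case False
        then show ?thesis using yc yw le'_new(5,6)[OF True] by auto
      qed
      then show ?thesis using 1 le'_new(5)[OF True] by simp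
    qed (use 1 wc le'_new(1,3) in auto)
  next
    case 2
    have y: "y = b \<or> (y \<in> P \<and> le v y \<and> y \<noteq> v)" using 2 xy yc le'_new(4) le'_new(6)[of y] by auto
    show ?thesis
    proof (cases "w \<in> P")
      case True
      have "le v w \<and> w \<noteq> v"
      proof (cases "y = b")
        case False
        then have yP: "y \<in> P" "le v y" "y \<noteq> v" using y by auto
        then have "le y w" using yw le'_old[OF yP(1) True] by auto
        then show ?thesis using trans[of v y w] antisym[of v y] v yP True by auto
      qed (use yw le'_new(6)[OF True] in auto)
      then show ?thesis using 2 le'_new(6)[OF True] by simp
    next
      case False
      then have "w = b" using wc y yw le'_new(4) le'_new(7)[of y] vyu by auto
      then show ?thesis using 2 le'_new(2) by simp
    qed
  next
    case 3
    then have x': "le x u" "x \<noteq> u" using xy le'_new(7) by auto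
    show ?thesis
    proof (cases "w \<in> P")
      case True
      then have "le x w" using le'_new(5)[OF True] yw 3 x' le_uv(1)[of x] trans[of x v w] v by auto
      then show ?thesis using le'_old[OF 3(1) True] x' by simp
    qed (use 3 x' wc le'_new(7,8)[OF 3(1)] in auto)
  next
    case 4
    then have x': "le x u" using xy le'_new(8) by auto
    show ?thesis
    proof (cases "w \<in> P")
      case True
      then have "le v w" "w \<noteq> v" using le'_new(6)[OF True] yw 4 by auto
      then have "le x w" using x' 4 True le_uv(1)[of x] trans[of x v w] v by auto
      then show ?thesis using le'_old[OF 4(1) True] \<open>w \<noteq> v\<close> by simp
    next
      case False
      then have "w = b" using wc yw 4 le'_new(4) by auto
      then show ?thesis using le'_new(8)[OF 4(1)] x' by simp
    qed
  next
    case 5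
    then have xy': "le x y" "\<not> (x = u \<and> y = v)" using xy le'_old by auto
    show ?thesis
    proof (cases "w \<in> P")
      case True
      then have yw': "le y w" "\<not> (y = u \<and> w = v)" using yw le'_old 5 by auto
      \<comment> \<open>The deleted relation cannot be recovered through \<open>y\<close>, since
        that would have to be \<open>u\<close> or \<open>v\<close>.\<close>
      have "\<not> (x = u \<and> w = v)" using between_uv[of y] xy' yw' 5 by auto
      then show ?thesis using le'_old[OF 5(1) True] trans[of x y w] xy' yw' 5 True by simp
    next
      case False
      then have yu: "le y u" using wc yw 5 le'_new(7,8)[of y] by auto
      then have "le x u" using trans[of x y u] xy' 5 u by simp
      moreover have "x \<noteq> u" if "w = a"
        using that yw le'_new(7)[OF 5(2)] antisym[of y u] xy' yu 5 u by auto
      ultimately show ?thesis using le'_new(7,8)[OF 5(1)] wc False by auto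
    qed
  qed
qed

sublocale new: ranked_poset P' le' z t r' n by (rule ranked')

text \<open>As nothing lies strictly between \<open>u\<close> and \<open>v\<close>, a further
  element is comparable to both exactly if it lies below \<open>u\<close> or above \<open>v\<close>;
  these are the elements that the new order makes comparable to both \<open>a\<close> and
  \<open>b\<close>.\<close>

lemma edge_to_path: "edge_to_path (P - {z, t}) (comparable le) u v a b (comparable le')"
proof
  show "comparable le u v" using uv uv_ne by (simp add: comparable_def)
  show "comparable le' a b" using ab le'_new by (simp add: comparable_def)
  show "comparable le x y \<longleftrightarrow> comparable le y x" "comparable le' x y \<longleftrightarrow> comparable le' y x" for x y
    by (rule comparable_sym)+
  show "comparable le' x y \<longleftrightarrow> comparable le x y \<and> {x, y} \<noteq> {u, v}"
    if "x \<in> P - {z, t}" "y \<in> P - {z, t}" for x y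
    using that le'_old[of x y] le'_old[of y x] not_le_uv unfolding comparable_def
    by (auto simp: doubleton_eq_iff)
  fix y assume y: "y \<in> P - {z, t}"
  have yP: "y \<in> P" "y \<noteq> a" "y \<noteq> b" using y ab by auto
  show "comparable le' a y \<longleftrightarrow> y = v \<or> y \<noteq> u \<and> y \<noteq> v \<and> comparable le u y \<and> comparable le v y"
    using yP le'_new(5,7)[OF yP(1)] refl[OF v(1)] between_uv[OF yP(1)] le_uv[OF yP(1)] not_le_uv
    unfolding comparable_def by auto
  show "comparable le' b y \<longleftrightarrow> y = u \<or> y \<noteq> u \<and> y \<noteq> v \<and> comparable le u y \<and> comparable le v y"
    using yP le'_new(6,8)[OF yP(1)] refl[OF u(1)] between_uv[OF yP(1)] le_uv[OF yP(1)] not_le_uv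
    unfolding comparable_def by auto
qed (use u v uv_ne ab in auto)

lemma gor':
  assumes "gor_graph T (P - {z, t}) (comparable le) n"
  shows "gor_graph T (P' - {z, t}) (comparable le') n"
proof -
  interpret edge_to_path "P - {z, t}" "comparable le" u v a b "comparable le'" by (rule edge_to_path)
  have "P' - {z, t} = insert a (insert b (P - {z, t}))" using zt ab by (auto simp: P'_def)
  then show ?thesis using gor_graph_edge_to_path[OF _ assms] fin by simp
qed

end

section \<open>Intervals of Gorenstein* posets\<close>

lemma dim_chain_space:
  assumes "finite K"
  shows "FV.dim (chain_space (T::'k::field itself) K j) = card {G \<in> K. card G = j}"
  using assms
proof (induction K rule: finite_induct)
  case empty
  have "chain_space T {} j \<subseteq> FV.span {}" by (auto simp: chain_space_def fun_eq_iff)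
  then have "FV.dim (chain_space T {} j) \<le> 0"
    using FV.dim_le_card[of "chain_space T {} j" "{}"] by simp
  then show ?case by simp
next
  case (insert G K)
  show ?case
  proof (cases "card G = j")
    case True
    have "single G \<notin> chain_space T K j" using insert.hyps by (auto simp: chain_space_def single_def)
    moreover have "chain_space T (insert G K) j = {f. \<exists>c. f - fscale c (single G) \<in> chain_space T K j}"
    proof (intro set_eqI iffI)
      fix f assume f: "f \<in> chain_space T (insert G K) j"
      have "f - fscale (f G) (single G) \<in> chain_space T K j"
        using f by (auto simp: chain_space_def fscale_def single_def split: if_splits)
      then show "f \<in> {f. \<exists>c. f - fscale c (single G) \<in> chain_space T K j}" by blast
    next
      fix f assume "f \<in> {f. \<exists>c. f - fscale c (single G) \<in> chain_space T K j}"
      then obtain c where c: "f - fscale c (single G) \<in> chain_space T K j" by blast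
      show "f \<in> chain_space T (insert G K) j"
      proof (rule chain_spaceI)
        fix H assume "f H \<noteq> 0"
        show "H \<in> insert G K \<and> card H = j"
        proof (cases "H = G")
          case False
          then have "(f - fscale c (single G)) H \<noteq> 0" using \<open>f H \<noteq> 0\<close> by (simp add: fscale_def single_def)
          then show ?thesis using chain_spaceD[OF c] by blast
        qed (use True in simp)
      qed
    qed
    ultimately have "FV.dim (chain_space T (insert G K) j) = FV.dim (chain_space T K j) + 1"
      using dim_add_line[OF subspace_chain_space chain_space_finite_span[OF insert.hyps(1)]]
        insert.hyps by blast
    moreover have "{H \<in> insert G K. card H = j} = insert G {H \<in> K. card H = j}" using True by auto
    ultimately show ?thesis using insert by simp
  next
    case False
    then have "chain_space T (insert G K) j = chain_space T K j" "{H \<in> insert G K. card H = j} = {H \<in> K. card H = j}"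
      by (auto simp: chain_space_def)
    then show ?thesis using insert by simp
  qed
qed

text \<open>Without the empty face the points have no boundary, so every chain in degree 1 is a
  cycle. This family arises after the empty face has been cancelled against one point.\<close>

lemma red_betti_singletons:
  assumes "finite Y"
  shows "red_betti (T::'k::field itself) ((\<lambda>v. {v}) ` Y) 1 = card Y"
proof -
  let ?K = "(\<lambda>v. {v}) ` Y"
  have "boundary ?K 1 f = 0" for f :: "nat set \<Rightarrow> 'k"
    by (auto simp: boundary_def fun_eq_iff)
  then have "cycles T ?K 1 = chain_space T ?K 1" by (auto simp: cycles_def)
  moreover have "{G \<in> ?K. card G = 1} = ?K" by auto
  ultimately have "FV.dim (cycles T ?K 1) = card Y"
    using dim_chain_space[of ?K T 1] assms by (simp add: card_image)
  moreover have "boundary ?K 2 f = 0" for f :: "nat set \<Rightarrow> 'k"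
    by (auto simp: boundary_def fun_eq_iff intro!: sum.neutral)
  then have "boundaries T ?K 1 \<subseteq> FV.span {}" by (auto simp: boundaries_def numeral_2_eq_2)
  then have "FV.dim (boundaries T ?K 1) \<le> 0"
    using FV.dim_le_card[of "boundaries T ?K 1" "{}"] by simp
  ultimately show ?thesis by (simp add: red_betti_eq)
qed

text \<open>The complex consists of isolated points. Cancelling the empty face against one of them
  leaves \<open>card Y - 1\<close> points and hence that Betti number, which has to be 1.\<close>

lemma betti_sphere_antichain:
  fixes T :: "'k::field itself"
  assumes Y: "finite Y" "\<And>x y. x \<in> Y \<Longrightarrow> y \<in> Y \<Longrightarrow> x \<noteq> y \<Longrightarrow> \<not> E x y"
    and sph: "betti_sphere T (clique Y E) 1"
  shows "card Y = 2"
proof -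
  have "C = {} \<or> (\<exists>v\<in>Y. C = {v})" if "C \<in> clique Y E" for C
  proof (cases "C = {}")
    case False
    then obtain v where "v \<in> C" by blast
    then have "C = {v}" "v \<in> Y" using that Y(2) unfolding clique_def by blast+
    then show ?thesis by blast
  qed simp
  then have Q: "clique Y E = insert {} ((\<lambda>v. {v}) ` Y)"
    by (auto simp: clique_def)
  have b1: "red_betti T (clique Y E) 1 = 1" using sph by (simp add: betti_sphere_def)
  show ?thesis
  proof (cases "Y = {}")
    case True
    then have "clique Y E = {{}}" using Q by simp
    then have "red_betti T (clique Y E) 1 \<le> FV.dim (cycles T {{}} 1)"
      by (simp add: red_betti_eq)
    also have "cycles T {{}} 1 \<subseteq> FV.span {}"
    proof
      fix f assume "f \<in> cycles T {{}} 1"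
      then have "f G = 0" for G by (force simp: cycles_def chain_space_def)
      then have "f = 0" by (simp add: fun_eq_iff)
      then show "f \<in> FV.span {}" by simp
    qed
    then have "FV.dim (cycles T {{}} 1) \<le> 0"
      using FV.dim_le_card[of "cycles T {{}} 1" "{}"] by simp
    finally show ?thesis using b1 by simp
  next
    case False
    then obtain c where c: "c \<in> Y" by blast
    have "red_betti T (clique Y E - {{}, insert c {}}) 1 = red_betti T (clique Y E) 1"
      by (rule red_betti_cancel_unique_facet[OF convex_family_clique[OF Y(1)]]) (use c Q in auto)
    moreover have "clique Y E - {{}, insert c {}} = (\<lambda>v. {v}) ` (Y - {c})" unfolding Q by auto
    ultimately have "card (Y - {c}) = 1" using red_betti_singletons[of "Y - {c}" T] Y b1 by simp
    then show ?thesis using c Y by (simp add: card_Diff_singleton)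
  qed
qed

text \<open>If \<open>U\<close> missed a vertex \<open>w\<close>, the cycle formed by some
  \<open>u\<close> in \<open>U\<close> minus \<open>w\<close> would be a boundary. But the
  coefficients of a boundary sum to 0 over \<open>U\<close>, since no edge leaves \<open>U\<close>,
  whereas here the sum is 1.\<close>

lemma betti_sphere_connected:
  fixes T :: "'k::field itself"
  assumes Y: "finite Y" and sph: "betti_sphere T (clique Y E) d" "d \<noteq> 1"
    and U: "U \<subseteq> Y" "U \<noteq> {}" "\<And>x y. x \<in> U \<Longrightarrow> y \<in> Y \<Longrightarrow> E x y \<Longrightarrow> y \<in> U"
  shows "U = Y"
proof (rule ccontr)
  assume "U \<noteq> Y"
  then obtain u w where uw: "u \<in> U" "w \<in> Y" "w \<notin> U" using U by blast
  let ?Q = "clique Y E"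
  have Q: "convex_family ?Q" by (rule convex_family_clique[OF Y])
  note fin = convex_family_finite[OF Q]
  \<comment> \<open>A truncated difference equal to 0 gives only an inequality of dimensions;
    equality follows because boundaries are cycles.\<close>
  have "red_betti T ?Q 1 = 0" using sph by (simp add: betti_sphere_def)
  then have dims: "FV.dim (cycles T ?Q 1) \<le> FV.dim (boundaries T ?Q 1)" by (simp add: red_betti_eq)
  have eq: "boundaries T ?Q 1 = cycles T ?Q 1"
    by (rule subspace_dim_eq[OF subspace_boundaries subspace_cycles boundaries_subset_cycles[OF Q]
          cycles_finite_span[OF fin(1)] _ dims]) (use fin in simp)
  define f :: "nat set \<Rightarrow> 'k" where "f = single {u} - single {w}"
  have sY: "{v} \<in> ?Q \<longleftrightarrow> v \<in> Y" for v by (auto simp: clique_def)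
  have "f \<in> chain_space T ?Q 1"
    using uw U by (intro chain_spaceI) (auto simp: f_def single_def sY split: if_splits)
  moreover have "boundary ?Q 1 f = 0"
  proof
    fix H show "boundary ?Q 1 f H = 0 H"
    proof (cases "H = {}")
      case True
      have "{} \<in> ?Q" by (simp add: clique_def)
      then have "boundary ?Q 1 f {} = (\<Sum>v\<in>Y. f {v})"
        using boundary_apply[of "{}" ?Q 1 f] by (simp add: sY)
      also have "\<dots> = (\<Sum>v\<in>Y. (if v = u then 1 else 0) - (if v = w then 1 else 0))"
        by (rule sum.cong) (auto simp: f_def single_def)
      also have "\<dots> = 0" using Y uw U by (auto simp: sum_subtractf)
      finally show ?thesis using True by simp
    next
      case False
      then have "card H + 1 \<noteq> 1 \<or> H \<notin> ?Q" using fin(2)[of H] by auto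
      then show ?thesis by (auto simp add: boundary_outside)
    qed
  qed
  ultimately have "f \<in> boundaries T ?Q 1" unfolding eq cycles_alt by blast
  then obtain g where g: "f = boundary ?Q 2 g" by (auto simp: boundaries_def numeral_2_eq_2)
  define X where "X = (\<lambda>v. {w. w \<noteq> v \<and> {w, v} \<in> ?Q})"
  define s :: "nat \<Rightarrow> nat \<Rightarrow> 'k" where "s = (\<lambda>v w. (-1) ^ card {x \<in> {v}. x < w} * g {w, v})"
  have fv: "f {v} = (\<Sum>w\<in>X v. s v w)" if "v \<in> U" for v
    unfolding g X_def s_def using boundary_apply[of "{v}" ?Q 2 g] that U sY[of v] by auto
  have finX: "finite (X v)" for v
    by (rule finite_subset[OF _ Y]) (auto simp: X_def clique_def)
  have fU: "finite U" using Y U finite_subset by blast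
  have "(\<Sum>v\<in>U. f {v}) = (\<Sum>v\<in>U. \<Sum>w\<in>X v. s v w)" using fv by simp
  also have "\<dots> = (\<Sum>(v,w)\<in>Sigma U X. s v w)" using fU finX by (intro sum.Sigma) auto
  \<comment> \<open>Every edge counted here has both ends in \<open>U\<close> and is counted once
    from each end, with opposite signs.\<close>
  also have "\<dots> = 0"
  proof (rule antisymmetric_sum_0)
    show "finite (Sigma U X)" using fU finX by blast
    fix v w assume "(v, w) \<in> Sigma U X"
    then have vw: "v \<in> U" "w \<noteq> v" "{w, v} \<in> ?Q" by (auto simp: X_def)
    then have "E v w" "w \<in> Y" by (auto simp: clique_def)
    then have "w \<in> U" using U vw by blast
    then have "(w, v) \<in> Sigma U X" using vw by (auto simp: X_def insert_commute)
    moreover have "{x \<in> {v}. x < w} = (if v < w then {v} else {})" "{x \<in> {w}. x < v} = (if w < v then {w} else {})"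
      by auto
    then have "s v w = - s w v" using vw by (auto simp: s_def insert_commute)
    ultimately show "v \<noteq> w \<and> (w, v) \<in> Sigma U X \<and> s v w = - s w v" using vw by blast
  qed
  finally have "(\<Sum>v\<in>U. f {v}) = 0" .
  moreover have "(\<Sum>v\<in>U. f {v}) = (\<Sum>v\<in>U. if v = u then 1 else 0)"
    by (rule sum.cong) (use uw in \<open>auto simp: f_def single_def\<close>)
  ultimately show False using fU uw by simp
qed

context ranked_poset
begin

lemma saturated_chain:
  assumes "x \<in> P" "y \<in> P" "le x y"
  shows "\<exists>C. C \<subseteq> {w \<in> P. le x w \<and> le w y} \<and> x \<in> C \<and> y \<in> C \<and> r ` C = {r x..r y}
    \<and> (\<forall>p\<in>C. \<forall>q\<in>C. p = q \<or> comparable le p q)"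
  using assms
proof (induction "r y - r x" arbitrary: x rule: less_induct)
  case less
  show ?case
  proof (cases "x = y")
    case True
    then show ?thesis using less.prems refl by (intro exI[of _ "{x}"]) auto
  next
    case False
    then have lt: "r x < r y" using strict less.prems by blast
    then obtain w where w: "w \<in> P" "le x w" "le w y" "r w = r x + 1"
      using between_rank[of x y "r x + 1"] less.prems by auto
    have "r y - r w < r y - r x" using w(4) lt by simp
    from less.hyps[OF this w(1) less.prems(2) w(3)]
    obtain C where C: "C \<subseteq> {v \<in> P. le w v \<and> le v y}" "w \<in> C" "y \<in> C" "r ` C = {r w..r y}"
      "\<forall>p\<in>C. \<forall>q\<in>C. p = q \<or> comparable le p q"
      by blast
    have xC: "le x v" "v \<in> P" "le v y" if "v \<in> C" for v
    proof -
      show v: "v \<in> P" "le v y" using C(1) that by auto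
      have "le w v" using C(1) that by auto
      then show "le x v" using trans[of x w v] w less.prems(1) v by simp
    qed
    have "x = v \<or> comparable le x v" "v = x \<or> comparable le v x" if "v \<in> C" for v
      using xC(1)[OF that] by (auto simp: comparable_def)
    then have "\<forall>p\<in>insert x C. \<forall>q\<in>insert x C. p = q \<or> comparable le p q"
      using C(5) by blast
    moreover have "r ` insert x C = {r x..r y}" using C(4) w(4) lt by auto
    ultimately show ?thesis
      using C(3) xC less.prems refl[OF less.prems(1)] by (intro exI[of _ "insert x C"]) auto
  qed
qed

text \<open>The interval is the link of a face: the union of a saturated chain from \<open>z\<close>
  to \<open>x\<close> and one from \<open>y\<close> to \<open>t\<close>, without \<open>z\<close>
  and \<open>t\<close>. Its cardinality is found from its ranks, which are 1 to \<open>r x\<close>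
  and \<open>r y\<close> to \<open>n\<close>.\<close>

lemma interval_sphere:
  assumes gor: "gor_graph T (P - {z, t}) (comparable le) n"
    and xy: "x \<in> P" "y \<in> P" "le x y" "x \<noteq> y"
  shows "betti_sphere T (clique (open_interval P le x y) (comparable le)) (r y - r x - 1)"
proof -
  have rxy: "r x < r y" using strict xy by blast
  obtain A where A: "A \<subseteq> {w \<in> P. le z w \<and> le w x}" "x \<in> A" "r ` A = {r z..r x}"
    "\<forall>p\<in>A. \<forall>q\<in>A. p = q \<or> comparable le p q"
    using saturated_chain[of z x] zt bot xy by blast
  obtain B where B: "B \<subseteq> {w \<in> P. le y w \<and> le w t}" "y \<in> B" "r ` B = {r y..r t}"
    "\<forall>p\<in>B. \<forall>q\<in>B. p = q \<or> comparable le p q"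
    using saturated_chain[of y t] zt top xy by blast
  define F where "F = A \<union> B - {z, t}"
  have AP: "w \<in> P" "le w x" "r w \<le> r x" if "w \<in> A" for w
    using A that rank_mono[of w x] xy by auto
  have BP: "w \<in> P" "le y w" "r y \<le> r w" if "w \<in> B" for w
    using B that rank_mono[of y w] xy by auto
  have AB: "comparable le p q" if "p \<in> A" "q \<in> B" for p q
    using AP[OF that(1)] BP[OF that(2)] trans[of p x y] trans[of p y q] xy rxy
    unfolding comparable_def by auto
  have "F \<subseteq> P - {z, t}" using AP BP by (auto simp: F_def)
  moreover have cF: "p = q \<or> comparable le p q" if "p \<in> F" "q \<in> F" for p q
    using that A(4) B(4) AB[of p q] AB[of q p] comparable_sym[of le p q] unfolding F_def by blast
  ultimately have F: "F \<in> clique (P - {z, t}) (comparable le)" by (auto simp: clique_def)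
  have "r ` F = {1..r x} \<union> {r y..n}"
  proof (intro set_eqI iffI)
    fix i assume "i \<in> r ` F"
    then obtain w where w: "w \<in> F" "i = r w" by blast
    then have wP: "w \<in> P" "w \<noteq> z" "w \<noteq> t" using AP BP by (auto simp: F_def)
    then have "1 \<le> i" "i \<le> n" using rank_bounds[of w] w(2) by auto
    moreover have "i \<le> r x \<or> r y \<le> i" using w AP BP by (auto simp: F_def)
    ultimately show "i \<in> {1..r x} \<union> {r y..n}" by auto
  next
    fix i assume i: "i \<in> {1..r x} \<union> {r y..n}"
    have rxn: "r x \<le> n" using rxy rank_mono[of y t] top zt rzt xy by auto
    from i have "i \<in> r ` A \<or> i \<in> r ` B" unfolding A(3) B(3) rzt by auto
    then obtain w where w: "w \<in> A \<union> B" "i = r w" by blast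
    moreover have "w \<noteq> z" "w \<noteq> t" using w i rxn rzt rxy by auto
    ultimately show "i \<in> r ` F" by (auto simp: F_def)
  qed
  moreover have "inj_on r F"
    using cF rank_inj \<open>F \<subseteq> P - {z, t}\<close> by (intro inj_onI) blast
  ultimately have "card F = card ({1..r x} \<union> {r y..n})" using card_image[of r F] by simp
  also have "\<dots> = card {1..r x} + card {r y..n}" by (rule card_Un_disjoint) (use rxy in auto)
  finally have cardF: "card F = r x + (n + 1 - r y)" by simp
  have ryn: "r y \<le> n + 1" using rank_mono[of y t] top zt rzt xy by auto
  have "common_nbrs (P - {z, t}) (comparable le) F = open_interval P le x y"
  proof (intro set_eqI iffI)
    fix w assume "w \<in> common_nbrs (P - {z, t}) (comparable le) F"
    then have w: "w \<in> P" "w \<noteq> z" "w \<noteq> t" and wF: "\<And>f. f \<in> F \<Longrightarrow> comparable le f w"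
      by (auto simp: common_nbrs_def)
    have nF: "r f \<noteq> r w" if "f \<in> F" for f
      using rank_inj[of f w] wF[OF that] w that \<open>F \<subseteq> P - {z, t}\<close> by blast
    have "r w \<notin> r ` F" using nF by force
    then have rw: "r x < r w" "r w < r y"
      using rank_bounds(1)[of w] rank_bounds(2)[of w] w unfolding \<open>r ` F = {1..r x} \<union> {r y..n}\<close> by auto
    have "x \<noteq> t" "y \<noteq> z" using rxy ryn rzt by auto
    have "le x w"
    proof (cases "x = z")
      case False
      then have "comparable le x w" using wF[of x] A(2) \<open>x \<noteq> t\<close> by (auto simp: F_def)
      then show ?thesis using rank_mono[of w x] w xy rw by (auto simp: comparable_def)
    qed (use bot w in simp)
    moreover have "le w y"
    proof (cases "y = t")
      case False
      then have "comparable le y w" using wF[of y] B(2) \<open>y \<noteq> z\<close> by (auto simp: F_def)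
      then show ?thesis using rank_mono[of y w] w xy rw by (auto simp: comparable_def)
    qed (use top w in simp)
    ultimately show "w \<in> open_interval P le x y" using in_open_interval xy rw w by blast
  next
    fix w assume "w \<in> open_interval P le x y"
    then have w: "w \<in> P" "le x w" "le w y" "r x < r w" "r w < r y" using in_open_interval xy by blast+
    have "comparable le f w" if "f \<in> A" for f
      using AP[OF that] trans[of f x w] w xy by (auto simp: comparable_def)
    moreover have "comparable le f w" if "f \<in> B" for f
      using BP[OF that] trans[of w y f] w xy by (auto simp: comparable_def)
    moreover have "w \<notin> F" using AP(3)[of w] BP(3)[of w] w by (auto simp: F_def)
    moreover have "w \<noteq> z" "w \<noteq> t" using w rzt ryn by auto
    ultimately show "w \<in> common_nbrs (P - {z, t}) (comparable le) F"
      using w by (auto simp: common_nbrs_def F_def)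
  qed
  moreover have "betti_sphere T (clique (common_nbrs (P - {z, t}) (comparable le) F) (comparable le)) (n - card F)"
    using gor F unfolding gor_graph_def by blast
  moreover have "n - card F = r y - r x - 1" using cardF rxy ryn by simp
  ultimately show ?thesis by simp
qed

lemma finite_open_interval: "finite (open_interval P le x y)"
  using fin by (simp add: open_interval_def)

lemma thin:
  assumes gor: "gor_graph T (P - {z, t}) (comparable le) n"
    and xy: "x \<in> P" "y \<in> P" "le x y" "r y = r x + 2"
  shows "card (open_interval P le x y) = 2"
proof (rule betti_sphere_antichain[OF finite_open_interval])
  show "betti_sphere T (clique (open_interval P le x y) (comparable le)) 1"
  proof -
    have "x \<noteq> y" "r y - r x - 1 = 1" using xy(4) by auto
    then show ?thesis using interval_sphere[OF gor xy(1-3)] by metis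
  qed
  fix p q assume "p \<in> open_interval P le x y" "q \<in> open_interval P le x y" "p \<noteq> q"
  then have "p \<in> P" "r x < r p" "r p < r y" "q \<in> P" "r x < r q" "r q < r y"
    using in_open_interval[OF xy(1,2)] by blast+
  then have "p \<in> P" "q \<in> P" "r p = r q" using xy(4) by linarith+
  then show "\<not> comparable le p q" using rank_inj by blast
qed

lemma interval_connected:
  assumes gor: "gor_graph T (P - {z, t}) (comparable le) n"
    and xy: "x \<in> P" "y \<in> P" "le x y" "r x + 2 < r y"
    and U: "U \<subseteq> open_interval P le x y" "U \<noteq> {}"
      "\<And>p q. p \<in> U \<Longrightarrow> q \<in> open_interval P le x y \<Longrightarrow> comparable le p q \<Longrightarrow> q \<in> U"
  shows "U = open_interval P le x y"
  by (rule betti_sphere_connected[OF finite_open_interval interval_sphere[OF gor xy(1-3)] _ U])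
     (use xy in auto)

end

section \<open>Flag numbers\<close>

text \<open>The flag f-vector of the interval from \<open>x\<close> to \<open>y\<close>. Ranks are
  those of the whole poset, so the cd-words of an interval are matched from position
  \<open>r x + 1\<close> on.\<close>

definition flag :: "nat set \<Rightarrow> (nat \<Rightarrow> nat \<Rightarrow> bool) \<Rightarrow> (nat \<Rightarrow> nat) \<Rightarrow> nat \<Rightarrow> nat \<Rightarrow> nat set \<Rightarrow> int" where
  "flag P le r x y S = int (card {C \<in> clique (open_interval P le x y) (comparable le). r ` C = S})"

definition h_transform :: "(nat set \<Rightarrow> int) \<Rightarrow> nat set \<Rightarrow> int" where
  "h_transform F S = (\<Sum>T\<in>Pow S. (-1) ^ (card S - card T) * F T)"

lemma h_transform_cong: "(\<And>T. T \<subseteq> S \<Longrightarrow> F T = G T) \<Longrightarrow> h_transform F S = h_transform G S"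
  unfolding h_transform_def by (rule sum.cong) auto

lemma h_transform_add: "h_transform (\<lambda>T. F T + G T) S = h_transform F S + h_transform G S"
  by (simp add: h_transform_def distrib_left sum.distrib)

lemma h_transform_product:
  assumes fin: "finite A" "finite B" and disj: "A \<inter> B = {}"
    and F: "\<And>T. T \<subseteq> A \<union> B \<Longrightarrow> F T = F1 (T \<inter> A) * F2 (T \<inter> B)"
  shows "h_transform F (A \<union> B) = h_transform F1 A * h_transform F2 B"
proof -
  have "h_transform F (A \<union> B) =
      (\<Sum>(X, Y)\<in>Pow A \<times> Pow B. ((-1) ^ (card A - card X) * F1 X) * ((-1) ^ (card B - card Y) * F2 Y))"
    unfolding h_transform_def
  proof (rule sum.reindex_bij_witness[of _ "\<lambda>(X, Y). X \<union> Y" "\<lambda>T. (T \<inter> A, T \<inter> B)"])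
    fix T assume "T \<in> Pow (A \<union> B)"
    then have T: "T \<subseteq> A \<union> B" by blast
    then have eq: "T = (T \<inter> A) \<union> (T \<inter> B)" by blast
    have "card T = card (T \<inter> A) + card (T \<inter> B)"
      by (subst eq, rule card_Un_disjoint) (use fin disj in auto)
    moreover have "card (A \<union> B) = card A + card B" using fin disj by (simp add: card_Un_disjoint)
    moreover have "card (T \<inter> A) \<le> card A" "card (T \<inter> B) \<le> card B" using fin by (auto intro: card_mono)
    ultimately have "card (A \<union> B) - card T = (card A - card (T \<inter> A)) + (card B - card (T \<inter> B))" by simp
    then show "(case (T \<inter> A, T \<inter> B) of (X, Y) \<Rightarrow> ((-1) ^ (card A - card X) * F1 X) * ((-1) ^ (card B - card Y) * F2 Y))
        = (-1) ^ (card (A \<union> B) - card T) * F T"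
      using F[OF T] by (simp add: power_add)
  qed (use disj in auto)
  then show ?thesis
    unfolding h_transform_def by (simp add: sum_product sum.cartesian_product)
qed

text \<open>Once the part \<open>X\<close> of a chain in the ranks \<open>i\<close> and
  \<open>i + 1\<close> is fixed, the rest splits into a part in \<open>L\<close> and a part in
  \<open>R\<close> that can be chosen independently.\<close>

lemma card_cliques_containing:
  assumes sym: "\<And>x y. E x y \<longleftrightarrow> E y x" and X: "X \<in> clique V E" and L: "L \<subseteq> V" "\<And>w. w \<in> L \<Longrightarrow> \<rho> w < (i::nat)"
    and R: "R \<subseteq> V" "\<And>w. w \<in> R \<Longrightarrow> i + 1 < \<rho> w"
    and LR: "\<And>p q. p \<in> L \<Longrightarrow> q \<in> R \<Longrightarrow> E p q"
    and LXR: "\<And>w p. w \<in> L \<union> R \<Longrightarrow> p \<in> X \<Longrightarrow> E p w"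
    and XLR: "\<And>w. w \<in> V \<Longrightarrow> \<rho> w \<in> S \<Longrightarrow> w \<notin> X \<Longrightarrow> (\<And>p. p \<in> X \<Longrightarrow> E p w) \<Longrightarrow> w \<in> L \<union> R"
    and XS: "\<rho> ` X = S \<inter> {i, i + 1}"
  shows "card {C \<in> clique V E. X \<subseteq> C \<and> \<rho> ` C = S} =
    card {Q \<in> clique L E. \<rho> ` Q = S \<inter> {..<i}} * card {Q \<in> clique R E. \<rho> ` Q = S \<inter> {i+1<..}}"
proof -
  let ?A = "{Q \<in> clique L E. \<rho> ` Q = S \<inter> {..<i}}" and ?B = "{Q \<in> clique R E. \<rho> ` Q = S \<inter> {i+1<..}}"
  have Xr: "\<rho> p = i \<or> \<rho> p = i + 1" if "p \<in> X" for p using XS that by blast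
  have disj: "X \<inter> L = {}" "X \<inter> R = {}" "L \<inter> R = {}" using Xr L(2) R(2) by fastforce+
  have "bij_betw (\<lambda>(Q1, Q2). X \<union> Q1 \<union> Q2) (?A \<times> ?B) {C \<in> clique V E. X \<subseteq> C \<and> \<rho> ` C = S}"
  proof (rule bij_betw_byWitness[where f' = "\<lambda>C. (C \<inter> L, C \<inter> R)"])
    show "\<forall>Q\<in>?A \<times> ?B. (\<lambda>C. (C \<inter> L, C \<inter> R)) ((\<lambda>(Q1, Q2). X \<union> Q1 \<union> Q2) Q) = Q"
      using disj by (auto simp: clique_def)
    have split: "C = X \<union> (C \<inter> L) \<union> (C \<inter> R)" if "C \<in> clique V E" "X \<subseteq> C" "\<rho> ` C = S" for C
    proof -
      have "w \<in> X \<union> (C \<inter> L) \<union> (C \<inter> R)" if w: "w \<in> C" for w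
      proof (cases "w \<in> X")
        case False
        have "E p w" if "p \<in> X" for p
          using that \<open>C \<in> clique V E\<close> \<open>X \<subseteq> C\<close> w False by (auto simp: clique_def)
        moreover have "w \<in> V" "\<rho> w \<in> S" using w that \<open>C \<in> clique V E\<close> \<open>\<rho> ` C = S\<close> by (auto simp: clique_def)
        ultimately show ?thesis using XLR False w by blast
      qed simp
      then show ?thesis using that by blast
    qed
    then show "\<forall>C\<in>{C \<in> clique V E. X \<subseteq> C \<and> \<rho> ` C = S}.
        (\<lambda>(Q1, Q2). X \<union> Q1 \<union> Q2) ((\<lambda>C. (C \<inter> L, C \<inter> R)) C) = C"
      by auto
    show "(\<lambda>(Q1, Q2). X \<union> Q1 \<union> Q2) ` (?A \<times> ?B) \<subseteq> {C \<in> clique V E. X \<subseteq> C \<and> \<rho> ` C = S}"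
    proof (rule image_subsetI)
      fix Qs assume "Qs \<in> ?A \<times> ?B"
      then obtain Q1 Q2 where Qs: "Qs = (Q1, Q2)"
        and Q: "Q1 \<in> clique L E" "\<rho> ` Q1 = S \<inter> {..<i}" "Q2 \<in> clique R E" "\<rho> ` Q2 = S \<inter> {i + 1<..}"
        by blast
      have sub: "Q1 \<subseteq> L" "Q2 \<subseteq> R" using Q by (auto simp: clique_def)
      have "p = q \<or> E p q" if "p \<in> X \<union> Q1 \<union> Q2" "q \<in> X \<union> Q1 \<union> Q2" for p q
      proof -
        have 1: "p = q \<or> E p q" if "p \<in> X" "q \<in> X" for p q using X that by (auto simp: clique_def)
        have 2: "p = q \<or> E p q" if "p \<in> Q1" "q \<in> Q1" for p q using Q that by (auto simp: clique_def)
        have 3: "p = q \<or> E p q" if "p \<in> Q2" "q \<in> Q2" for p q using Q that by (auto simp: clique_def)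
        have 4: "E p q \<and> E q p" if "p \<in> X" "q \<in> Q1 \<union> Q2" for p q
          using LXR[of q p] sym[of p q] that sub by auto
        have 5: "E p q \<and> E q p" if "p \<in> Q1" "q \<in> Q2" for p q
          using LR[of p q] sym[of p q] that sub by auto
        show ?thesis using that 1 2 3 4 5 by (elim UnE) simp_all
      qed
      moreover have "X \<union> Q1 \<union> Q2 \<subseteq> V" using X sub L R by (auto simp: clique_def)
      moreover have "\<rho> ` (X \<union> Q1 \<union> Q2) = S"
        unfolding image_Un XS Q(2,4) by auto
      ultimately show "(case Qs of (Q1, Q2) \<Rightarrow> X \<union> Q1 \<union> Q2) \<in> {C \<in> clique V E. X \<subseteq> C \<and> \<rho> ` C = S}"
        unfolding Qs by (auto simp: clique_def)
    qed
    show "(\<lambda>C. (C \<inter> L, C \<inter> R)) ` {C \<in> clique V E. X \<subseteq> C \<and> \<rho> ` C = S} \<subseteq> ?A \<times> ?B"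
    proof (rule image_subsetI)
      fix C assume "C \<in> {C \<in> clique V E. X \<subseteq> C \<and> \<rho> ` C = S}"
      then have C: "C \<in> clique V E" "X \<subseteq> C" "S = \<rho> ` C" by auto
      note sp = split[OF C(1,2) C(3)[symmetric]]
      have "\<rho> ` (C \<inter> L) = \<rho> ` C \<inter> {..<i}"
      proof (intro set_eqI iffI)
        fix j assume "j \<in> \<rho> ` C \<inter> {..<i}"
        then obtain w where w: "w \<in> C" "j = \<rho> w" "\<rho> w < i" by auto
        then have "w \<notin> X" "w \<notin> R" using Xr[of w] R(2)[of w] by auto
        then show "j \<in> \<rho> ` (C \<inter> L)" using sp w by blast
      qed (use L in auto)
      moreover have "\<rho> ` (C \<inter> R) = \<rho> ` C \<inter> {i+1<..}"
      proof (intro set_eqI iffI)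
        fix j assume "j \<in> \<rho> ` C \<inter> {i+1<..}"
        then obtain w where w: "w \<in> C" "j = \<rho> w" "i + 1 < \<rho> w" by auto
        then have "w \<notin> X" "w \<notin> L" using Xr[of w] L(2)[of w] by auto
        then show "j \<in> \<rho> ` (C \<inter> R)" using sp w by blast
      qed (use R in auto)
      ultimately show "(C \<inter> L, C \<inter> R) \<in> ?A \<times> ?B"
        using C by (auto simp: clique_def)
    qed
  qed
  then show ?thesis
    using bij_betw_same_card by (fastforce simp: card_cartesian_product)
qed

context cover_split
begin

lemma open_interval_unchanged:
  assumes "x \<in> P" "y \<in> P" "\<not> (le x u \<and> le v y)"
  shows "open_interval P' le' x y = open_interval P le x y"
proof (intro set_eqI iffI)
  fix w assume w: "w \<in> open_interval P' le' x y"
  then have "w \<noteq> a" "w \<noteq> b" using le'_new(5,6)[OF assms(2)] le'_new(7,8)[OF assms(1)] assms(3)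
    by (auto simp: open_interval_def)
  then have "w \<in> P" using w by (auto simp: open_interval_def P'_def)
  then show "w \<in> open_interval P le x y"
    using w le'_old[of x w] le'_old[of w y] assms by (auto simp: open_interval_def)
next
  fix w assume w: "w \<in> open_interval P le x y"
  then have wP: "w \<in> P" "le x w" "le w y" "w \<noteq> x" "w \<noteq> y" by (auto simp: open_interval_def)
  have "\<not> (x = u \<and> w = v)" "\<not> (w = u \<and> y = v)" using wP assms refl[OF u(1)] refl[OF v(1)] by auto
  then show "w \<in> open_interval P' le' x y"
    using wP le'_old[of x w] le'_old[of w y] assms by (auto simp: open_interval_def P'_def)
qed

lemma flag_unchanged:
  assumes "x \<in> P" "y \<in> P" "\<not> (le x u \<and> le v y)"
  shows "flag P' le' r' x y = flag P le r x y"
proof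
  fix S
  let ?O = "open_interval P le x y"
  have O: "w \<in> P" "r' w = r w" if "w \<in> ?O" for w using that r'_simps(3) by (auto simp: open_interval_def)
  have "\<not> (u \<in> ?O \<and> v \<in> ?O)" using assms by (auto simp: open_interval_def)
  then have "clique ?O (comparable le') = clique ?O (comparable le)"
    using O(1) le'_old by (intro clique_cong) (auto simp: comparable_def)
  moreover have "r' ` C = r ` C" if "C \<in> clique ?O (comparable le)" for C
    using that O(2) by (intro image_cong) (auto simp: clique_def)
  ultimately show "flag P' le' r' x y S = flag P le r x y S"
    unfolding flag_def open_interval_unchanged[OF assms] by (metis (no_types, lifting))
qed

text \<open>Let \<open>?m\<close> count the ways to complete a chain below \<open>u\<close> and
  above \<open>v\<close>. If \<open>S\<close> contains just one of the two ranks, the chains through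
  \<open>a\<close>, respectively \<open>b\<close>, are new. If it contains both, there are three
  types of new chains, through {a, b}, {a, v} or {u, b}, and those through {u, v} are lost, a gain
  of 3 - 1 = 2 times \<open>?m\<close>.\<close>

lemma flag_split:
  assumes x: "x \<in> P" "le x u" "x \<noteq> u" and y: "y \<in> P" "le v y" "y \<noteq> v"
  shows "flag P' le' r' x y S = flag P le r x y S +
    flag P le r x u (S \<inter> {..<r u}) * flag P le r v y (S \<inter> {r u + 1<..}) *
      ((if r u \<in> S then 1 else 0) + (if r u + 1 \<in> S then 1 else 0))"
proof -
  let ?O = "open_interval P le x y" and ?O' = "insert a (insert b (open_interval P le x y))"
  let ?L = "open_interval P le x u" and ?R = "open_interval P le v y"
  let ?E = "comparable le" and ?E' = "comparable le'"
  let ?m = "card {Q \<in> clique ?L ?E. r ` Q = S \<inter> {..<r u}} * card {Q \<in> clique ?R ?E. r ` Q = S \<inter> {r u + 1<..}}"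
  let ?K = "{C \<in> clique ?O ?E. r ` C = S}" and ?K' = "{C \<in> clique ?O' ?E'. r' ` C = S}"
  have xv: "le x v" and uy: "le u y" using le_uv x y by auto
  have Oi: "w \<in> ?O \<longleftrightarrow> w \<in> P \<and> le x w \<and> le w y \<and> w \<noteq> x \<and> w \<noteq> y" for w
    by (auto simp: open_interval_def)
  have Li: "w \<in> ?L \<longleftrightarrow> w \<in> P \<and> le x w \<and> le w u \<and> w \<noteq> x \<and> w \<noteq> u" for w
    by (auto simp: open_interval_def)
  have Ri: "w \<in> ?R \<longleftrightarrow> w \<in> P \<and> le v w \<and> le w y \<and> w \<noteq> v \<and> w \<noteq> y" for w
    by (auto simp: open_interval_def)
  have xnv: "x \<noteq> v" using x(2) not_le_uv by blast
  have ynu: "y \<noteq> u" using y(2) not_le_uv by blast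
  have uO: "u \<in> ?O" "v \<in> ?O" using Oi u v x y xv uy xnv ynu by auto
  have LO: "w \<in> ?O \<and> r w < r u" if "w \<in> ?L" for w
    using that Li Oi trans[of w u y] uy y u strict[of w u] antisym[of y u] uy by auto
  have RO: "w \<in> ?O \<and> r u + 1 < r w" if "w \<in> ?R" for w
    using that Ri Oi trans[of x v w] xv x v strict[of v w] antisym[of x v] xv uv by auto
  have OP: "w \<in> P" "r' w = r w" "w \<noteq> a" "w \<noteq> b" if "w \<in> ?O" for w
    using that Oi r'_simps(3) ab by auto
  have O': "open_interval P' le' x y = ?O'"
  proof (intro set_eqI iffI)
    fix w assume w: "w \<in> open_interval P' le' x y"
    show "w \<in> ?O'"
    proof (cases "w \<in> P")
      case True
      then show ?thesis using w le'_old[of x w] le'_old[of w y] x y by (auto simp: open_interval_def)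
    qed (use w in \<open>auto simp: open_interval_def P'_def\<close>)
  next
    fix w assume w: "w \<in> ?O'"
    have "a \<noteq> x" "a \<noteq> y" "b \<noteq> x" "b \<noteq> y" using x y ab by auto
    moreover have "le' x w \<and> le' w y" if "w \<in> ?O"
      using that Oi le'_old[of x w] le'_old[of w y] x y by auto
    ultimately show "w \<in> open_interval P' le' x y"
      using w le'_new(5,6)[of y] le'_new(7,8)[of x] x y by (auto simp: open_interval_def P'_def)
  qed
  have fO: "finite ?O" "finite ?O'" using finite_open_interval by auto
  have ru: "r' a = r u" "r' b = r u + 1" "r' u = r u" "r' v = r u + 1"
    using r'_simps u v uv by auto
  have LR: "?E p q" if "p \<in> ?L" "q \<in> ?R" for p q
  proof -
    have "le p v" using that Li le_uv(1)[of p] by blast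
    moreover have "p \<noteq> q" using LO[OF that(1)] RO[OF that(2)] by auto
    ultimately show ?thesis using that Li Ri trans[of p v q] v by (auto simp: comparable_def)
  qed
  have eqE: "?E' p q \<longleftrightarrow> ?E p q" if "p \<in> P" "q \<in> P" "{p, q} \<noteq> {u, v}" for p q
    using that le'_old[of p q] le'_old[of q p] not_le_uv by (auto simp: comparable_def)
  have nuv: "u \<notin> ?L" "u \<notin> ?R" "v \<notin> ?L" "v \<notin> ?R"
    using Li Ri not_le_uv by auto
  have cl: "{Q \<in> clique A ?E'. r' ` Q = T} = {Q \<in> clique A ?E. r ` Q = T}" if "A = ?L \<or> A = ?R" for A T
  proof -
    have A: "A \<subseteq> ?O" "u \<notin> A" using that LO RO nuv by blast+
    have "clique A ?E' = clique A ?E"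
      by (rule clique_cong, rule eqE) (use A OP in \<open>auto simp: doubleton_eq_iff\<close>)
    moreover have "r' ` C = r ` C" if "C \<in> clique A ?E" for C
      using that A OP(2) by (intro image_cong) (auto simp: clique_def)
    ultimately show ?thesis by (simp cong: conj_cong)
  qed
  have wab: "?E' a w" "?E' b w" "?E' u w" "?E' v w" "?E u w" "?E v w" if "w \<in> ?L \<union> ?R" for w
  proof -
    have w: "w \<in> P" "w \<noteq> a" "w \<noteq> b" "w \<noteq> u" "w \<noteq> v"
    proof -
      have "w \<in> ?O" using that LO RO by blast
      then show "w \<in> P" "w \<noteq> a" "w \<noteq> b" using OP by blast+
      show "w \<noteq> u" "w \<noteq> v" using that nuv by blast+
    qed
    have cases: "(le w u) \<or> (le v w)" using that Li Ri by auto
    show "?E' a w" "?E' b w" using le'_new(5-8)[OF w(1)] w cases by (auto simp: comparable_def)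
    show "?E u w" "?E v w" using cases le_uv[OF w(1)] w by (auto simp: comparable_def)
    then show "?E' u w" "?E' v w" using eqE[of u w] eqE[of v w] u v w by (auto simp: doubleton_eq_iff)
  qed
  have a_nbr: "w \<in> ?L \<union> ?R \<or> w = v \<or> w = b" if "w \<in> ?O'" "w \<noteq> a" "?E' a w" for w
    using that le'_new(5,7)[of w] Li Ri Oi by (auto simp: comparable_def)
  have b_nbr: "w \<in> ?L \<union> ?R \<or> w = u \<or> w = a" if "w \<in> ?O'" "w \<noteq> b" "?E' b w" for w
    using that le'_new(6,8)[of w] Li Ri Oi by (auto simp: comparable_def)
  have uv_nbr: "w \<in> ?L \<union> ?R" if "w \<in> ?O" "?E u w" "?E v w" for w
    using that between_uv[of w] not_le_uv Li Ri Oi le_uv[of w] by (auto simp: comparable_def)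
  have adj: "?E' a v" "?E' a b" "?E' b u" "?E' b a" "?E' u b" "?E' v a" "\<not> ?E' v b" "\<not> ?E' b v" "\<not> ?E' u a" "\<not> ?E' a u" "?E u v"
    "\<not> ?E' u v"
    using le'_new ab refl u v uv uv_ne not_le_uv le'_old[of u v] le'_old[of v u] by (auto simp: comparable_def)
  have cnt: "card {C \<in> clique ?O' ?E'. X \<subseteq> C \<and> r' ` C = S} = ?m"
    if X: "X \<in> clique ?O' ?E'" "X \<subseteq> {a, b, u, v}" "r' ` X = S \<inter> {r u, r u + 1}"
      and nb: "\<And>w. w \<in> ?O' \<Longrightarrow> r' w \<in> S \<Longrightarrow> w \<notin> X \<Longrightarrow> (\<And>p. p \<in> X \<Longrightarrow> ?E' p w) \<Longrightarrow> w \<in> ?L \<union> ?R" for X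
  proof -
    have "card {C \<in> clique ?O' ?E'. X \<subseteq> C \<and> r' ` C = S} =
      card {Q \<in> clique ?L ?E'. r' ` Q = S \<inter> {..<r u}} * card {Q \<in> clique ?R ?E'. r' ` Q = S \<inter> {r u + 1<..}}"
    proof (rule card_cliques_containing[OF comparable_sym X(1)])
      show "?L \<subseteq> ?O'" "?R \<subseteq> ?O'" using LO RO by blast+
      show "r' w < r u" if "w \<in> ?L" for w using LO[OF that] OP(2) by auto
      show "r u + 1 < r' w" if "w \<in> ?R" for w using RO[OF that] OP(2) by auto
      show "?E' p q" if "p \<in> ?L" "q \<in> ?R" for p q
        using LR[OF that] eqE[of p q] that LO RO OP nuv by (auto simp: doubleton_eq_iff)
      show "?E' p w" if "w \<in> ?L \<union> ?R" "p \<in> X" for w p using wab[OF that(1)] X(2) that(2) by blast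
      show "w \<in> ?L \<union> ?R" if "w \<in> ?O'" "r' w \<in> S" "w \<notin> X" "\<And>p. p \<in> X \<Longrightarrow> ?E' p w" for w
        by (rule nb[OF that])
    qed (use X in auto)
    then show ?thesis by (simp add: cl)
  qed
  have cnt_uv: "card {C \<in> clique ?O ?E. {u, v} \<subseteq> C \<and> r ` C = S} = ?m" if "r u \<in> S" "r u + 1 \<in> S"
  proof (rule card_cliques_containing[OF comparable_sym])
    show "{u, v} \<in> clique ?O ?E" using uO adj(11) comparable_sym[of le u v] by (auto simp: clique_def)
    show "?L \<subseteq> ?O" "?R \<subseteq> ?O" using LO RO by blast+
    show "?E p w" if "w \<in> ?L \<union> ?R" "p \<in> {u, v}" for w p using wab[OF that(1)] that(2) by blast
    show "w \<in> ?L \<union> ?R" if "w \<in> ?O" "\<And>p. p \<in> {u, v} \<Longrightarrow> ?E p w" for w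
      using uv_nbr that by blast
  qed (use LO RO LR uv that in auto)
  have fK: "finite ?K" "finite ?K'" using finite_clique fO convex_family_finite(1)[OF convex_family_clique] by auto
  have old: "{C \<in> ?K'. a \<notin> C \<and> b \<notin> C} = ?K - {C \<in> clique ?O ?E. {u, v} \<subseteq> C \<and> r ` C = S}"
  proof (intro set_eqI iffI)
    fix C assume C: "C \<in> {C \<in> ?K'. a \<notin> C \<and> b \<notin> C}"
    then have CO: "C \<subseteq> ?O" and nuvC: "\<not> {u, v} \<subseteq> C" using adj uv_ne by (auto simp: clique_def)
    have "?E p q" if "p \<in> C" "q \<in> C" "p \<noteq> q" for p q
    proof -
      have "?E' p q" "p \<in> P" "q \<in> P" using C that CO OP(1) by (auto simp: clique_def)
      moreover have "{p, q} \<noteq> {u, v}" using nuvC that by (auto simp: doubleton_eq_iff)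
      ultimately show ?thesis using eqE by blast
    qed
    moreover have "r ` C = r' ` C" using CO OP(2) by (intro image_cong) auto
    ultimately show "C \<in> ?K - {C \<in> clique ?O ?E. {u, v} \<subseteq> C \<and> r ` C = S}"
      using C CO nuvC by (auto simp: clique_def)
  next
    fix C assume C: "C \<in> ?K - {C \<in> clique ?O ?E. {u, v} \<subseteq> C \<and> r ` C = S}"
    then have CO: "C \<subseteq> ?O" and nuvC: "\<not> {u, v} \<subseteq> C" by (auto simp: clique_def)
    have "?E' p q" if "p \<in> C" "q \<in> C" "p \<noteq> q" for p q
    proof -
      have "?E p q" "p \<in> P" "q \<in> P" using C that CO OP(1) by (auto simp: clique_def)
      moreover have "{p, q} \<noteq> {u, v}" using nuvC that by (auto simp: doubleton_eq_iff)
      ultimately show ?thesis using eqE by blast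
    qed
    moreover have "r' ` C = r ` C" using CO OP(2) by (intro image_cong) auto
    moreover have "a \<notin> C" "b \<notin> C" using CO OP by blast+
    ultimately show "C \<in> {C \<in> ?K'. a \<notin> C \<and> b \<notin> C}"
      using C CO by (auto simp: clique_def)
  qed
  let ?S = "\<lambda>X. {C \<in> clique ?O' ?E'. X \<subseteq> C \<and> r' ` C = S}"
  have fS: "finite (?S X)" for X by (rule finite_subset[OF _ fK(2)]) auto
  have fold: "finite {C \<in> ?K'. a \<notin> C \<and> b \<notin> C}" by (rule finite_subset[OF _ fK(2)]) auto
  have inr: "r' w \<in> S" if "w \<in> C" "r' ` C = S" for w C using that by blast
  have none: False if "{u, v} \<subseteq> C" "r ` C = S" "r u \<notin> S \<or> r u + 1 \<notin> S" for C
  proof -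
    have "r u \<in> r ` C" "r v \<in> r ` C" using that(1) by blast+
    then show False using that(2,3) uv(2) by simp
  qed
  have old0: "{C \<in> ?K'. a \<notin> C \<and> b \<notin> C} = ?K" if "r u \<notin> S \<or> r u + 1 \<notin> S"
  proof -
    have "{C \<in> clique ?O ?E. {u, v} \<subseteq> C \<and> r ` C = S} = {}" using none that by blast
    then show ?thesis using old by (simp only: Diff_empty)
  qed
  have main: "int (card ?K') = int (card ?K) + int ?m * ((if r u \<in> S then 1 else 0) + (if r u + 1 \<in> S then 1 else 0))"
  proof (cases "r u \<in> S"; cases "r u + 1 \<in> S")
    assume S: "r u \<in> S" "r u + 1 \<in> S"
    \<comment> \<open>In rank \<open>r u + 1\<close> a chain through \<open>a\<close> can only use
      \<open>b\<close> or \<open>v\<close>; in rank \<open>r u\<close> a chain through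
      \<open>b\<close> can only use \<open>a\<close> or \<open>u\<close>.\<close>
    have eq: "?K' = {C \<in> ?K'. a \<notin> C \<and> b \<notin> C} \<union> (?S {a, b} \<union> (?S {a, v} \<union> ?S {u, b}))"
    proof (intro set_eqI iffI)
      fix C assume C: "C \<in> ?K'"
      have Cadj: "?E' p q" if "p \<in> C" "q \<in> C" "p \<noteq> q" for p q using C that by (auto simp: clique_def)
      have "v \<in> C" if "a \<in> C" "b \<notin> C"
      proof -
        have "r u + 1 \<in> r' ` C" using C S by simp
        then obtain w where w: "w \<in> C" "r' w = r u + 1" by auto
        then have "w \<noteq> a" using ru by auto
        then have "w \<in> ?L \<union> ?R \<or> w = v \<or> w = b" using a_nbr[of w] Cadj[of a w] that w C by (auto simp: clique_def)
        then have "w = v" using w that LO RO OP(2) by fastforce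
        then show ?thesis using w by simp
      qed
      moreover have "u \<in> C" if "b \<in> C" "a \<notin> C"
      proof -
        have "r u \<in> r' ` C" using C S by simp
        then obtain w where w: "w \<in> C" "r' w = r u" by auto
        then have "w \<noteq> b" using ru by auto
        then have "w \<in> ?L \<union> ?R \<or> w = u \<or> w = a" using b_nbr[of w] Cadj[of b w] that w C by (auto simp: clique_def)
        then have "w = u" using w that LO RO OP(2) by fastforce
        then show ?thesis using w by simp
      qed
      ultimately show "C \<in> {C \<in> ?K'. a \<notin> C \<and> b \<notin> C} \<union> (?S {a, b} \<union> (?S {a, v} \<union> ?S {u, b}))"
        using C by blast
    qed auto
    have nb: False if "C \<in> clique ?O' ?E'" "v \<in> C \<and> b \<in> C \<or> u \<in> C \<and> a \<in> C" for C
      using that adj(7,9) u v ab by (auto simp: clique_def)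
    have d1: "?S {a, v} \<inter> ?S {u, b} = {}" and d2: "?S {a, b} \<inter> (?S {a, v} \<union> ?S {u, b}) = {}"
      using nb by blast+
    have d3: "{C \<in> ?K'. a \<notin> C \<and> b \<notin> C} \<inter> (?S {a, b} \<union> (?S {a, v} \<union> ?S {u, b})) = {}" by blast
    note fU = finite_UnI[OF fS fS]
    have "card ?K' = card {C \<in> ?K'. a \<notin> C \<and> b \<notin> C} + (card (?S {a, b}) + (card (?S {a, v}) + card (?S {u, b})))"
      using HOL.trans[OF arg_cong[OF eq, of card] card_Un_disjoint[OF fold finite_UnI[OF fS fU] d3]]
        card_Un_disjoint[OF fS fU d2] card_Un_disjoint[OF fS fS d1] by simp
    moreover have "card (?S {a, b}) = ?m"
    proof (rule cnt)
      fix w assume "w \<in> ?O'" "w \<notin> {a, b}" "\<And>p. p \<in> {a, b} \<Longrightarrow> ?E' p w"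
      then show "w \<in> ?L \<union> ?R" using a_nbr[of w] adj(8) by blast
    qed (use adj(2,4) ru S in \<open>auto simp: clique_def\<close>)
    moreover have "card (?S {a, v}) = ?m"
    proof (rule cnt)
      fix w assume "w \<in> ?O'" "w \<notin> {a, v}" "\<And>p. p \<in> {a, v} \<Longrightarrow> ?E' p w"
      then show "w \<in> ?L \<union> ?R" using a_nbr[of w] adj(7) by blast
    qed (use adj ru S uO ab in \<open>auto simp: clique_def\<close>)
    moreover have "card (?S {u, b}) = ?m"
    proof (rule cnt)
      fix w assume "w \<in> ?O'" "w \<notin> {u, b}" "\<And>p. p \<in> {u, b} \<Longrightarrow> ?E' p w"
      then show "w \<in> ?L \<union> ?R" using b_nbr[of w] adj(9) by blast
    qed (use adj ru S uO ab in \<open>auto simp: clique_def\<close>)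
    \<comment> \<open>The old chains through both \<open>u\<close> and \<open>v\<close> disappear.
      The bound on \<open>?m\<close> that follows makes the natural subtraction exact.\<close>
    moreover have "card {C \<in> ?K'. a \<notin> C \<and> b \<notin> C} = card ?K - ?m"
      unfolding old using cnt_uv[OF S] fK by (subst card_Diff_subset) (auto intro: finite_subset[OF _ fK(1)])
    moreover have "?m \<le> card ?K"
      unfolding cnt_uv[OF S, symmetric] by (rule card_mono[OF fK(1)]) auto
    ultimately show ?thesis using S by simp
  next
    assume S: "r u \<in> S" "r u + 1 \<notin> S"
    have nb: "b \<notin> C" "v \<notin> C" if "C \<in> ?K'" for C using inr[of b C] inr[of v C] that S ru by auto
    have eq: "?K' = {C \<in> ?K'. a \<notin> C \<and> b \<notin> C} \<union> ?S {a}" using nb by blast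
    have d: "{C \<in> ?K'. a \<notin> C \<and> b \<notin> C} \<inter> ?S {a} = {}" by blast
    have "card ?K' = card {C \<in> ?K'. a \<notin> C \<and> b \<notin> C} + card (?S {a})"
      by (rule HOL.trans[OF arg_cong[OF eq, of card] card_Un_disjoint[OF fold fS d]])
    moreover have "card (?S {a}) = ?m"
    proof (rule cnt)
      fix w assume "w \<in> ?O'" "r' w \<in> S" "w \<notin> {a}" "\<And>p. p \<in> {a} \<Longrightarrow> ?E' p w"
      then show "w \<in> ?L \<union> ?R" using a_nbr[of w] ru S by auto
    qed (use ru S in \<open>auto simp: clique_def\<close>)
    moreover have "{C \<in> ?K'. a \<notin> C \<and> b \<notin> C} = ?K" by (rule old0) (use S in simp)
    ultimately have "card ?K' = card ?K + ?m" by (simp only:)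
    then show ?thesis using S by simp
  next
    assume S: "r u \<notin> S" "r u + 1 \<in> S"
    have na: "a \<notin> C" "u \<notin> C" if "C \<in> ?K'" for C using inr[of a C] inr[of u C] that S ru by auto
    have eq: "?K' = {C \<in> ?K'. a \<notin> C \<and> b \<notin> C} \<union> ?S {b}" using na by blast
    have d: "{C \<in> ?K'. a \<notin> C \<and> b \<notin> C} \<inter> ?S {b} = {}" by blast
    have "card ?K' = card {C \<in> ?K'. a \<notin> C \<and> b \<notin> C} + card (?S {b})"
      by (rule HOL.trans[OF arg_cong[OF eq, of card] card_Un_disjoint[OF fold fS d]])
    moreover have "card (?S {b}) = ?m"
    proof (rule cnt)
      fix w assume "w \<in> ?O'" "r' w \<in> S" "w \<notin> {b}" "\<And>p. p \<in> {b} \<Longrightarrow> ?E' p w"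
      then show "w \<in> ?L \<union> ?R" using b_nbr[of w] ru S by auto
    qed (use ru S in \<open>auto simp: clique_def\<close>)
    moreover have "{C \<in> ?K'. a \<notin> C \<and> b \<notin> C} = ?K" by (rule old0) (use S in simp)
    ultimately have "card ?K' = card ?K + ?m" by (simp only:)
    then show ?thesis using S by simp
  next
    assume S: "r u \<notin> S" "r u + 1 \<notin> S"
    have "a \<notin> C" "b \<notin> C" if "C \<in> ?K'" for C using inr[of a C] inr[of b C] that S ru by auto
    then have "{C \<in> ?K'. a \<notin> C \<and> b \<notin> C} = ?K'" by blast
    moreover have "{C \<in> ?K'. a \<notin> C \<and> b \<notin> C} = ?K" by (rule old0) (use S in simp)
    ultimately have "card ?K' = card ?K" by (simp only:)
    then show ?thesis using S by simp
  qed
  then show ?thesis unfolding flag_def O' by simp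
qed

end

section \<open>Coefficients of the cd-index\<close>

lemma cd_words_0: "cd_words 0 = {[]}"
proof -
  have "cd_deg w = 0 \<longleftrightarrow> w = []" for w by (cases w rule: cd_deg.cases) auto
  then show ?thesis by (simp add: cd_words_def)
qed

lemma cd_words_1: "cd_words (Suc 0) = {[C]}"
proof -
  have "cd_deg w = Suc 0 \<longleftrightarrow> w = [C]" for w
    using cd_words_0 by (cases w rule: cd_deg.cases) (auto simp: cd_words_def)
  then show ?thesis by (auto simp: cd_words_def)
qed

lemma cd_words_Suc_Suc: "cd_words (Suc (Suc m)) = (#) C ` cd_words (Suc m) \<union> (#) D ` cd_words m"
proof -
  have "cd_deg w = Suc (Suc m) \<longleftrightarrow> w \<in> (#) C ` cd_words (Suc m) \<union> (#) D ` cd_words m" for w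
    by (cases w rule: cd_deg.cases) (auto simp: cd_words_def)
  then show ?thesis by (auto simp: cd_words_def)
qed

lemma finite_cd_words: "finite (cd_words m)"
  by (induction m rule: induct_nat_012) (simp_all add: cd_words_0 cd_words_1 cd_words_Suc_Suc)

lemma cd_deg_append: "cd_deg (w @ w') = cd_deg w + cd_deg w'"
  by (induction w rule: cd_deg.induct) auto

lemma cd_match_append: "cd_match (w @ w') k S \<longleftrightarrow> cd_match w k S \<and> cd_match w' (k + cd_deg w) S"
  by (induction w arbitrary: k rule: cd_deg.induct) (auto simp: algebra_simps)

lemma cd_match_cong:
  "(\<And>i. k \<le> i \<Longrightarrow> i < k + cd_deg w \<Longrightarrow> i \<in> S \<longleftrightarrow> i \<in> S') \<Longrightarrow> cd_match w k S = cd_match w k S'"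
  by (induction w arbitrary: k rule: cd_deg.induct) auto

definition cd_expands :: "nat \<Rightarrow> nat \<Rightarrow> (nat set \<Rightarrow> int) \<Rightarrow> (cd list \<Rightarrow> int) \<Rightarrow> bool" where
  "cd_expands k m h \<Phi> \<longleftrightarrow>
     (\<forall>S\<subseteq>{k..<k + m}. h S = (\<Sum>w\<in>cd_words m. if cd_match w k S then \<Phi> w else 0))"

definition d_coeff :: "nat \<Rightarrow> (cd list \<Rightarrow> int) \<Rightarrow> nat \<Rightarrow> int" where
  "d_coeff m \<Phi> i = (\<Sum>w\<in>cd_words m. if count_list w D = i then \<Phi> w else 0)"

lemma d_vector_of_eq: "d_vector_of m \<Phi> = map (d_coeff m \<Phi>) [0..<m div 2 + 1]"
  unfolding d_vector_of_def d_coeff_def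
  by (rule map_cong[OF refl]) (simp add: sum.inter_filter[OF finite_cd_words])

text \<open>The coefficient function of the noncommutative product of \<open>\<Phi>1\<close>, d and
  \<open>\<Phi>2\<close>; a word may have several factorizations.\<close>

definition insert_d :: "nat \<Rightarrow> nat \<Rightarrow> (cd list \<Rightarrow> int) \<Rightarrow> (cd list \<Rightarrow> int) \<Rightarrow> cd list \<Rightarrow> int" where
  "insert_d m1 m2 \<Phi>1 \<Phi>2 w =
     (\<Sum>(w1, w2)\<in>cd_words m1 \<times> cd_words m2. if w1 @ D # w2 = w then \<Phi>1 w1 * \<Phi>2 w2 else 0)"

lemma sum_insert_d:
  "(\<Sum>w\<in>cd_words (m1 + 2 + m2). if g w then insert_d m1 m2 \<Phi>1 \<Phi>2 w else 0) =
    (\<Sum>w1\<in>cd_words m1. \<Sum>w2\<in>cd_words m2. if g (w1 @ D # w2) then \<Phi>1 w1 * \<Phi>2 w2 else 0)"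
proof -
  let ?W = "cd_words (m1 + 2 + m2)" and ?X = "cd_words m1 \<times> cd_words m2"
  have "(\<Sum>w\<in>?W. if g w then insert_d m1 m2 \<Phi>1 \<Phi>2 w else 0) =
     (\<Sum>w\<in>?W. \<Sum>(w1, w2)\<in>?X. if w1 @ D # w2 = w then (if g (w1 @ D # w2) then \<Phi>1 w1 * \<Phi>2 w2 else 0) else 0)"
    unfolding insert_d_def by (rule sum.cong[OF refl]) (auto intro!: sum.cong sum.neutral)
  also have "\<dots> = (\<Sum>(w1, w2)\<in>?X. \<Sum>w\<in>?W. if w1 @ D # w2 = w then (if g (w1 @ D # w2) then \<Phi>1 w1 * \<Phi>2 w2 else 0) else 0)"
    by (subst sum.swap) (simp add: case_prod_unfold)
  also have "\<dots> = (\<Sum>(w1, w2)\<in>?X. if g (w1 @ D # w2) then \<Phi>1 w1 * \<Phi>2 w2 else 0)"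
  proof (rule sum.cong[OF refl], clarify)
    fix w1 w2 assume "w1 \<in> cd_words m1" "w2 \<in> cd_words m2"
    then have "w1 @ D # w2 \<in> ?W" by (simp add: cd_words_def cd_deg_append)
    then show "(\<Sum>w\<in>?W. if w1 @ D # w2 = w then (if g (w1 @ D # w2) then \<Phi>1 w1 * \<Phi>2 w2 else 0) else 0)
      = (if g (w1 @ D # w2) then \<Phi>1 w1 * \<Phi>2 w2 else 0)"
      using finite_cd_words by (simp add: sum.delta')
  qed
  finally show ?thesis by (simp add: sum.cartesian_product)
qed

text \<open>Putting c = 1 turns the product into one of polynomials in d. The middle factor d takes
  one unit of the exponent, hence \<open>i - 1 - j\<close>.\<close>

lemma d_coeff_insert_d:
  "d_coeff (m1 + 2 + m2) (insert_d m1 m2 \<Phi>1 \<Phi>2) i =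
     (\<Sum>j<i. d_coeff m1 \<Phi>1 j * d_coeff m2 \<Phi>2 (i - 1 - j))"
proof -
  have "(\<Sum>j<i. d_coeff m1 \<Phi>1 j * d_coeff m2 \<Phi>2 (i - 1 - j)) =
    (\<Sum>j<i. \<Sum>w1\<in>cd_words m1. \<Sum>w2\<in>cd_words m2.
       if count_list w1 D = j \<and> count_list w2 D = i - 1 - j then \<Phi>1 w1 * \<Phi>2 w2 else 0)"
    unfolding d_coeff_def sum_product by (intro sum.cong refl) auto
  also have "\<dots> = (\<Sum>w1\<in>cd_words m1. \<Sum>w2\<in>cd_words m2. \<Sum>j<i.
       if count_list w1 D = j then (if count_list w2 D = i - 1 - j then \<Phi>1 w1 * \<Phi>2 w2 else 0) else 0)"
    by (subst sum.swap, rule sum.cong[OF refl], subst sum.swap, intro sum.cong refl) auto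
  also have "\<dots> = (\<Sum>w1\<in>cd_words m1. \<Sum>w2\<in>cd_words m2.
      if count_list (w1 @ D # w2) D = i then \<Phi>1 w1 * \<Phi>2 w2 else 0)"
    by (intro sum.cong refl) (auto simp: sum.delta)
  also have "\<dots> = d_coeff (m1 + 2 + m2) (insert_d m1 m2 \<Phi>1 \<Phi>2) i"
    unfolding d_coeff_def by (rule sum_insert_d[symmetric])
  finally show ?thesis by simp
qed

lemma d_coeff_add: "d_coeff m (\<lambda>w. \<Phi> w + \<Psi> w) i = d_coeff m \<Phi> i + d_coeff m \<Psi> i"
  unfolding d_coeff_def sum.distrib[symmetric] by (rule sum.cong) auto

lemma h_transform_empty: "h_transform F {} = F {}"
  by (simp add: h_transform_def)

lemma h_transform_single: "h_transform F {i} = F {i} - F {}"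
  by (simp add: h_transform_def Pow_insert)

lemma h_transform_pair: "i \<noteq> j \<Longrightarrow> h_transform F {i, j} = F {i, j} - F {i} - F {j} + F {}"
  by (simp add: h_transform_def Pow_insert)

text \<open>The three blocks of ranks contribute independently. The factor for the ranks
  \<open>i\<close> and \<open>i + 1\<close> transforms into the indicator of sets containing exactly
  one of them, which is the expansion ab + ba of d.\<close>

lemma h_transform_two_levels:
  assumes "finite S"
  shows "h_transform (\<lambda>T. A (T \<inter> {..<i}) * B (T \<inter> {i + 1<..}) * ((if i \<in> T then 1 else 0) + (if i + 1 \<in> T then 1 else 0))) S
    = h_transform A (S \<inter> {..<i}) * h_transform B (S \<inter> {i + 1<..}) * (if (i \<in> S) \<noteq> (i + 1 \<in> S) then 1 else 0)"
proof -
  define g :: "nat set \<Rightarrow> int" where "g = (\<lambda>T. (if i \<in> T then 1 else 0) + (if i + 1 \<in> T then 1 else 0))"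
  let ?S1 = "S \<inter> {..<i}" and ?S2 = "S \<inter> {i, i + 1}" and ?S3 = "S \<inter> {i + 1<..}"
  have S: "S = ?S1 \<union> (?S2 \<union> ?S3)" by auto
  have "h_transform (\<lambda>T. A (T \<inter> {..<i}) * B (T \<inter> {i + 1<..}) * g T) (?S1 \<union> (?S2 \<union> ?S3))
     = h_transform A ?S1 * h_transform (\<lambda>T. B (T \<inter> {i + 1<..}) * g T) (?S2 \<union> ?S3)"
  proof (rule h_transform_product)
    fix T assume "T \<subseteq> ?S1 \<union> (?S2 \<union> ?S3)"
    then have e: "T \<inter> ?S1 = T \<inter> {..<i}" "T \<inter> (?S2 \<union> ?S3) \<inter> {i + 1<..} = T \<inter> {i + 1<..}" "g (T \<inter> (?S2 \<union> ?S3)) = g T"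
      by (auto simp: g_def)
    show "A (T \<inter> {..<i}) * B (T \<inter> {i + 1<..}) * g T
      = A (T \<inter> ?S1) * (B (T \<inter> (?S2 \<union> ?S3) \<inter> {i + 1<..}) * g (T \<inter> (?S2 \<union> ?S3)))"
      unfolding e by (rule mult.assoc)
  qed (use assms in auto)
  also have "h_transform (\<lambda>T. B (T \<inter> {i + 1<..}) * g T) (?S2 \<union> ?S3) = h_transform g ?S2 * h_transform B ?S3"
  proof (rule h_transform_product)
    fix T assume "T \<subseteq> ?S2 \<union> ?S3"
    then have e: "T \<inter> ?S3 = T \<inter> {i + 1<..}" "g (T \<inter> ?S2) = g T" by (auto simp: g_def)
    show "B (T \<inter> {i + 1<..}) * g T = g (T \<inter> ?S2) * B (T \<inter> ?S3)"
      unfolding e by (rule mult.commute)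
  qed (use assms in auto)
  also have "h_transform g ?S2 = (if (i \<in> S) \<noteq> (i + 1 \<in> S) then 1 else 0)"
  proof (cases "i \<in> S"; cases "i + 1 \<in> S")
    assume "i \<in> S" "i + 1 \<in> S"
    then have "?S2 = {i, i + 1}" by auto
    then show ?thesis using \<open>i \<in> S\<close> \<open>i + 1 \<in> S\<close> by (simp add: h_transform_pair g_def)
  next
    assume "i \<in> S" "i + 1 \<notin> S"
    then have "?S2 = {i}" by auto
    then show ?thesis using \<open>i \<in> S\<close> \<open>i + 1 \<notin> S\<close> by (simp add: h_transform_single g_def)
  next
    assume "i \<notin> S" "i + 1 \<in> S"
    then have "?S2 = {i + 1}" by auto
    then show ?thesis using \<open>i \<notin> S\<close> \<open>i + 1 \<in> S\<close> by (simp add: h_transform_single g_def)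
  next
    assume "i \<notin> S" "i + 1 \<notin> S"
    then have "?S2 = {}" by auto
    then show ?thesis using \<open>i \<notin> S\<close> \<open>i + 1 \<notin> S\<close> by (simp add: h_transform_empty g_def)
  qed
  finally show ?thesis unfolding S[symmetric] g_def by (simp only: mult.assoc mult.commute mult.left_commute)
qed

text \<open>The interval \<open>[x, y]\<close> has a \<open>cd\<close>-index whose image under \<open>c \<mapsto> 1\<close> is \<open>1 + k d + l d^2\<close> up to
  higher powers of \<open>d\<close>.\<close>

definition has_d_vector ::
  "nat set \<Rightarrow> (nat \<Rightarrow> nat \<Rightarrow> bool) \<Rightarrow> (nat \<Rightarrow> nat) \<Rightarrow> nat \<Rightarrow> nat \<Rightarrow> int \<Rightarrow> int \<Rightarrow> bool" where
  "has_d_vector P le r x y k l \<longleftrightarrow>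
     (\<exists>\<Phi>. cd_expands (r x + 1) (r y - r x - 1) (h_transform (flag P le r x y)) \<Phi>
        \<and> d_coeff (r y - r x - 1) \<Phi> 0 = 1 \<and> d_coeff (r y - r x - 1) \<Phi> 1 = k
        \<and> d_coeff (r y - r x - 1) \<Phi> 2 = l)"

text \<open>The correction in \<open>flag_split\<close> becomes the expansion of the product of
  \<open>\<Phi>1\<close>, d and \<open>\<Phi>2\<close>. Both outer factors have constant term 1 at c
  = 1, so the coefficient of d grows by 1 and that of the square of d by
  \<open>k1 + k2\<close>.\<close>

lemma (in cover_split) has_d_vector_split:
  assumes x: "x \<in> P" "le x u" "x \<noteq> u" and y: "y \<in> P" "le v y" "y \<noteq> v"
    and xy: "has_d_vector P le r x y k l" and xu: "has_d_vector P le r x u k1 l1"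
    and vy: "has_d_vector P le r v y k2 l2"
  shows "has_d_vector P' le' r' x y (k + 1) (l + k1 + k2)"
proof -
  define m1 where "m1 = r u - r x - 1"
  define m2 where "m2 = r y - r v - 1"
  define s where "s = r x + 1"
  have rk: "r x < r u" "r v < r y" using strict x y u v by auto
  then have ri: "r u = s + m1" "r v = s + m1 + 1" "r y - r x - 1 = m1 + 2 + m2" "r u - r x - 1 = m1" "r y - r v - 1 = m2"
    using uv(2) by (auto simp: m1_def m2_def s_def)
  obtain \<Phi> where \<Phi>: "cd_expands s (m1 + 2 + m2) (h_transform (flag P le r x y)) \<Phi>"
    "d_coeff (m1 + 2 + m2) \<Phi> 0 = 1" "d_coeff (m1 + 2 + m2) \<Phi> 1 = k" "d_coeff (m1 + 2 + m2) \<Phi> 2 = l"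
    using xy unfolding has_d_vector_def ri(3) s_def[symmetric] by blast
  obtain \<Phi>1 where \<Phi>1: "cd_expands s m1 (h_transform (flag P le r x u)) \<Phi>1"
    "d_coeff m1 \<Phi>1 0 = 1" "d_coeff m1 \<Phi>1 1 = k1"
    using xu unfolding has_d_vector_def ri(4) s_def[symmetric] by blast
  obtain \<Phi>2 where \<Phi>2: "cd_expands (r v + 1) m2 (h_transform (flag P le r v y)) \<Phi>2"
    "d_coeff m2 \<Phi>2 0 = 1" "d_coeff m2 \<Phi>2 1 = k2"
    using vy unfolding has_d_vector_def ri(5) by blast
  define \<Phi>' where "\<Phi>' = (\<lambda>w. \<Phi> w + insert_d m1 m2 \<Phi>1 \<Phi>2 w)"
  have "cd_expands s (m1 + 2 + m2) (h_transform (flag P' le' r' x y)) \<Phi>'"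
    unfolding cd_expands_def
  proof (intro allI impI)
    fix S assume S: "S \<subseteq> {s..<s + (m1 + 2 + m2)}"
    let ?i = "s + m1"
    let ?S1 = "S \<inter> {..<?i}" and ?S3 = "S \<inter> {?i + 1<..}"
    have S13: "?S1 \<subseteq> {s..<s + m1}" "?S3 \<subseteq> {r v + 1..<r v + 1 + m2}" using S ri(2) by auto
    have h1: "h_transform (flag P le r x u) ?S1 = (\<Sum>w\<in>cd_words m1. if cd_match w s S then \<Phi>1 w else 0)"
    proof -
      have "cd_match w s ?S1 = cd_match w s S" if "w \<in> cd_words m1" for w
        by (rule cd_match_cong) (use that in \<open>auto simp: cd_words_def\<close>)
      then show ?thesis using \<Phi>1(1) S13(1) unfolding cd_expands_def by (simp cong: sum.cong)
    qed
    have h2: "h_transform (flag P le r v y) ?S3 = (\<Sum>w\<in>cd_words m2. if cd_match w (?i + 2) S then \<Phi>2 w else 0)"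
    proof -
      have "cd_match w (r v + 1) ?S3 = cd_match w (r v + 1) S" if "w \<in> cd_words m2" for w
        by (rule cd_match_cong) (use that ri(2) in \<open>auto simp: cd_words_def\<close>)
      then show ?thesis using \<Phi>2(1) S13(2) ri(2) unfolding cd_expands_def by (simp cong: sum.cong)
    qed
    have iff: "(if cd_match w s S then \<Phi>' w else 0) =
      (if cd_match w s S then \<Phi> w else 0) + (if cd_match w s S then insert_d m1 m2 \<Phi>1 \<Phi>2 w else 0)" for w
      by (simp add: \<Phi>'_def)
    have "h_transform (flag P' le' r' x y) S = h_transform (flag P le r x y) S +
      h_transform (\<lambda>T. flag P le r x u (T \<inter> {..<?i}) * flag P le r v y (T \<inter> {?i + 1<..}) *
        ((if ?i \<in> T then 1 else 0) + (if ?i + 1 \<in> T then 1 else 0))) S"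
      unfolding h_transform_add[symmetric]
      by (rule h_transform_cong) (use flag_split[OF x y] ri(1) in simp)
    also have "h_transform (\<lambda>T. flag P le r x u (T \<inter> {..<?i}) * flag P le r v y (T \<inter> {?i + 1<..}) *
        ((if ?i \<in> T then 1 else 0) + (if ?i + 1 \<in> T then 1 else 0))) S
      = (\<Sum>w1\<in>cd_words m1. if cd_match w1 s S then \<Phi>1 w1 else 0) *
        (\<Sum>w2\<in>cd_words m2. if cd_match w2 (?i + 2) S then \<Phi>2 w2 else 0) * (if (?i \<in> S) \<noteq> (?i + 1 \<in> S) then 1 else 0)"
      unfolding h1[symmetric] h2[symmetric]
      by (rule h_transform_two_levels) (use S finite_subset in blast)
    also have "\<dots> = (\<Sum>w1\<in>cd_words m1. \<Sum>w2\<in>cd_words m2.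
        if cd_match (w1 @ D # w2) s S then \<Phi>1 w1 * \<Phi>2 w2 else 0)"
      unfolding sum_product unfolding sum_distrib_right
      by (intro sum.cong refl) (auto simp: cd_match_append cd_words_def)
    also have "\<dots> = (\<Sum>w\<in>cd_words (m1 + 2 + m2). if cd_match w s S then insert_d m1 m2 \<Phi>1 \<Phi>2 w else 0)"
      by (rule sum_insert_d[symmetric])
    also have "h_transform (flag P le r x y) S = (\<Sum>w\<in>cd_words (m1 + 2 + m2). if cd_match w s S then \<Phi> w else 0)"
      using \<Phi>(1) S unfolding cd_expands_def by blast
    finally show "h_transform (flag P' le' r' x y) S = (\<Sum>w\<in>cd_words (m1 + 2 + m2). if cd_match w s S then \<Phi>' w else 0)"
      by (simp only: iff sum.distrib)
  qed
  moreover have "d_coeff (m1 + 2 + m2) \<Phi>' i = d_coeff (m1 + 2 + m2) \<Phi> i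
      + (\<Sum>j<i. d_coeff m1 \<Phi>1 j * d_coeff m2 \<Phi>2 (i - 1 - j))" for i
    unfolding \<Phi>'_def d_coeff_add d_coeff_insert_d ..
  then have "d_coeff (m1 + 2 + m2) \<Phi>' 0 = 1" "d_coeff (m1 + 2 + m2) \<Phi>' 1 = k + 1"
    "d_coeff (m1 + 2 + m2) \<Phi>' 2 = l + k1 + k2"
    using \<Phi> \<Phi>1 \<Phi>2 by (simp_all add: numeral_2_eq_2)
  moreover have "r' x = r x" "r' y = r y" using r'_simps x y by auto
  ultimately show ?thesis
    unfolding has_d_vector_def using ri(3) s_def by auto
qed

lemma (in cover_split) has_d_vector_unchanged:
  assumes "x \<in> P" "y \<in> P" "\<not> (le x u \<and> le v y)"
  shows "has_d_vector P' le' r' x y k l \<longleftrightarrow> has_d_vector P le r x y k l"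
  using flag_unchanged[OF assms] r'_simps(3) assms unfolding has_d_vector_def by simp

text \<open>By the binomial expansion of (2 - 1) to the power \<open>card S\<close>, all flag
  h-numbers are 1, so the cd-index is a power of c.\<close>

lemma has_d_vector_powers_of_2:
  assumes "\<And>S. S \<subseteq> {r x + 1..<r y} \<Longrightarrow> flag P le r x y S = 2 ^ card S" "r x < r y"
  shows "has_d_vector P le r x y 0 0"
proof -
  define m where "m = r y - r x - 1"
  define \<Phi> :: "cd list \<Rightarrow> int" where "\<Phi> = (\<lambda>w. if w = replicate m C then 1 else 0)"
  have deg: "cd_deg (replicate i C) = i" for i by (induction i) auto
  have match: "cd_match (replicate i C) j S" for i j S by (induction i arbitrary: j) auto
  have w: "replicate m C \<in> cd_words m" by (simp add: cd_words_def deg)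
  have "h_transform (flag P le r x y) S = 1" if S: "S \<subseteq> {r x + 1..<r y}" for S
  proof -
    have fS: "finite S" using S finite_subset by blast
    have "h_transform (flag P le r x y) S = (\<Sum>T\<in>Pow S. (\<Prod>i\<in>T. 2) * (\<Prod>i\<in>S - T. - 1 :: int))"
      unfolding h_transform_def
    proof (rule sum.cong[OF refl])
      fix T assume T: "T \<in> Pow S"
      then have "card (S - T) = card S - card T" using fS by (simp add: card_Diff_subset finite_subset)
      then show "(- 1) ^ (card S - card T) * flag P le r x y T = (\<Prod>i\<in>T. 2) * (\<Prod>i\<in>S - T. - 1)"
        using assms(1)[of T] T S by auto
    qed
    also have "\<dots> = (\<Prod>i\<in>S. 2 + - 1)" by (rule prod_add[OF fS, symmetric])
    finally show ?thesis by simp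
  qed
  moreover have "(\<Sum>w\<in>cd_words m. if cd_match w (r x + 1) S then \<Phi> w else 0) = 1" for S
  proof -
    have "(\<Sum>w\<in>cd_words m. if cd_match w (r x + 1) S then \<Phi> w else 0) = (\<Sum>w\<in>cd_words m. if w = replicate m C then 1 else 0)"
      by (rule sum.cong) (auto simp: \<Phi>_def match)
    then show ?thesis using w finite_cd_words by simp
  qed
  moreover have "{r x + 1..<r x + 1 + m} = {r x + 1..<r y}" using assms(2) by (simp add: m_def)
  ultimately have "cd_expands (r x + 1) m (h_transform (flag P le r x y)) \<Phi>"
    unfolding cd_expands_def by simp
  moreover have "d_coeff m \<Phi> i = (if i = 0 then 1 else 0)" for i
  proof -
    have c: "count_list (replicate m C) D = 0" by (induction m) auto
    have "d_coeff m \<Phi> i = (\<Sum>w\<in>cd_words m. if w = replicate m C then (if i = 0 then 1 else 0) else 0)"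
      unfolding d_coeff_def by (rule sum.cong) (auto simp: \<Phi>_def c)
    then show ?thesis using w finite_cd_words by simp
  qed
  ultimately show ?thesis unfolding has_d_vector_def m_def[symmetric] by auto
qed

section \<open>Flag numbers and intervals of small rank\<close>

definition rank_level ::
  "nat set \<Rightarrow> (nat \<Rightarrow> nat \<Rightarrow> bool) \<Rightarrow> (nat \<Rightarrow> nat) \<Rightarrow> nat \<Rightarrow> nat \<Rightarrow> nat \<Rightarrow> nat set" where
  "rank_level P le r x y i = {w \<in> open_interval P le x y. r w = i}"

context ranked_poset
begin

abbreviation level :: "nat \<Rightarrow> nat \<Rightarrow> nat \<Rightarrow> nat set" where "level \<equiv> rank_level P le r"

lemmas level_def = rank_level_def

lemma flag_empty: "flag P le r x y {} = 1"
proof -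
  have "{C \<in> clique (open_interval P le x y) (comparable le). r ` C = {}} = {{}}" by (auto simp: clique_def)
  then show ?thesis by (simp add: flag_def)
qed

lemma level_subset: "level x y i \<subseteq> P" "finite (level x y i)"
  using finite_subset[OF _ finite_open_interval[of x y], of "level x y i"]
  by (auto simp: level_def open_interval_def)

lemma flag_single: "flag P le r x y {i} = int (card (level x y i))"
proof -
  have "bij_betw (\<lambda>w. {w}) (level x y i) {C \<in> clique (open_interval P le x y) (comparable le). r ` C = {i}}"
    unfolding bij_betw_def
  proof
    show "(\<lambda>w. {w}) ` level x y i = {C \<in> clique (open_interval P le x y) (comparable le). r ` C = {i}}"
    proof (intro set_eqI iffI)
      fix A assume A: "A \<in> {C \<in> clique (open_interval P le x y) (comparable le). r ` C = {i}}"
      then obtain w where w: "w \<in> A" by blast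
      have "q = w" if "q \<in> A" for q
      proof (rule ccontr)
        assume "q \<noteq> w"
        then have "comparable le q w" "q \<in> P" "w \<in> P" using A that w by (auto simp: clique_def open_interval_def)
        then have "r q \<noteq> r w" by (intro rank_inj)
        moreover have "r q = i" "r w = i" using A that w by auto
        ultimately show False by simp
      qed
      then have "A = {w}" using w by blast
      moreover have "w \<in> level x y i" using A w by (auto simp: level_def clique_def)
      ultimately show "A \<in> (\<lambda>w. {w}) ` level x y i" by blast
    qed (auto simp: level_def clique_def)
  qed simp
  then show ?thesis by (simp add: flag_def bij_betw_same_card)
qed

lemma flag_pair:
  assumes "i < j"
  shows "flag P le r x y {i, j} = int (card {(p, q). p \<in> level x y i \<and> q \<in> level x y j \<and> le p q})"
proof -
  let ?A = "{(p, q). p \<in> level x y i \<and> q \<in> level x y j \<and> le p q}"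
  let ?B = "{C \<in> clique (open_interval P le x y) (comparable le). r ` C = {i, j}}"
  have "bij_betw (\<lambda>(p, q). {p, q}) ?A ?B"
    unfolding bij_betw_def
  proof
    show "inj_on (\<lambda>(p, q). {p, q}) ?A"
      using assms by (auto simp: inj_on_def doubleton_eq_iff level_def)
    show "(\<lambda>(p, q). {p, q}) ` ?A = ?B"
    proof (intro set_eqI iffI)
      fix A assume "A \<in> (\<lambda>(p, q). {p, q}) ` ?A"
      then obtain p q where pq: "A = {p, q}" "p \<in> level x y i" "q \<in> level x y j" "le p q" by auto
      then have "p \<noteq> q" using assms by (auto simp: level_def)
      then show "A \<in> ?B" using pq by (auto simp: clique_def level_def comparable_def)
    next
      fix A assume A: "A \<in> ?B"
      then have "i \<in> r ` A" "j \<in> r ` A" by auto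
      then obtain p q where pq: "p \<in> A" "r p = i" "q \<in> A" "r q = j" by auto
      have AP: "w \<in> P" "w \<in> open_interval P le x y" if "w \<in> A" for w
        using A that by (auto simp: clique_def open_interval_def)
      have cmp: "comparable le w w'" if "w \<in> A" "w' \<in> A" "w \<noteq> w'" for w w'
        using A that by (auto simp: clique_def)
      have "w = p \<or> w = q" if w: "w \<in> A" for w
      proof -
        have "r w = i \<or> r w = j" using A w by auto
        then show ?thesis
          using rank_inj[of w p] rank_inj[of w q] cmp[of w p] cmp[of w q] AP w pq by metis
      qed
      then have "A = {p, q}" using pq by blast
      moreover have "p \<noteq> q" using pq assms by auto
      then have "le p q" using cmp[of p q] rank_mono[of q p] pq AP assms by (auto simp: comparable_def)
      ultimately show "A \<in> (\<lambda>(p, q). {p, q}) ` ?A" using pq AP by (auto simp: level_def)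
    qed
  qed
  then show ?thesis by (simp add: flag_def bij_betw_same_card)
qed

lemma has_d_vector_rank_1:
  assumes "x \<in> P" "y \<in> P" "r y = r x + 1"
  shows "has_d_vector P le r x y 0 0"
  by (rule has_d_vector_powers_of_2) (use assms flag_empty in auto)

lemma level_thin:
  assumes gor: "gor_graph T (P - {z, t}) (comparable le) n"
    and xy: "x \<in> P" "y \<in> P" "le x y" "r y = r x + 2"
  shows "card (level x y (r x + 1)) = 2"
proof -
  have "r w = r x + 1" if "w \<in> open_interval P le x y" for w
  proof -
    have "r x < r w" "r w < r y" using that in_open_interval[OF xy(1,2)] by blast+
    then show ?thesis using xy(4) by linarith
  qed
  then have "level x y (r x + 1) = open_interval P le x y" unfolding level_def by blast
  then show ?thesis using thin[OF gor xy] by simp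
qed

lemma has_d_vector_rank_2:
  assumes gor: "gor_graph T (P - {z, t}) (comparable le) n"
    and xy: "x \<in> P" "y \<in> P" "le x y" "r y = r x + 2"
  shows "has_d_vector P le r x y 0 0"
proof (rule has_d_vector_powers_of_2)
  fix S assume "S \<subseteq> {r x + 1..<r y}"
  then have "S = {} \<or> S = {r x + 1}" using xy(4) by force
  then show "flag P le r x y S = 2 ^ card S"
    using flag_empty flag_single level_thin[OF gor xy] by auto
qed (use xy in simp)

text \<open>The incidences between the two middle levels are counted from both sides; by thinness
  every element lies in exactly two.\<close>

lemma thin_double_count:
  assumes gor: "gor_graph T (P - {z, t}) (comparable le) n"
    and xy: "x \<in> P" "y \<in> P" "le x y" "r y = r x + 3"
  shows "card {(p, q). p \<in> level x y (r x + 1) \<and> q \<in> level x y (r x + 2) \<and> le p q} = 2 * card (level x y (r x + 1))"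
    "card (level x y (r x + 1)) = card (level x y (r x + 2))"
proof -
  let ?A = "level x y (r x + 1)" and ?B = "level x y (r x + 2)"
  let ?M = "{(p, q). p \<in> ?A \<and> q \<in> ?B \<and> le p q}"
  have lv: "w \<in> level x y i \<longleftrightarrow> w \<in> P \<and> le x w \<and> le w y \<and> r w = i" if "r x < i" "i < r y" for w i
    using in_open_interval[OF xy(1,2)] that by (auto simp: level_def)
  have "?M = Sigma ?A (\<lambda>p. open_interval P le p y)"
  proof (intro set_eqI iffI)
    fix e assume "e \<in> ?M"
    then obtain p q where e: "e = (p, q)" and pq: "p \<in> ?A" "q \<in> ?B" "le p q" by blast
    have "q \<in> open_interval P le p y" using pq lv xy(4) in_open_interval[of p y q] xy(2) by auto
    then show "e \<in> Sigma ?A (\<lambda>p. open_interval P le p y)" using e pq by blast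
  next
    fix e assume "e \<in> Sigma ?A (\<lambda>p. open_interval P le p y)"
    then obtain p q where e: "e = (p, q)" and p: "p \<in> ?A" and q: "q \<in> open_interval P le p y" by blast
    have pP: "p \<in> P" "le x p" "r p = r x + 1" using p lv xy(4) by auto
    have qP: "q \<in> P" "le p q" "le q y" "r p < r q" "r q < r y" using q in_open_interval[OF pP(1) xy(2)] by auto
    then have "le x q" using trans[of x p q] xy pP by blast
    then have "q \<in> ?B" using lv qP pP xy(4) by auto
    then show "e \<in> ?M" using e p qP by blast
  qed
  moreover have "card (open_interval P le p y) = 2" if "p \<in> ?A" for p
    by (rule thin[OF gor]) (use that lv xy in auto)
  ultimately show M1: "card ?M = 2 * card ?A"
    using level_subset(2) finite_open_interval by (simp add: card_SigmaI)
  have "prod.swap ` ?M = Sigma ?B (\<lambda>q. open_interval P le x q)"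
  proof (intro set_eqI iffI)
    fix e assume "e \<in> prod.swap ` ?M"
    then obtain p q where e: "e = (q, p)" and pq: "p \<in> ?A" "q \<in> ?B" "le p q" by auto
    have "p \<in> open_interval P le x q" using pq lv xy(4) in_open_interval[of x q p] xy(1) by auto
    then show "e \<in> Sigma ?B (\<lambda>q. open_interval P le x q)" using e pq by blast
  next
    fix e assume "e \<in> Sigma ?B (\<lambda>q. open_interval P le x q)"
    then obtain p q where e: "e = (q, p)" and q: "q \<in> ?B" and p: "p \<in> open_interval P le x q" by blast
    have qP: "q \<in> P" "le q y" "r q = r x + 2" using q lv xy(4) by auto
    have pP: "p \<in> P" "le p q" "le x p" "r x < r p" "r p < r q" using p in_open_interval[OF xy(1) qP(1)] by auto
    then have "le p y" using trans[of p q y] xy qP by blast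
    then have "(p, q) \<in> ?M" using lv qP pP xy(4) q by auto
    then show "e \<in> prod.swap ` ?M" unfolding e by force
  qed
  moreover have "card (open_interval P le x q) = 2" if "q \<in> ?B" for q
    by (rule thin[OF gor]) (use that lv xy in auto)
  ultimately have "card (prod.swap ` ?M) = 2 * card ?B"
    using level_subset(2) finite_open_interval by (simp add: card_SigmaI)
  moreover have "card (prod.swap ` ?M) = card ?M" by (rule card_image) (simp add: inj_on_def)
  ultimately show "card ?A = card ?B" using M1 by simp
qed

text \<open>With k atoms the flag numbers are 1, k, k and 2k, as for a polygon with k vertices, and
  the cd-index is cc + (k - 2) d. Both levels are offered because either may be the one whose size
  is known.\<close>

lemma has_d_vector_rank_3:
  assumes gor: "gor_graph T (P - {z, t}) (comparable le) n"
    and xy: "x \<in> P" "y \<in> P" "le x y" "r y = r x + 3"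
  shows "has_d_vector P le r x y (int (card (level x y (r x + 1))) - 2) 0"
    "has_d_vector P le r x y (int (card (level x y (r x + 2))) - 2) 0"
proof -
  let ?c = "int (card (level x y (r x + 1)))"
  note dc = thin_double_count[OF gor xy]
  define \<Phi> :: "cd list \<Rightarrow> int" where "\<Phi> = (\<lambda>w. if w = [C, C] then 1 else ?c - 2)"
  have words: "cd_words 2 = {[C, C], [D]}"
    by (auto simp: numeral_2_eq_2 cd_words_Suc_Suc cd_words_0 cd_words_1)
  have f: "flag P le r x y {r x + 1} = ?c" "flag P le r x y {r x + 2} = ?c"
    "flag P le r x y {r x + 1, r x + 2} = 2 * ?c"
    using flag_single flag_pair[of "r x + 1" "r x + 2"] dc by auto
  have "cd_expands (r x + 1) 2 (h_transform (flag P le r x y)) \<Phi>"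
    unfolding cd_expands_def
  proof (intro allI impI)
    fix S assume "S \<subseteq> {r x + 1..<r x + 1 + 2}"
    moreover have "{r x + 1..<r x + 1 + 2} = {r x + 1, r x + 2}" by auto
    ultimately have "S \<in> Pow {r x + 1, r x + 2}" by simp
    then have "S = {} \<or> S = {r x + 1} \<or> S = {r x + 2} \<or> S = {r x + 1, r x + 2}"
      by (simp only: Pow_insert Pow_empty) blast
    then show "h_transform (flag P le r x y) S = (\<Sum>w\<in>cd_words 2. if cd_match w (r x + 1) S then \<Phi> w else 0)"
      unfolding words using f flag_empty
      by (elim disjE) (simp_all add: h_transform_empty h_transform_single h_transform_pair \<Phi>_def)
  qed
  moreover have "d_coeff 2 \<Phi> 0 = 1" "d_coeff 2 \<Phi> 1 = ?c - 2" "d_coeff 2 \<Phi> 2 = 0"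
    unfolding d_coeff_def words by (simp_all add: \<Phi>_def)
  moreover have "r y - r x - 1 = 2" using xy(4) by simp
  ultimately show "has_d_vector P le r x y (?c - 2) 0" unfolding has_d_vector_def by auto
  then show "has_d_vector P le r x y (int (card (level x y (r x + 2))) - 2) 0" using dc(2) by simp
qed

lemma flag_h_eq: "flag_h P le z t r S = h_transform (flag P le r z t) S"
  unfolding flag_h_def h_transform_def flag_f_def flag_def order_complex_eq open_interval_zt ..

lemma is_cd_index_iff:
  "is_cd_index P le z t r n \<Phi> \<longleftrightarrow> cd_expands 1 n (h_transform (flag P le r z t)) \<Phi>"
proof -
  have "{1..<1 + n} = {1..n}" by auto
  then show ?thesis unfolding is_cd_index_def cd_expands_def flag_h_eq by simp
qed

lemma is_d_vectorI:
  assumes gor: "gor_graph (T::'k::field itself) (P - {z, t}) (comparable le) n"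
    and d: "has_d_vector P le r z t k l" and n: "n div 2 = 2"
  shows "is_d_vector_of_gorenstein T n [1, k, l]"
proof -
  obtain \<Phi> where \<Phi>: "cd_expands 1 n (h_transform (flag P le r z t)) \<Phi>"
    "d_coeff n \<Phi> 0 = 1" "d_coeff n \<Phi> 1 = k" "d_coeff n \<Phi> 2 = l"
    using d rzt unfolding has_d_vector_def by auto
  have "d_vector_of n \<Phi> = [1, k, l]"
    unfolding d_vector_of_eq n using \<Phi> by (simp add: numeral_2_eq_2)
  then show ?thesis
    unfolding is_d_vector_of_gorenstein_def using gorenstein_star_iff gor is_cd_index_iff \<Phi>(1) by blast
qed

end

section \<open>Construction of posets\<close>

text \<open>Rank i consists of \<open>2 * i - 1\<close> and \<open>2 * i\<close>; 0 is the bottom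
  and \<open>2 * n + 1\<close> the top.\<close>

definition base_rank :: "nat \<Rightarrow> nat" where "base_rank x = (x + 1) div 2"

definition base_le :: "nat \<Rightarrow> nat \<Rightarrow> bool" where
  "base_le x y \<longleftrightarrow> x = y \<or> base_rank x < base_rank y"

lemma base_rank_simps: "base_rank (2 * i) = i" "0 < i \<Longrightarrow> base_rank (2 * i - 1) = i"
  by (auto simp: base_rank_def)

lemma base_rank_cases: "base_rank w = i \<Longrightarrow> 0 < i \<Longrightarrow> w = 2 * i \<or> w = 2 * i - 1"
  unfolding base_rank_def by presburger

lemma base_ranked_poset: "ranked_poset {0..2 * n + 1} base_le 0 (2 * n + 1) base_rank n"
proof
  fix x y assume xy: "x \<in> {0..2 * n + 1}" "y \<in> {0..2 * n + 1}" "base_le x y" "base_rank x + 1 < base_rank y"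
  let ?w = "2 * (base_rank x + 1)"
  have w: "base_rank ?w = base_rank x + 1" by (rule base_rank_simps)
  have "base_rank y \<le> n + 1" using xy(2) by (auto simp: base_rank_def)
  then have "?w \<in> {0..2 * n + 1}" using xy(4) by simp
  then show "\<exists>w\<in>{0..2 * n + 1}. base_le x w \<and> base_le w y \<and> base_rank x < base_rank w \<and> base_rank w < base_rank y"
    using w xy by (intro bexI[of _ ?w]) (auto simp: base_le_def)
next
  fix x assume x: "x \<in> {0..2 * n + 1}"
  have "x = 0 \<or> 0 < base_rank x" unfolding base_rank_def by presburger
  then show "base_le 0 x" by (auto simp: base_le_def base_rank_def)
  have "x = 2 * n + 1 \<or> base_rank x < n + 1" using x unfolding base_rank_def by auto
  then show "base_le x (2 * n + 1)" by (auto simp: base_le_def base_rank_def)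
qed (auto simp: base_le_def base_rank_def)

text \<open>The complex with only the empty face is the sphere of dimension -1, which has index 0
  here.\<close>

lemma betti_sphere_empty: "betti_sphere (T::'k::field itself) (clique {} E) 0"
proof -
  have K: "clique {} E = {{}}" by (auto simp: clique_def)
  have d: "FV.dim (chain_space T {{}} j) = (if j = 0 then 1 else 0)" for j
  proof -
    have "card {G \<in> {{}} :: nat set set. card G = j} = (if j = 0 then 1 else 0)"
    proof (cases "j = 0")
      case True
      then have "{G \<in> {{}} :: nat set set. card G = j} = {{}}" by auto
      then show ?thesis unfolding True by (simp only: card.empty) simp
    next
      case False
      then have "{G \<in> {{}} :: nat set set. card G = j} = {}" by auto
      then show ?thesis using False by (simp only: card.empty) simp
    qed
    then show ?thesis using dim_chain_space[of "{{}}" T j] by (simp only: finite.intros)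
  qed
  have b: "boundaries T {{}} j \<subseteq> FV.span {}" for j
  proof
    fix f assume "f \<in> boundaries T {{}} j"
    then obtain g where "f = boundary {{}} (j + 1) g" by (auto simp: boundaries_def)
    then have "f = 0" by (auto simp: boundary_def fun_eq_iff)
    then show "f \<in> FV.span {}" by simp
  qed
  have "FV.dim (boundaries T {{}} j) \<le> 0" for j
    using FV.dim_le_card[OF b] by simp
  moreover have "boundary {{}} j f = 0" for j and f :: "nat set \<Rightarrow> 'k"
    by (auto simp: boundary_def fun_eq_iff)
  then have "cycles T {{}} j = chain_space T {{}} j" for j by (auto simp: cycles_def)
  ultimately show ?thesis
    unfolding betti_sphere_def K red_betti_eq using d by simp
qed

text \<open>The order complex is the boundary of a cross-polytope: the two elements of each further
  rank are the apexes of a suspension.\<close>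

lemma base_gor_graph: "gor_graph T {1..2 * n} (comparable base_le) n"
proof (induction n)
  case 0
  have "gor_graph T {} (comparable base_le) 0"
    unfolding gor_graph_def using betti_sphere_empty[of T "comparable base_le"]
    by (auto simp: clique_def common_nbrs_def)
  then show ?case by simp
next
  case (Suc n)
  have "{1..2 * Suc n} = insert (2 * n + 1) (insert (2 * n + 2) {1..2 * n})" by auto
  moreover have "gor_graph T (insert (2 * n + 1) (insert (2 * n + 2) {1..2 * n})) (comparable base_le) (Suc n)"
    by (rule gor_graph_suspension[OF _ comparable_sym _ _ _ _ _ Suc])
       (auto simp: comparable_def base_le_def base_rank_def)
  ultimately show ?case by simp
qed

lemma base_flag:
  assumes x: "x \<in> {0..2 * n + 1}" and y: "y \<in> {0..2 * n + 1}" and S: "S \<subseteq> {base_rank x + 1..<base_rank y}"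
  shows "flag {0..2 * n + 1} base_le base_rank x y S = 2 ^ card S"
proof -
  let ?O = "open_interval {0..2 * n + 1} base_le x y" and ?E = "comparable base_le"
  have fS: "finite S" by (rule finite_subset[OF S]) simp
  have S0: "0 < i" if "i \<in> S" for i using S that by auto
  have yn: "base_rank y \<le> n + 1" using y by (auto simp: base_rank_def)
  have rk: "base_rank (2 * i) = i" "base_rank (2 * i - 1) = i" if "i \<in> S" for i
    using base_rank_simps S0[OF that] by auto
  have O: "2 * i \<in> ?O" "2 * i - 1 \<in> ?O" if "i \<in> S" for i
  proof -
    have "base_rank x < i" "i < base_rank y" using S that by auto
    then show "2 * i \<in> ?O" "2 * i - 1 \<in> ?O"
      using rk[OF that] yn by (auto simp: open_interval_def base_le_def)
  qed
  \<comment> \<open>\<open>T\<close> is the set of ranks in which the chain uses the even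
    element.\<close>
  define f where "f = (\<lambda>T. (\<lambda>i. 2 * i) ` T \<union> (\<lambda>i. 2 * i - 1) ` (S - T))"
  have memf: "w \<in> f T \<longleftrightarrow> (\<exists>i\<in>T. w = 2 * i) \<or> (\<exists>i\<in>S - T. w = 2 * i - 1)" for w T
    by (auto simp: f_def)
  have "bij_betw f (Pow S) {C \<in> clique ?O ?E. base_rank ` C = S}"
  proof (rule bij_betw_byWitness[where f' = "\<lambda>C. {i \<in> S. 2 * i \<in> C}"])
    show "\<forall>T\<in>Pow S. {i \<in> S. 2 * i \<in> f T} = T"
    proof
      fix T assume "T \<in> Pow S"
      moreover have "2 * i \<noteq> 2 * j - 1" if "j \<in> S" for i j :: nat using S0[OF that] by presburger
      ultimately show "{i \<in> S. 2 * i \<in> f T} = T" by (auto simp: memf)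
    qed
    show "\<forall>C\<in>{C \<in> clique ?O ?E. base_rank ` C = S}. f {i \<in> S. 2 * i \<in> C} = C"
    proof
      fix C assume C: "C \<in> {C \<in> clique ?O ?E. base_rank ` C = S}"
      show "f {i \<in> S. 2 * i \<in> C} = C"
      proof (intro set_eqI iffI)
        fix w assume "w \<in> f {i \<in> S. 2 * i \<in> C}"
        then consider "w \<in> C" | i where "i \<in> S" "2 * i \<notin> C" "w = 2 * i - 1" by (auto simp: memf)
        then show "w \<in> C"
        proof cases
          case 2
          then have "i \<in> base_rank ` C" using C by simp
          then obtain q where "q \<in> C" "base_rank q = i" by auto
          then show ?thesis using base_rank_cases[of q i] S0 2 by auto
        qed
      next
        fix w assume w: "w \<in> C"
        then have i: "base_rank w \<in> S" using C by auto
        then consider "w = 2 * base_rank w" | "w = 2 * base_rank w - 1" using base_rank_cases S0 by blast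
        then show "w \<in> f {i \<in> S. 2 * i \<in> C}"
        proof cases
          case 1 then show ?thesis using i w unfolding memf by auto
        next
          case 2
          have "2 * base_rank w \<notin> C"
          proof
            assume q: "2 * base_rank w \<in> C"
            have "2 * base_rank w \<noteq> w" using 2 S0[OF i] by linarith
            then have "comparable base_le (2 * base_rank w) w" using C w q by (auto simp: clique_def)
            then show False using rk(1)[OF i] by (auto simp: comparable_def base_le_def)
          qed
          then show ?thesis using i 2 unfolding memf by blast
        qed
      qed
    qed
    show "f ` Pow S \<subseteq> {C \<in> clique ?O ?E. base_rank ` C = S}"
    proof (rule image_subsetI)
      fix T assume T: "T \<in> Pow S"
      have fT: "base_rank w \<in> S \<and> (w = 2 * base_rank w \<and> base_rank w \<in> T \<or> w = 2 * base_rank w - 1 \<and> base_rank w \<notin> T)"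
        if "w \<in> f T" for w
        using that T rk by (auto simp: memf subset_iff)
      have "f T \<subseteq> ?O"
      proof
        fix w assume "w \<in> f T"
        then show "w \<in> ?O" using fT[of w] O[of "base_rank w"] by metis
      qed
      moreover have "p = q \<or> comparable base_le p q" if "p \<in> f T" "q \<in> f T" for p q
      proof (cases "base_rank p = base_rank q")
        case True
        then show ?thesis using fT[OF that(1)] fT[OF that(2)] by metis
      qed (auto simp: comparable_def base_le_def)
      moreover have "base_rank ` f T = S"
      proof (intro set_eqI iffI)
        fix i assume "i \<in> base_rank ` f T" then show "i \<in> S" using fT by auto
      next
        fix i assume i: "i \<in> S"
        then have "2 * i \<in> f T \<or> 2 * i - 1 \<in> f T" by (auto simp: memf)
        then show "i \<in> base_rank ` f T" using rk[OF i] by force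
      qed
      ultimately show "f T \<in> {C \<in> clique ?O ?E. base_rank ` C = S}" by (auto simp: clique_def)
    qed
    show "(\<lambda>C. {i \<in> S. 2 * i \<in> C}) ` {C \<in> clique ?O ?E. base_rank ` C = S} \<subseteq> Pow S" by auto
  qed
  then have "card {C \<in> clique ?O ?E. base_rank ` C = S} = 2 ^ card S"
    using bij_betw_same_card[of f] card_Pow[OF fS] by metis
  then show ?thesis by (simp add: flag_def)
qed

lemma base_has_d_vector:
  assumes "x \<in> {0..2 * n + 1}" "y \<in> {0..2 * n + 1}" "base_rank x < base_rank y"
  shows "has_d_vector {0..2 * n + 1} base_le base_rank x y 0 0"
  by (rule has_d_vector_powers_of_2[OF base_flag[OF assms(1,2)] assms(3)])

lemma base_level:
  assumes "x \<in> {0..2 * n + 1}" "y \<in> {0..2 * n + 1}" "base_rank x < i" "i < base_rank y"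
  shows "card (rank_level {0..2 * n + 1} base_le base_rank x y i) = 2"
proof -
  interpret ranked_poset "{0..2 * n + 1}" base_le 0 "2 * n + 1" base_rank n by (rule base_ranked_poset)
  have "int (card (level x y i)) = 2"
    using flag_single[of x y i] base_flag[OF assms(1,2), of "{i}"] assms(3,4) by simp
  then show ?thesis by simp
qed

section \<open>Quantities tracked through a split\<close>

definition gor_poset ::
  "'k::field itself \<Rightarrow> nat set \<Rightarrow> (nat \<Rightarrow> nat \<Rightarrow> bool) \<Rightarrow> nat \<Rightarrow> nat \<Rightarrow> (nat \<Rightarrow> nat) \<Rightarrow> nat \<Rightarrow> bool" where
  "gor_poset T P le z t r n \<longleftrightarrow> ranked_poset P le z t r n \<and> gor_graph T (P - {z, t}) (comparable le) n"

lemma base_gor_poset: "gor_poset T {0..2 * n + 1} base_le 0 (2 * n + 1) base_rank n"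
proof -
  have "{0..2 * n + 1} - {0, 2 * n + 1} = {1..2 * n}" by auto
  then show ?thesis unfolding gor_poset_def using base_ranked_poset base_gor_graph by simp
qed

context cover_split
begin

lemma level_other_rank:
  assumes "x \<in> P" "y \<in> P" "i \<noteq> r u" "i \<noteq> r v"
  shows "rank_level P' le' r' x y i = level x y i"
proof (intro set_eqI iffI)
  fix w assume w: "w \<in> rank_level P' le' r' x y i"
  then have "w \<noteq> a" "w \<noteq> b" using assms r'_simps by (auto simp: rank_level_def)
  then have "w \<in> P" using w by (auto simp: rank_level_def open_interval_def P'_def)
  then show "w \<in> level x y i"
    using w le'_old[of x w] le'_old[of w y] assms r'_simps by (auto simp: rank_level_def open_interval_def)
next
  fix w assume "w \<in> level x y i"
  then have w: "w \<in> P" "le x w" "le w y" "w \<noteq> x" "w \<noteq> y" "r w = i" by (auto simp: rank_level_def open_interval_def)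
  then have "w \<noteq> u" "w \<noteq> v" using assms by auto
  then show "w \<in> rank_level P' le' r' x y i"
    using w le'_old[of x w] le'_old[of w y] assms r'_simps
    by (auto simp: rank_level_def open_interval_def P'_def)
qed

lemma level_unchanged:
  assumes "x \<in> P" "y \<in> P" "\<not> (le x u \<and> le v y)"
  shows "rank_level P' le' r' x y i = level x y i"
  using open_interval_unchanged[OF assms] r'_simps(3) by (auto simp: rank_level_def open_interval_def)

lemma card_level_lower:
  assumes x: "x \<in> P" "le x u" "x \<noteq> u" and y: "y \<in> P" "le v y" "y \<noteq> v"
  shows "card (rank_level P' le' r' x y (r u)) = card (level x y (r u)) + 1"
proof -
  have "rank_level P' le' r' x y (r u) = insert a (level x y (r u))"
  proof (intro set_eqI iffI)
    fix w assume w: "w \<in> rank_level P' le' r' x y (r u)"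
    then have "w \<noteq> b" using r'_simps uv by (auto simp: rank_level_def)
    then have "w = a \<or> w \<in> P" using w by (auto simp: rank_level_def open_interval_def P'_def)
    then show "w \<in> insert a (level x y (r u))"
      using w le'_old[of x w] le'_old[of w y] x y r'_simps by (auto simp: rank_level_def open_interval_def)
  next
    fix w assume w: "w \<in> insert a (level x y (r u))"
    have "x \<noteq> a" "y \<noteq> a" using x y ab by auto
    then show "w \<in> rank_level P' le' r' x y (r u)"
      using w le'_old[of x w] le'_old[of w y] le'_new(5)[of y] le'_new(7)[of x] x y r'_simps
      by (auto simp: rank_level_def open_interval_def P'_def)
  qed
  moreover have "a \<notin> level x y (r u)" using ab by (auto simp: rank_level_def open_interval_def)
  ultimately show ?thesis using level_subset(2) by simp
qed

end

text \<open>The new elements are hidden; listed are the effects on ranks, order, levels and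
  d-vectors of old elements that the constructions have to follow through repeated splits.\<close>

lemma gor_poset_step:
  assumes g: "gor_poset T P le z t r n" and u: "u \<in> P" "u \<noteq> z" and v: "v \<in> P" "v \<noteq> t"
    and uv: "le u v" "r v = r u + 1"
    and d: "has_d_vector P le r z t k l" "has_d_vector P le r z u k1 l1" "has_d_vector P le r v t k2 l2"
  obtains P' le' r' where "gor_poset T P' le' z t r' n" "P \<subseteq> P'"
    "has_d_vector P' le' r' z t (k + 1) (l + k1 + k2)"
    "\<And>x. x \<in> P \<Longrightarrow> r' x = r x"
    "\<And>x y. x \<in> P \<Longrightarrow> y \<in> P \<Longrightarrow> le' x y \<longleftrightarrow> le x y \<and> \<not> (x = u \<and> y = v)"
    "\<And>x y i. x \<in> P \<Longrightarrow> y \<in> P \<Longrightarrow> i \<noteq> r u \<Longrightarrow> i \<noteq> r u + 1 \<Longrightarrow> rank_level P' le' r' x y i = rank_level P le r x y i"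
    "\<And>y i. y \<in> P \<Longrightarrow> \<not> le v y \<Longrightarrow> rank_level P' le' r' z y i = rank_level P le r z y i"
    "\<And>y. y \<in> P \<Longrightarrow> le v y \<Longrightarrow> y \<noteq> v \<Longrightarrow> card (rank_level P' le' r' z y (r u)) = card (rank_level P le r z y (r u)) + 1"
    "\<And>y k l. y \<in> P \<Longrightarrow> \<not> le v y \<Longrightarrow> has_d_vector P' le' r' z y k l \<longleftrightarrow> has_d_vector P le r z y k l"
    "\<And>k l. has_d_vector P' le' r' v t k l \<longleftrightarrow> has_d_vector P le r v t k l"
    "\<And>y k l k' l'. y \<in> P \<Longrightarrow> le v y \<Longrightarrow> y \<noteq> v \<Longrightarrow> has_d_vector P le r z y k l \<Longrightarrow>
       has_d_vector P le r v y k' l' \<Longrightarrow> has_d_vector P' le' r' z y (k + 1) (l + k1 + k')"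
proof -
  interpret ranked_poset P le z t r n using g by (simp add: gor_poset_def)
  obtain a where a: "a \<notin> P" using fin ex_new_if_finite infinite_UNIV_nat by blast
  obtain b where b: "b \<notin> insert a P" using fin ex_new_if_finite[of "insert a P"] infinite_UNIV_nat by blast
  interpret cover_split P le z t r n u v a b
    by unfold_locales (use u v uv a b in auto)
  have zu: "le z u" "z \<noteq> u" and vt: "le v t" "t \<noteq> v" using bot top u v by auto
  have vu: "\<not> (le v u \<and> le v t)" using not_le_uv by blast
  show ?thesis
  proof (rule that[of P' le' r'])
    show "gor_poset T P' le' z t r' n"
      using gor'[of T] ranked' g by (simp add: gor_poset_def)
    show "P \<subseteq> P'" by (auto simp: P'_def)
    show "has_d_vector P' le' r' z t (k + 1) (l + k1 + k2)"
      by (rule has_d_vector_split[OF zt(1) zu zt(2) vt d])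
    show "r' x = r x" if "x \<in> P" for x by (rule r'_simps(3)[OF that])
    show "le' x y \<longleftrightarrow> le x y \<and> \<not> (x = u \<and> y = v)" if "x \<in> P" "y \<in> P" for x y by (rule le'_old[OF that])
    show "rank_level P' le' r' x y i = rank_level P le r x y i"
      if "x \<in> P" "y \<in> P" "i \<noteq> r u" "i \<noteq> r u + 1" for x y i
      using level_other_rank that uv by simp
    show "rank_level P' le' r' z y i = rank_level P le r z y i" if "y \<in> P" "\<not> le v y" for y i
      using level_unchanged[of z y i] that zt by blast
    show "card (rank_level P' le' r' z y (r u)) = card (rank_level P le r z y (r u)) + 1"
      if "y \<in> P" "le v y" "y \<noteq> v" for y
      by (rule card_level_lower[OF zt(1) zu that])
    show "has_d_vector P' le' r' z y k l \<longleftrightarrow> has_d_vector P le r z y k l" if "y \<in> P" "\<not> le v y" for y k l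
      using has_d_vector_unchanged[of z y] that zt by blast
    show "has_d_vector P' le' r' v t k l \<longleftrightarrow> has_d_vector P le r v t k l" for k l
      using has_d_vector_unchanged[OF v(1) zt(2) vu] .
    show "has_d_vector P' le' r' z y (k + 1) (l + k1 + k')"
      if "y \<in> P" "le v y" "y \<noteq> v" "has_d_vector P le r z y k l" "has_d_vector P le r v y k' l'" for y k l k' l'
      by (rule has_d_vector_split[OF zt(1) zu that(1-4) d(2) that(5)])
  qed
qed

section \<open>Construction in rank 5\<close>

text \<open>Splitting a cover above \<open>m\<close> or \<open>m0\<close> increases \<open>Y\<close> by \<open>\<alpha>\<close> or \<open>\<beta>\<close>, respectively.\<close>

definition rank5_state ::
  "'k::field itself \<Rightarrow> nat set \<Rightarrow> (nat \<Rightarrow> nat \<Rightarrow> bool) \<Rightarrow> nat \<Rightarrow> nat \<Rightarrow> (nat \<Rightarrow> nat) \<Rightarrow>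
    nat \<Rightarrow> nat \<Rightarrow> nat \<Rightarrow> nat \<Rightarrow> nat \<Rightarrow> nat \<Rightarrow> bool" where
  "rank5_state T P le z t r X Y m m0 \<alpha> \<beta> \<longleftrightarrow> gor_poset T P le z t r 4 \<and> has_d_vector P le r z t (int X) (int Y)
     \<and> m \<in> P \<and> m0 \<in> P \<and> r m = 3 \<and> r m0 = 3
     \<and> card (rank_level P le r z m 1) = \<alpha> + 2 \<and> card (rank_level P le r z m0 1) = \<beta> + 2"

lemma rank5_state_swap: "rank5_state T P le z t r X Y m m0 \<alpha> \<beta> \<Longrightarrow> rank5_state T P le z t r X Y m0 m \<beta> \<alpha>"
  by (simp add: rank5_state_def)

text \<open>A cover from \<open>m\<close> to some \<open>w\<close> of rank 4 is split. The interval
  below \<open>m\<close> has d-coefficient \<alpha> and the one above \<open>w\<close> is trivial.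
  Only ranks 3 and 4 are altered, so the atom counts below \<open>m\<close> and \<open>m0\<close>
  persist and the step can be repeated.\<close>

lemma rank5_split_at_m:
  assumes s: "rank5_state T P le z t r X Y m m0 \<alpha> \<beta>"
  shows "\<exists>P' le' r'. rank5_state T P' le' z t r' (X + 1) (Y + \<alpha>) m m0 \<alpha> \<beta>"
proof -
  have g: "gor_poset T P le z t r 4" and d: "has_d_vector P le r z t (int X) (int Y)"
    and mP: "m \<in> P" "m0 \<in> P" "r m = 3" "r m0 = 3"
    and lv: "card (rank_level P le r z m 1) = \<alpha> + 2" "card (rank_level P le r z m0 1) = \<beta> + 2"
    using s by (auto simp: rank5_state_def)
  interpret ranked_poset P le z t r 4 using g by (simp add: gor_poset_def)
  have gor: "gor_graph T (P - {z, t}) (comparable le) 4" using g by (simp add: gor_poset_def)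
  obtain w where w: "w \<in> P" "le m w" "r w = 4"
    using between_rank[of m t 4] top[of m] mP zt rzt by auto
  have ne: "m \<noteq> z" "w \<noteq> t" using mP w rzt by auto
  have L: "has_d_vector P le r z m (int \<alpha>) 0"
    using has_d_vector_rank_3(1)[OF gor zt(1) mP(1) bot[OF mP(1)]] mP(3) rzt lv(1) by simp
  have R: "has_d_vector P le r w t 0 0"
    by (rule has_d_vector_rank_1) (use w zt rzt in auto)
  have rv: "r w = r m + 1" using w mP by simp
  obtain P' le' r' where n: "gor_poset T P' le' z t r' 4" "P \<subseteq> P'"
    "has_d_vector P' le' r' z t (int X + 1) (int Y + int \<alpha> + 0)"
    "\<And>x. x \<in> P \<Longrightarrow> r' x = r x"
    "\<And>x y i. x \<in> P \<Longrightarrow> y \<in> P \<Longrightarrow> i \<noteq> r m \<Longrightarrow> i \<noteq> r m + 1 \<Longrightarrow> rank_level P' le' r' x y i = rank_level P le r x y i"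
    by (rule gor_poset_step[OF g mP(1) ne(1) w(1) ne(2) w(2) rv d L R]) blast
  have "rank_level P' le' r' z m 1 = rank_level P le r z m 1" "rank_level P' le' r' z m0 1 = rank_level P le r z m0 1"
    using n(5) mP zt by auto
  then have "rank5_state T P' le' z t r' (X + 1) (Y + \<alpha>) m m0 \<alpha> \<beta>"
    unfolding rank5_state_def using n(1-4) mP lv by (auto simp: add.commute)
  then show ?thesis by blast
qed

lemma rank5_split_at_m_iterate:
  assumes "rank5_state T P le z t r X Y m m0 \<alpha> \<beta>"
  shows "\<exists>P' le' r'. rank5_state T P' le' z t r' (X + j) (Y + j * \<alpha>) m m0 \<alpha> \<beta>"
proof (induction j)
  case 0
  then show ?case using assms by auto
next
  case (Suc j)
  then show ?case using rank5_split_at_m[of T _ _ z t _ "X + j" "Y + j * \<alpha>" m m0 \<alpha> \<beta>]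
    by (fastforce simp: algebra_simps)
qed

text \<open>Having only two coatoms above it, \<open>p\<close> has an upper interval with cd-index
  cc, so a split below \<open>p\<close> does not change \<open>Y\<close>. The flag \<open>c\<close>
  tells whether such a split also adds an atom below \<open>m\<close>.\<close>

definition rank5_state' ::
  "'k::field itself \<Rightarrow> nat set \<Rightarrow> (nat \<Rightarrow> nat \<Rightarrow> bool) \<Rightarrow> nat \<Rightarrow> nat \<Rightarrow> (nat \<Rightarrow> nat) \<Rightarrow>
    nat \<Rightarrow> nat \<Rightarrow> nat \<Rightarrow> nat \<Rightarrow> nat \<Rightarrow> nat \<Rightarrow> nat \<Rightarrow> bool \<Rightarrow> bool" where
  "rank5_state' T P le z t r X Y p m m0 \<alpha> \<beta> c \<longleftrightarrow> rank5_state T P le z t r X Y m m0 \<alpha> \<beta>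
     \<and> p \<in> P \<and> r p = 2 \<and> card (rank_level P le r p t 4) = 2 \<and> le p m0 \<and> (le p m \<longleftrightarrow> c)"

text \<open>The cover from an atom to \<open>p\<close> is split. The new atom lies below every
  element of rank 3 above \<open>p\<close>: below \<open>m0\<close> always, below \<open>m\<close>
  if \<open>c\<close> holds.\<close>

lemma rank5_split_below_p:
  assumes s: "rank5_state' T P le z t r X Y p m m0 \<alpha> \<beta> c"
  shows "\<exists>P' le' r'. rank5_state' T P' le' z t r' (X + 1) Y p m m0 (\<alpha> + of_bool c) (\<beta> + 1) c"
proof -
  have g: "gor_poset T P le z t r 4" and d: "has_d_vector P le r z t (int X) (int Y)"
    and mP: "m \<in> P" "m0 \<in> P" "r m = 3" "r m0 = 3"
    and lv: "card (rank_level P le r z m 1) = \<alpha> + 2" "card (rank_level P le r z m0 1) = \<beta> + 2"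
    and p: "p \<in> P" "r p = 2" "card (rank_level P le r p t 4) = 2" "le p m0" "le p m \<longleftrightarrow> c"
    using s by (auto simp: rank5_state_def rank5_state'_def)
  interpret ranked_poset P le z t r 4 using g by (simp add: gor_poset_def)
  have gor: "gor_graph T (P - {z, t}) (comparable le) 4" using g by (simp add: gor_poset_def)
  obtain w where w: "w \<in> P" "le w p" "r w = 1"
    using between_rank[of z p 1] bot[of p] p zt rzt by auto
  have ne: "w \<noteq> z" "p \<noteq> t" "p \<noteq> m" "p \<noteq> m0" "p \<noteq> w" using p mP w rzt by auto
  have L: "has_d_vector P le r z w 0 0"
    by (rule has_d_vector_rank_1) (use w zt rzt in auto)
  have R: "has_d_vector P le r p t 0 0"
    using has_d_vector_rank_3(2)[OF gor p(1) zt(2) top[OF p(1)]] p rzt by simp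
  have rv: "r p = r w + 1" using w p by simp
  obtain P' le' r' where n: "gor_poset T P' le' z t r' 4" "P \<subseteq> P'"
    "has_d_vector P' le' r' z t (int X + 1) (int Y + 0 + 0)"
    "\<And>x. x \<in> P \<Longrightarrow> r' x = r x"
    "\<And>x y. x \<in> P \<Longrightarrow> y \<in> P \<Longrightarrow> le' x y \<longleftrightarrow> le x y \<and> \<not> (x = w \<and> y = p)"
    "\<And>x y i. x \<in> P \<Longrightarrow> y \<in> P \<Longrightarrow> i \<noteq> r w \<Longrightarrow> i \<noteq> r w + 1 \<Longrightarrow> rank_level P' le' r' x y i = rank_level P le r x y i"
    "\<And>y i. y \<in> P \<Longrightarrow> \<not> le p y \<Longrightarrow> rank_level P' le' r' z y i = rank_level P le r z y i"
    "\<And>y. y \<in> P \<Longrightarrow> le p y \<Longrightarrow> y \<noteq> p \<Longrightarrow> card (rank_level P' le' r' z y (r w)) = card (rank_level P le r z y (r w)) + 1"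
    by (rule gor_poset_step[OF g w(1) ne(1) p(1) ne(2) w(2) rv d L R]) blast
  have "card (rank_level P' le' r' z m 1) = \<alpha> + of_bool c + 2"
    using n(7)[of m 1] n(8)[of m] mP lv p ne w by (cases c) auto
  moreover have "card (rank_level P' le' r' z m0 1) = \<beta> + 1 + 2"
    using n(8)[of m0] mP lv p ne w by auto
  moreover have "card (rank_level P' le' r' p t 4) = 2" using n(6)[of p t 4] p zt w by auto
  moreover have "le' p m0" "le' p m \<longleftrightarrow> c" using n(5)[of p m0] n(5)[of p m] p mP ne by auto
  ultimately have "rank5_state' T P' le' z t r' (X + 1) Y p m m0 (\<alpha> + of_bool c) (\<beta> + 1) c"
    unfolding rank5_state_def rank5_state'_def using n(1-4) mP p by (auto simp: add.commute)
  then show ?thesis by blast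
qed

lemma rank5_split_below_p_iterate:
  assumes "rank5_state' T P le z t r X Y p m m0 \<alpha> \<beta> c"
  shows "\<exists>P' le' r'. rank5_state' T P' le' z t r' (X + j) Y p m m0 (\<alpha> + j * of_bool c) (\<beta> + j) c"
proof (induction j)
  case 0
  then show ?case using assms by auto
next
  case (Suc j)
  then obtain P' le' r' where "rank5_state' T P' le' z t r' (X + j) Y p m m0 (\<alpha> + j * of_bool c) (\<beta> + j) c"
    by blast
  from rank5_split_below_p[OF this] show ?case by (simp add: algebra_simps)
qed

text \<open>Splitting the cover of \<open>m\<close> over \<open>p\<close> detaches them. Both outer
  intervals have rank difference 2 and cd-index c, so this only costs one unit of
  \<open>X\<close>.\<close>

lemma rank5_split_p_m:
  assumes s: "rank5_state' T P le z t r X Y p m m0 \<alpha> \<beta> True" and ne: "m \<noteq> m0"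
  shows "\<exists>P' le' r'. rank5_state' T P' le' z t r' (X + 1) Y p m m0 \<alpha> \<beta> False"
proof -
  have g: "gor_poset T P le z t r 4" and d: "has_d_vector P le r z t (int X) (int Y)"
    and mP: "m \<in> P" "m0 \<in> P" "r m = 3" "r m0 = 3"
    and lv: "card (rank_level P le r z m 1) = \<alpha> + 2" "card (rank_level P le r z m0 1) = \<beta> + 2"
    and p: "p \<in> P" "r p = 2" "card (rank_level P le r p t 4) = 2" "le p m0" "le p m"
    using s by (auto simp: rank5_state_def rank5_state'_def)
  interpret ranked_poset P le z t r 4 using g by (simp add: gor_poset_def)
  have gor: "gor_graph T (P - {z, t}) (comparable le) 4" using g by (simp add: gor_poset_def)
  have ne': "p \<noteq> z" "m \<noteq> t" using p mP rzt by auto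
  have L: "has_d_vector P le r z p 0 0"
    by (rule has_d_vector_rank_2[OF gor zt(1) p(1) bot[OF p(1)]]) (use p rzt in simp)
  have R: "has_d_vector P le r m t 0 0"
    by (rule has_d_vector_rank_2[OF gor mP(1) zt(2) top[OF mP(1)]]) (use mP rzt in simp)
  have rv: "r m = r p + 1" using mP p by simp
  obtain P' le' r' where n: "gor_poset T P' le' z t r' 4" "P \<subseteq> P'"
    "has_d_vector P' le' r' z t (int X + 1) (int Y + 0 + 0)"
    "\<And>x. x \<in> P \<Longrightarrow> r' x = r x"
    "\<And>x y. x \<in> P \<Longrightarrow> y \<in> P \<Longrightarrow> le' x y \<longleftrightarrow> le x y \<and> \<not> (x = p \<and> y = m)"
    "\<And>x y i. x \<in> P \<Longrightarrow> y \<in> P \<Longrightarrow> i \<noteq> r p \<Longrightarrow> i \<noteq> r p + 1 \<Longrightarrow> rank_level P' le' r' x y i = rank_level P le r x y i"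
    by (rule gor_poset_step[OF g p(1) ne'(1) mP(1) ne'(2) p(5) rv d L R]) blast
  have "rank_level P' le' r' z m 1 = rank_level P le r z m 1" "rank_level P' le' r' z m0 1 = rank_level P le r z m0 1"
    "rank_level P' le' r' p t 4 = rank_level P le r p t 4"
    using n(6) mP zt p by auto
  moreover have "le' p m0" "\<not> le' p m" using n(5)[of p m0] n(5)[of p m] p mP ne by auto
  ultimately have "rank5_state' T P' le' z t r' (X + 1) Y p m m0 \<alpha> \<beta> False"
    unfolding rank5_state_def rank5_state'_def using n(1-4) mP p lv by (auto simp: add.commute)
  then show ?thesis by blast
qed

lemma rank5_base: "rank5_state' T {0..9} base_le 0 9 base_rank 0 0 3 5 6 0 0 True"
proof -
  have rk: "base_rank 0 = 0" "base_rank 3 = 2" "base_rank 5 = 3" "base_rank 6 = 3" "base_rank 9 = 5"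
    by (auto simp: base_rank_def)
  have "card (rank_level {0..9} base_le base_rank 0 5 1) = 2" "card (rank_level {0..9} base_le base_rank 0 6 1) = 2"
    "card (rank_level {0..9} base_le base_rank 3 9 4) = 2"
    using base_level[of 0 4 5 1] base_level[of 0 4 6 1] base_level[of 3 4 9 4] rk by simp_all
  moreover have "has_d_vector {0..9} base_le base_rank 0 9 0 0"
    using base_has_d_vector[of 0 4 9] rk by simp
  moreover have "gor_poset T {0..9} base_le 0 9 base_rank 4" using base_gor_poset[of T 4] by simp
  ultimately show ?thesis
    unfolding rank5_state'_def rank5_state_def using rk by (simp add: base_le_def)
qed

lemma rank5_realize:
  assumes "rank5_state (T::'k::field itself) P le z t r X Y m m0 \<alpha> \<beta>"
  shows "is_d_vector_of_gorenstein T 4 [1, int X, int Y]"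
proof -
  have g: "gor_poset T P le z t r 4" and d: "has_d_vector P le r z t (int X) (int Y)"
    using assms by (auto simp: rank5_state_def)
  interpret ranked_poset P le z t r 4 using g by (simp add: gor_poset_def)
  show ?thesis by (rule is_d_vectorI[OF _ d]) (use g in \<open>auto simp: gor_poset_def\<close>)
qed

text \<open>\<open>a\<close> splits below \<open>p\<close> produce \<open>a\<close> additional
  atoms, and each of \<open>b\<close> splits above \<open>m\<close> then contributes
  \<open>a\<close>. Nothing has to be detached.\<close>

lemma rank5_product: "is_d_vector_of_gorenstein (T::'k::field itself) 4 [1, int (a + b), int (a * b)]"
proof -
  obtain P le r where "rank5_state' T P le 0 9 r (0 + a) 0 3 5 6 (0 + a * of_bool True) (0 + a) True"
    using rank5_split_below_p_iterate[OF rank5_base] by blast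
  then have "rank5_state T P le 0 9 r a 0 5 6 a a" by (simp add: rank5_state'_def)
  then obtain P le r where "rank5_state T P le 0 9 r (a + b) (0 + b * a) 5 6 a a"
    using rank5_split_at_m_iterate by blast
  from rank5_realize[OF this] show ?thesis by (simp add: mult.commute)
qed

text \<open>While \<open>p\<close> is below both elements of rank 3, \<open>q\<close> splits raise
  both counts. One split detaches \<open>p\<close> from \<open>m\<close>, and \<open>a - q\<close>
  further ones raise only the count of \<open>m0\<close>. Finally \<open>b\<close> splits above
  \<open>m0\<close> contribute \<open>a\<close> each and one above \<open>m\<close> contributes
  \<open>q\<close>.\<close>

lemma rank5_general:
  assumes "q \<le> a"
  shows "is_d_vector_of_gorenstein (T::'k::field itself) 4 [1, int (a + b + 2), int (b * a + q)]"
proof -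
  obtain P le r where "rank5_state' T P le 0 9 r (0 + q) 0 3 5 6 (0 + q * of_bool True) (0 + q) True"
    using rank5_split_below_p_iterate[OF rank5_base] by blast
  then have "rank5_state' T P le 0 9 r q 0 3 5 6 q q True" by simp
  from rank5_split_p_m[OF this] obtain P le r where "rank5_state' T P le 0 9 r (q + 1) 0 3 5 6 q q False"
    by auto
  from rank5_split_below_p_iterate[OF this, of "a - q"] obtain P le r where
    "rank5_state' T P le 0 9 r (q + 1 + (a - q)) 0 3 5 6 (q + (a - q) * of_bool False) (q + (a - q)) False"
    by (elim exE) (rule that)
  \<comment> \<open>The roles are exchanged so that the next splits occur above 6, the element with
    \<open>a + 2\<close> atoms below it.\<close>
  then have "rank5_state T P le 0 9 r (a + 1) 0 6 5 a q"
    by (intro rank5_state_swap[of T P le 0 9 r "a + 1" 0 5 6 q a]) (use assms in \<open>simp add: rank5_state'_def\<close>)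
  then obtain P le r where "rank5_state T P le 0 9 r (a + 1 + b) (0 + b * a) 6 5 a q"
    using rank5_split_at_m_iterate by blast
  then obtain P le r where "rank5_state T P le 0 9 r (a + 1 + b + 1) (0 + b * a + q) 5 6 q a"
    using rank5_split_at_m[OF rank5_state_swap] by blast
  from rank5_realize[OF this] show ?thesis by (simp add: algebra_simps)
qed

section \<open>Construction in rank 6\<close>

text \<open>Splitting \<open>m < w\<close> increases \<open>Y\<close> by \<open>\<alpha>\<close>, splitting a cover above \<open>w\<close> increases it by \<open>\<kappa>\<close>.\<close>

definition rank6_state ::
  "'k::field itself \<Rightarrow> nat set \<Rightarrow> (nat \<Rightarrow> nat \<Rightarrow> bool) \<Rightarrow> nat \<Rightarrow> nat \<Rightarrow> (nat \<Rightarrow> nat) \<Rightarrow>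
    nat \<Rightarrow> nat \<Rightarrow> nat \<Rightarrow> nat \<Rightarrow> nat \<Rightarrow> nat \<Rightarrow> bool" where
  "rank6_state T P le z t r X Y m w \<alpha> \<kappa> \<longleftrightarrow> gor_poset T P le z t r 5 \<and> has_d_vector P le r z t (int X) (int Y)
     \<and> m \<in> P \<and> w \<in> P \<and> r m = 3 \<and> r w = 4 \<and> le m w
     \<and> card (rank_level P le r z m 1) = \<alpha> + 2 \<and> (\<exists>l. has_d_vector P le r z w (int \<kappa>) l)"

text \<open>This is the last step of the construction: it destroys the relation between
  \<open>m\<close> and \<open>w\<close>, so the state itself is not maintained.\<close>

lemma rank6_split_m_w:
  assumes s: "rank6_state T P le z t r X Y m w \<alpha> \<kappa>"
  shows "\<exists>P' le' r'. gor_poset T P' le' z t r' 5 \<and> has_d_vector P' le' r' z t (int (X + 1)) (int (Y + \<alpha>))"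
proof -
  have g: "gor_poset T P le z t r 5" and d: "has_d_vector P le r z t (int X) (int Y)"
    and mP: "m \<in> P" "r m = 3" and w: "w \<in> P" "r w = 4" "le m w"
    and lv: "card (rank_level P le r z m 1) = \<alpha> + 2"
    using s by (auto simp: rank6_state_def)
  interpret ranked_poset P le z t r 5 using g by (simp add: gor_poset_def)
  have gor: "gor_graph T (P - {z, t}) (comparable le) 5" using g by (simp add: gor_poset_def)
  have ne: "m \<noteq> z" "w \<noteq> t" using mP w rzt by auto
  have L: "has_d_vector P le r z m (int \<alpha>) 0"
    using has_d_vector_rank_3(1)[OF gor zt(1) mP(1) bot[OF mP(1)]] mP rzt lv by simp
  have R: "has_d_vector P le r w t 0 0"
    by (rule has_d_vector_rank_2[OF gor w(1) zt(2) top[OF w(1)]]) (use w rzt in simp)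
  have rv: "r w = r m + 1" using w mP by simp
  obtain P' le' r' where "gor_poset T P' le' z t r' 5"
    "has_d_vector P' le' r' z t (int X + 1) (int Y + int \<alpha> + 0)"
    by (rule gor_poset_step[OF g mP(1) ne(1) w(1) ne(2) w(3) rv d L R]) blast
  then show ?thesis by (auto simp: add.commute)
qed

text \<open>The cover from \<open>w\<close> to some \<open>v\<close> of rank 5 is split. The
  interval below \<open>w\<close> is untouched and contributes \<kappa> again each time.\<close>

lemma rank6_split_above_w:
  assumes s: "rank6_state T P le z t r X Y m w \<alpha> \<kappa>"
  shows "\<exists>P' le' r'. rank6_state T P' le' z t r' (X + 1) (Y + \<kappa>) m w \<alpha> \<kappa>"
proof -
  obtain l where g: "gor_poset T P le z t r 5" and d: "has_d_vector P le r z t (int X) (int Y)"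
    and mP: "m \<in> P" "r m = 3" and w: "w \<in> P" "r w = 4" "le m w"
    and lv: "card (rank_level P le r z m 1) = \<alpha> + 2" and L: "has_d_vector P le r z w (int \<kappa>) l"
    using s by (auto simp: rank6_state_def)
  interpret ranked_poset P le z t r 5 using g by (simp add: gor_poset_def)
  obtain v where v: "v \<in> P" "le w v" "r v = 5"
    using between_rank[of w t 5] top[of w] w zt rzt by auto
  have ne: "w \<noteq> z" "v \<noteq> t" "m \<noteq> w" using mP v w rzt by auto
  have R: "has_d_vector P le r v t 0 0"
    by (rule has_d_vector_rank_1) (use v zt rzt in auto)
  have rv: "r v = r w + 1" using w v by simp
  obtain P' le' r' where n: "gor_poset T P' le' z t r' 5" "P \<subseteq> P'"
    "has_d_vector P' le' r' z t (int X + 1) (int Y + int \<kappa> + 0)"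
    "\<And>x. x \<in> P \<Longrightarrow> r' x = r x"
    "\<And>x y. x \<in> P \<Longrightarrow> y \<in> P \<Longrightarrow> le' x y \<longleftrightarrow> le x y \<and> \<not> (x = w \<and> y = v)"
    "\<And>x y i. x \<in> P \<Longrightarrow> y \<in> P \<Longrightarrow> i \<noteq> r w \<Longrightarrow> i \<noteq> r w + 1 \<Longrightarrow> rank_level P' le' r' x y i = rank_level P le r x y i"
    "\<And>y k l. y \<in> P \<Longrightarrow> \<not> le v y \<Longrightarrow> has_d_vector P' le' r' z y k l \<longleftrightarrow> has_d_vector P le r z y k l"
    by (rule gor_poset_step[OF g w(1) ne(1) v(1) ne(2) v(2) rv d L R]) blast
  have "\<not> le v w" using rank_mono[of v w] v w by auto
  then have "has_d_vector P' le' r' z w (int \<kappa>) l" using n(7) w L by blast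
  moreover have "rank_level P' le' r' z m 1 = rank_level P le r z m 1" using n(6)[of z m 1] mP zt w by auto
  moreover have "le' m w" using n(5)[of m w] mP w ne by auto
  ultimately have "rank6_state T P' le' z t r' (X + 1) (Y + \<kappa>) m w \<alpha> \<kappa>"
    unfolding rank6_state_def using n(1-4) mP w lv by (auto simp: add.commute)
  then show ?thesis by blast
qed

lemma rank6_split_above_w_iterate:
  assumes "rank6_state T P le z t r X Y m w \<alpha> \<kappa>"
  shows "\<exists>P' le' r'. rank6_state T P' le' z t r' (X + j) (Y + j * \<kappa>) m w \<alpha> \<kappa>"
proof (induction j)
  case 0
  then show ?case using assms by auto
next
  case (Suc j)
  then obtain P' le' r' where "rank6_state T P' le' z t r' (X + j) (Y + j * \<kappa>) m w \<alpha> \<kappa>" by blast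
  from rank6_split_above_w[OF this] show ?case by (simp add: algebra_simps)
qed

text \<open>With two elements of rank 5 above \<open>m\<close>, the upper interval of
  \<open>m\<close> has cd-index cc, so a split below \<open>m\<close> does not change
  \<open>Y\<close>.\<close>

definition rank6_state' ::
  "'k::field itself \<Rightarrow> nat set \<Rightarrow> (nat \<Rightarrow> nat \<Rightarrow> bool) \<Rightarrow> nat \<Rightarrow> nat \<Rightarrow> (nat \<Rightarrow> nat) \<Rightarrow>
    nat \<Rightarrow> nat \<Rightarrow> nat \<Rightarrow> nat \<Rightarrow> nat \<Rightarrow> nat \<Rightarrow> bool" where
  "rank6_state' T P le z t r X Y m w \<alpha> \<kappa> \<longleftrightarrow> rank6_state T P le z t r X Y m w \<alpha> \<kappa>
     \<and> card (rank_level P le r m t 5) = 2"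

text \<open>The cover from some \<open>u\<close> of rank 2 to \<open>m\<close> is split inside the
  interval below \<open>w\<close>, raising its d-coefficient; atoms are not affected, so \<alpha>
  stays. This is the move that separates \<kappa> from \<alpha>.\<close>

lemma rank6_split_below_m:
  assumes s: "rank6_state' T P le z t r X Y m w \<alpha> \<kappa>"
  shows "\<exists>P' le' r'. rank6_state' T P' le' z t r' (X + 1) Y m w \<alpha> (\<kappa> + 1)"
proof -
  obtain l where g: "gor_poset T P le z t r 5" and d: "has_d_vector P le r z t (int X) (int Y)"
    and mP: "m \<in> P" "r m = 3" and w: "w \<in> P" "r w = 4" "le m w"
    and lv: "card (rank_level P le r z m 1) = \<alpha> + 2" "card (rank_level P le r m t 5) = 2"
    and zw: "has_d_vector P le r z w (int \<kappa>) l"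
    using s by (auto simp: rank6_state_def rank6_state'_def)
  interpret ranked_poset P le z t r 5 using g by (simp add: gor_poset_def)
  have gor: "gor_graph T (P - {z, t}) (comparable le) 5" using g by (simp add: gor_poset_def)
  obtain u where u: "u \<in> P" "le u m" "r u = 2"
    using between_rank[of z m 2] bot[of m] mP zt rzt by auto
  have ne: "u \<noteq> z" "m \<noteq> t" "m \<noteq> w" "u \<noteq> m" using mP u w rzt by auto
  have L: "has_d_vector P le r z u 0 0"
    by (rule has_d_vector_rank_2[OF gor zt(1) u(1) bot[OF u(1)]]) (use u rzt in simp)
  have R: "has_d_vector P le r m t 0 0"
    using has_d_vector_rank_3(2)[OF gor mP(1) zt(2) top[OF mP(1)]] mP rzt lv by simp
  have mw: "has_d_vector P le r m w 0 0"
    by (rule has_d_vector_rank_1) (use mP w in auto)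
  have rv: "r m = r u + 1" using u mP by simp
  obtain P' le' r' where n: "gor_poset T P' le' z t r' 5" "P \<subseteq> P'"
    "has_d_vector P' le' r' z t (int X + 1) (int Y + 0 + 0)"
    "\<And>x. x \<in> P \<Longrightarrow> r' x = r x"
    "\<And>x y. x \<in> P \<Longrightarrow> y \<in> P \<Longrightarrow> le' x y \<longleftrightarrow> le x y \<and> \<not> (x = u \<and> y = m)"
    "\<And>x y i. x \<in> P \<Longrightarrow> y \<in> P \<Longrightarrow> i \<noteq> r u \<Longrightarrow> i \<noteq> r u + 1 \<Longrightarrow> rank_level P' le' r' x y i = rank_level P le r x y i"
    "\<And>y k l k' l'. y \<in> P \<Longrightarrow> le m y \<Longrightarrow> y \<noteq> m \<Longrightarrow> has_d_vector P le r z y k l \<Longrightarrow>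
       has_d_vector P le r m y k' l' \<Longrightarrow> has_d_vector P' le' r' z y (k + 1) (l + 0 + k')"
    by (rule gor_poset_step[OF g u(1) ne(1) mP(1) ne(2) u(2) rv d L R]) blast
  have "\<exists>l. has_d_vector P' le' r' z w (int (\<kappa> + 1)) l"
    using n(7)[OF w(1,3) ne(3)[symmetric] zw mw] by (auto simp: add.commute)
  moreover have "rank_level P' le' r' z m 1 = rank_level P le r z m 1" "rank_level P' le' r' m t 5 = rank_level P le r m t 5"
    using n(6)[of z m 1] n(6)[of m t 5] mP zt u by auto
  moreover have "le' m w" using n(5)[of m w] mP w ne by auto
  ultimately have "rank6_state' T P' le' z t r' (X + 1) Y m w \<alpha> (\<kappa> + 1)"
    unfolding rank6_state_def rank6_state'_def using n(1-4) mP w lv by (auto simp: add.commute)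
  then show ?thesis by blast
qed

lemma rank6_split_below_m_iterate:
  assumes "rank6_state' T P le z t r X Y m w \<alpha> \<kappa>"
  shows "\<exists>P' le' r'. rank6_state' T P' le' z t r' (X + j) Y m w \<alpha> (\<kappa> + j)"
proof (induction j)
  case 0
  then show ?case using assms by auto
next
  case (Suc j)
  then obtain P' le' r' where "rank6_state' T P' le' z t r' (X + j) Y m w \<alpha> (\<kappa> + j)" by blast
  from rank6_split_below_m[OF this] show ?case by (simp add: algebra_simps)
qed

text \<open>The upper interval of \<open>p\<close> has rank difference 4. Its vanishing
  d-coefficient keeps \<open>Y\<close> fixed under splits below \<open>p\<close>, which leave this
  interval unchanged.\<close>

definition rank6_state'' ::
  "'k::field itself \<Rightarrow> nat set \<Rightarrow> (nat \<Rightarrow> nat \<Rightarrow> bool) \<Rightarrow> nat \<Rightarrow> nat \<Rightarrow> (nat \<Rightarrow> nat) \<Rightarrow>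
    nat \<Rightarrow> nat \<Rightarrow> nat \<Rightarrow> nat \<Rightarrow> nat \<Rightarrow> nat \<Rightarrow> nat \<Rightarrow> bool" where
  "rank6_state'' T P le z t r X Y p m w \<alpha> \<kappa> \<longleftrightarrow> rank6_state' T P le z t r X Y m w \<alpha> \<kappa>
     \<and> p \<in> P \<and> r p = 2 \<and> le p m \<and> (\<exists>l. has_d_vector P le r p t 0 l)"

text \<open>As \<open>p\<close> is below \<open>m\<close> and \<open>w\<close>, the split adds an
  atom below \<open>m\<close> and at the same time raises the d-coefficient of the interval below
  \<open>w\<close>.\<close>

lemma rank6_split_below_p:
  assumes s: "rank6_state'' T P le z t r X Y p m w \<alpha> \<kappa>"
  shows "\<exists>P' le' r'. rank6_state'' T P' le' z t r' (X + 1) Y p m w (\<alpha> + 1) (\<kappa> + 1)"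
proof -
  obtain l l2 where g: "gor_poset T P le z t r 5" and d: "has_d_vector P le r z t (int X) (int Y)"
    and mP: "m \<in> P" "r m = 3" and w: "w \<in> P" "r w = 4" "le m w"
    and lv: "card (rank_level P le r z m 1) = \<alpha> + 2" "card (rank_level P le r m t 5) = 2"
    and zw: "has_d_vector P le r z w (int \<kappa>) l"
    and p: "p \<in> P" "r p = 2" "le p m" and R: "has_d_vector P le r p t 0 l2"
    using s by (auto simp: rank6_state_def rank6_state'_def rank6_state''_def)
  interpret ranked_poset P le z t r 5 using g by (simp add: gor_poset_def)
  have gor: "gor_graph T (P - {z, t}) (comparable le) 5" using g by (simp add: gor_poset_def)
  obtain u where u: "u \<in> P" "le u p" "r u = 1"
    using between_rank[of z p 1] bot[of p] p zt rzt by auto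
  have ne: "u \<noteq> z" "p \<noteq> t" "p \<noteq> w" "p \<noteq> m" "p \<noteq> u" "m \<noteq> u" using mP u w p rzt by auto
  have pw: "le p w" using trans[of p m w] p mP w by blast
  have L: "has_d_vector P le r z u 0 0"
    by (rule has_d_vector_rank_1) (use u zt rzt in auto)
  have pw2: "has_d_vector P le r p w 0 0"
    by (rule has_d_vector_rank_2[OF gor p(1) w(1) pw]) (use p w in simp)
  have rv: "r p = r u + 1" using u p by simp
  obtain P' le' r' where n: "gor_poset T P' le' z t r' 5" "P \<subseteq> P'"
    "has_d_vector P' le' r' z t (int X + 1) (int Y + 0 + 0)"
    "\<And>x. x \<in> P \<Longrightarrow> r' x = r x"
    "\<And>x y. x \<in> P \<Longrightarrow> y \<in> P \<Longrightarrow> le' x y \<longleftrightarrow> le x y \<and> \<not> (x = u \<and> y = p)"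
    "\<And>x y i. x \<in> P \<Longrightarrow> y \<in> P \<Longrightarrow> i \<noteq> r u \<Longrightarrow> i \<noteq> r u + 1 \<Longrightarrow> rank_level P' le' r' x y i = rank_level P le r x y i"
    "\<And>y. y \<in> P \<Longrightarrow> le p y \<Longrightarrow> y \<noteq> p \<Longrightarrow> card (rank_level P' le' r' z y (r u)) = card (rank_level P le r z y (r u)) + 1"
    "\<And>k l. has_d_vector P' le' r' p t k l \<longleftrightarrow> has_d_vector P le r p t k l"
    "\<And>y k l k' l'. y \<in> P \<Longrightarrow> le p y \<Longrightarrow> y \<noteq> p \<Longrightarrow> has_d_vector P le r z y k l \<Longrightarrow>
       has_d_vector P le r p y k' l' \<Longrightarrow> has_d_vector P' le' r' z y (k + 1) (l + 0 + k')"
    by (rule gor_poset_step[OF g u(1) ne(1) p(1) ne(2) u(2) rv d L R]) blast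
  have "\<exists>l. has_d_vector P' le' r' z w (int (\<kappa> + 1)) l"
    using n(9)[OF w(1) pw ne(3)[symmetric] zw pw2] by (auto simp: add.commute)
  moreover have "card (rank_level P' le' r' z m 1) = \<alpha> + 1 + 2"
    using n(7)[of m] mP p ne lv u by auto
  moreover have "rank_level P' le' r' m t 5 = rank_level P le r m t 5"
    using n(6)[of m t 5] mP zt u by auto
  moreover have "le' m w" "le' p m" using n(5)[of m w] n(5)[of p m] mP w p ne by auto
  moreover have "\<exists>l. has_d_vector P' le' r' p t 0 l" using n(8) R by blast
  ultimately have "rank6_state'' T P' le' z t r' (X + 1) Y p m w (\<alpha> + 1) (\<kappa> + 1)"
    unfolding rank6_state_def rank6_state'_def rank6_state''_def using n(1-4) mP w lv p by (auto simp: add.commute)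
  then show ?thesis by blast
qed

lemma rank6_split_below_p_iterate:
  assumes "rank6_state'' T P le z t r X Y p m w \<alpha> \<kappa>"
  shows "\<exists>P' le' r'. rank6_state'' T P' le' z t r' (X + j) Y p m w (\<alpha> + j) (\<kappa> + j)"
proof (induction j)
  case 0
  then show ?case using assms by auto
next
  case (Suc j)
  then obtain P' le' r' where "rank6_state'' T P' le' z t r' (X + j) Y p m w (\<alpha> + j) (\<kappa> + j)" by blast
  from rank6_split_below_p[OF this] show ?case by (simp add: algebra_simps)
qed

lemma rank6_base: "rank6_state'' T {0..11} base_le 0 11 base_rank 0 0 3 5 7 0 0"
proof -
  have rk: "base_rank 0 = 0" "base_rank 3 = 2" "base_rank 5 = 3" "base_rank 7 = 4" "base_rank 11 = 6"
    by (auto simp: base_rank_def)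
  have "card (rank_level {0..11} base_le base_rank 0 5 1) = 2" "card (rank_level {0..11} base_le base_rank 5 11 5) = 2"
    using base_level[of 0 5 5 1] base_level[of 5 5 11 5] rk by simp_all
  moreover have "has_d_vector {0..11} base_le base_rank 0 11 0 0" "has_d_vector {0..11} base_le base_rank 3 11 0 0"
    "has_d_vector {0..11} base_le base_rank 0 7 0 0"
    using base_has_d_vector[of 0 5 11] base_has_d_vector[of 3 5 11] base_has_d_vector[of 0 5 7] rk by simp_all
  moreover have "gor_poset T {0..11} base_le 0 11 base_rank 5" using base_gor_poset[of T 5] by simp
  ultimately show ?thesis
    unfolding rank6_state''_def rank6_state'_def rank6_state_def using rk by (auto simp: base_le_def)
qed

text \<open>\<open>q\<close> splits below \<open>p\<close> bring \<alpha> and \<kappa> to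
  \<open>q\<close>, and \<open>a - q\<close> splits below \<open>m\<close> bring \<kappa> to
  \<open>a\<close>. Then \<open>b\<close> splits above \<open>w\<close> contribute \<open>a\<close>
  each, and splitting the cover of \<open>w\<close> over \<open>m\<close> contributes
  \<open>q\<close>.\<close>

lemma rank6_general:
  assumes "q \<le> a"
  shows "is_d_vector_of_gorenstein (T::'k::field itself) 5 [1, int (a + b + 1), int (b * a + q)]"
proof -
  obtain P le r where "rank6_state'' T P le 0 11 r (0 + q) 0 3 5 7 (0 + q) (0 + q)"
    using rank6_split_below_p_iterate[OF rank6_base] by blast
  then have "rank6_state' T P le 0 11 r q 0 5 7 q q" by (simp add: rank6_state''_def)
  then obtain P le r where "rank6_state' T P le 0 11 r (q + (a - q)) 0 5 7 q (q + (a - q))"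
    using rank6_split_below_m_iterate by blast
  then have "rank6_state T P le 0 11 r a 0 5 7 q a" using assms by (simp add: rank6_state'_def)
  then obtain P le r where "rank6_state T P le 0 11 r (a + b) (0 + b * a) 5 7 q a"
    using rank6_split_above_w_iterate by blast
  from rank6_split_m_w[OF this] obtain P le r where
    g: "gor_poset T P le 0 11 r 5" and d: "has_d_vector P le r 0 11 (int (a + b + 1)) (int (b * a + q))"
    by auto
  interpret ranked_poset P le 0 11 r 5 using g by (simp add: gor_poset_def)
  show ?thesis by (rule is_d_vectorI[OF _ d]) (use g in \<open>auto simp: gor_poset_def\<close>)
qed

text \<open>This covers x = 0, which is not of the form a + b + 1.\<close>

lemma rank6_zero: "is_d_vector_of_gorenstein (T::'k::field itself) 5 [1, int a, 0]"
proof -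
  obtain P le r where "rank6_state'' T P le 0 11 r (0 + a) 0 3 5 7 (0 + a) (0 + a)"
    using rank6_split_below_p_iterate[OF rank6_base] by blast
  then have g: "gor_poset T P le 0 11 r 5" and d: "has_d_vector P le r 0 11 (int a) 0"
    by (auto simp: rank6_state_def rank6_state'_def rank6_state''_def)
  interpret ranked_poset P le 0 11 r 5 using g by (simp add: gor_poset_def)
  show ?thesis by (rule is_d_vectorI[OF _ d]) (use g in \<open>auto simp: gor_poset_def\<close>)
qed

text \<open>For \<open>b\<close> minimal with \<open>y \<le> b (x - b)\<close>, the numbers \<open>(b - 1) (x - b)\<close> and \<open>b (x - b)\<close> enclose \<open>y\<close>.\<close>

lemma product_decomposition:
  fixes x y :: nat
  assumes "4 * y \<le> x ^ 2" "0 < y"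
  obtains a b q where "x = a + b + 1" "y = b * a + q" "q \<le> a"
proof -
  let ?Q = "\<lambda>b. b \<le> x \<and> y \<le> b * (x - b)"
  \<comment> \<open>With c = x div 2, four times c (x - c) is the square of x, or one less if x is
    odd. Hence \<open>x div 2\<close> is one admissible value of \<open>b\<close>.\<close>
  have "4 * (x div 2 * (x - x div 2)) + 1 \<ge> x ^ 2"
  proof -
    define c where "c = x div 2"
    have "x = 2 * c \<or> x = 2 * c + 1" unfolding c_def by presburger
    then show ?thesis unfolding c_def[symmetric] by (auto simp: power2_eq_square algebra_simps)
  qed
  then have "y \<le> x div 2 * (x - x div 2)" using assms by linarith
  then have ex: "?Q (x div 2)" by simp
  define b where "b = (LEAST b. ?Q b)"
  have b: "?Q b" unfolding b_def by (rule LeastI[of ?Q, OF ex])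
  have "b \<noteq> 0"
  proof
    assume "b = 0"
    then have "y \<le> 0 * (x - 0)" using b by blast
    then show False using assms(2) by simp
  qed
  have "\<not> ?Q (b - 1)" using not_less_Least[of "b - 1" ?Q] \<open>b \<noteq> 0\<close> unfolding b_def[symmetric] by simp
  then have "(b - 1) * (x - (b - 1)) < y" using b by auto
  moreover have "(b - 1) * (x - b) \<le> (b - 1) * (x - (b - 1))" by (rule mult_le_mono2) simp
  ultimately have lo: "(b - 1) * (x - b) \<le> y" by linarith
  have hi: "y \<le> (b - 1) * (x - b) + (x - b)" using b \<open>b \<noteq> 0\<close> by (cases b) auto
  show ?thesis
    by (rule that[of "x - b" "b - 1" "y - (b - 1) * (x - b)"]) (use lo hi b \<open>b \<noteq> 0\<close> in auto)
qed

lemma rank5_sufficient: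
  fixes x y :: nat
  assumes "real y \<le> (real x - 1)\<^sup>2 / 4 \<or> (\<exists>a b :: nat. x = a + b \<and> y = a * b)"
  shows "is_d_vector_of_gorenstein (T::'k::field itself) 4 [1, int x, int y]"
proof -
  have zero: "is_d_vector_of_gorenstein T 4 [1, int x, 0]" using rank5_product[of T x 0] by simp
  show ?thesis
  proof (cases "\<exists>a b :: nat. x = a + b \<and> y = a * b")
    case True
    then show ?thesis using rank5_product by blast
  next
    case False
    then have "real y \<le> (real x - 1)\<^sup>2 / 4" using assms by blast
    then have le: "4 * real y \<le> (real x - 1)\<^sup>2" by simp
    show ?thesis
    proof (cases "y = 0 \<or> x = 0")
      case True
      \<comment> \<open>For x = 0 the bound is 1/4, which also forces y = 0.\<close>
      then have "y = 0" using le by auto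
      then show ?thesis using zero by simp
    next
      case nz: False
      then obtain x' where x': "x = x' + 1" by (metis Suc_eq_plus1 not0_implies_Suc)
      then have "real (4 * y) \<le> real (x' ^ 2)" using le by simp
      then have "4 * y \<le> x' ^ 2" by (simp only: of_nat_le_iff)
      then obtain a b q where "x' = a + b + 1" "y = b * a + q" "q \<le> a"
        using product_decomposition nz by blast
      then show ?thesis using rank5_general[of q a T b] x' by simp
    qed
  qed
qed

lemma rank6_sufficient:
  fixes x y :: nat
  assumes "real y \<le> (real x)\<^sup>2 / 4"
  shows "is_d_vector_of_gorenstein (T::'k::field itself) 5 [1, int x, int y]"
proof (cases "y = 0")
  case False
  have "real (4 * y) \<le> real (x ^ 2)" using assms by simp
  then have "4 * y \<le> x ^ 2" by (simp only: of_nat_le_iff)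
  then obtain a b q where "x = a + b + 1" "y = b * a + q" "q \<le> a"
    using product_decomposition False by blast
  then show ?thesis using rank6_general[of q a T b] by simp
qed (use rank6_zero in simp)

section \<open>Bounds on the coefficients\<close>

lemma gorenstein_d_vectorE:
  assumes "is_d_vector_of_gorenstein (T::'k::field itself) n [1, int x, int y]"
  obtains P le z t r \<Phi> where "ranked_poset P le z t r n" "gor_graph T (P - {z, t}) (comparable le) n"
    "cd_expands 1 n (h_transform (flag P le r z t)) \<Phi>"
    "d_coeff n \<Phi> 0 = 1" "d_coeff n \<Phi> 1 = int x" "d_coeff n \<Phi> 2 = int y"
proof -
  obtain P le z t r \<Phi> where g: "gorenstein_star_poset T P le z t r n" and cd: "is_cd_index P le z t r n \<Phi>"
    and dv: "d_vector_of n \<Phi> = [1, int x, int y]"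
    using assms unfolding is_d_vector_of_gorenstein_def by blast
  have "graded_poset P le z t r n" using g by (simp add: gorenstein_star_poset_def)
  then interpret ranked_poset P le z t r n by (rule ranked_posetI_graded)
  have m: "map (d_coeff n \<Phi>) [0..<n div 2 + 1] = [1, int x, int y]" using dv d_vector_of_eq by simp
  then have "length [0..<n div 2 + 1] = 3" by (metis length_Cons length_map list.size(3) numeral_3_eq_3)
  then have "n div 2 + 1 = 3" by (simp only: length_upt)
  then have "map (d_coeff n \<Phi>) [0, 1, 2] = [1, int x, int y]" using m by (simp add: upt_rec numeral_2_eq_2)
  then have "d_coeff n \<Phi> 0 = 1" "d_coeff n \<Phi> 1 = int x" "d_coeff n \<Phi> 2 = int y" by simp_all
  then show ?thesis
    using that[OF ranked_poset_axioms] g cd gorenstein_star_iff is_cd_index_iff by blast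
qed

context ranked_poset
begin

lemma rank_level_zt: "0 < i \<Longrightarrow> i < n + 1 \<Longrightarrow> w \<in> level z t i \<longleftrightarrow> w \<in> P \<and> r w = i"
  unfolding rank_level_def open_interval_zt using rzt by auto

lemma flag_pair_le:
  assumes "i < j"
  shows "flag P le r z t {i, j} \<le> flag P le r z t {i} * flag P le r z t {j}"
proof -
  have "card {(p, q). p \<in> level z t i \<and> q \<in> level z t j \<and> le p q} \<le> card (level z t i \<times> level z t j)"
    by (rule card_mono) (auto simp: level_subset(2))
  then show ?thesis
    unfolding flag_pair[OF assms] flag_single by (simp add: card_cartesian_product flip: of_nat_mult)
qed

text \<open>Induction on the rank of \<open>v\<close>: by the induction hypothesis, the elements above some element of \<open>A\<close>
  are closed under comparability inside the open interval below \<open>v\<close>, which is connected.\<close>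

lemma closed_low_part_spreads:
  assumes gor: "gor_graph T (P - {z, t}) (comparable le) n"
    and A: "\<And>p. p \<in> A \<Longrightarrow> p \<in> P \<and> 0 < r p \<and> r p \<le> 2"
    and closed: "\<And>p q. p \<in> A \<Longrightarrow> q \<in> P \<Longrightarrow> 0 < r q \<Longrightarrow> r q \<le> 2 \<Longrightarrow> comparable le p q \<Longrightarrow> q \<in> A"
    and v: "v \<in> P" "3 \<le> r v" and p: "p \<in> A" "le p v"
    and q: "q \<in> P" "0 < r q" "q \<noteq> v" "le q v"
  shows "\<exists>p'\<in>A. le p' q"
  using v p q
proof (induction "r v" arbitrary: v p q rule: less_induct)
  case less
  let ?I = "open_interval P le z v"
  let ?U = "{w \<in> ?I. \<exists>p'\<in>A. le p' w}"
  have I: "w \<in> ?I \<longleftrightarrow> w \<in> P \<and> 0 < r w \<and> r w < r v \<and> le w v" for w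
    using in_open_interval[OF zt(1) less.prems(1)] bot rzt by auto
  have lowA: "w \<in> A" if w: "w \<in> ?U" "r w \<le> 2" for w
  proof -
    obtain p' where p': "p' \<in> A" "le p' w" using w by blast
    have "w \<in> P" "0 < r w" using w I by auto
    then show ?thesis using closed[OF p'(1), of w] p' A[of p'] w(2) by (cases "p' = w") (auto simp: comparable_def)
  qed
  have "?U = ?I"
  proof (rule interval_connected[OF gor zt(1) less.prems(1) bot[OF less.prems(1)]])
    show "r z + 2 < r v" using less.prems(2) rzt by simp
    show "?U \<noteq> {}"
    proof -
      have "p \<in> ?I" using less.prems A[of p] I[of p] by auto
      then show ?thesis using less.prems(3) A[of p] refl by blast
    qed
    fix w w' assume w: "w \<in> ?U" and w': "w' \<in> ?I" and c: "comparable le w w'"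
    have wP: "w \<in> P" "w' \<in> P" "0 < r w'" using w w' I by auto
    obtain p' where p': "p' \<in> A" "le p' w" using w by blast
    have "\<exists>p'\<in>A. le p' w'"
    proof (cases "le w w'")
      case True
      then have "le p' w'" using trans[of p' w w'] p' A[OF p'(1)] wP by blast
      then show ?thesis using p' by blast
    next
      case False
      then have le: "le w' w" "w' \<noteq> w" using c by (auto simp: comparable_def)
      show ?thesis
      proof (cases "r w \<le> 2")
        case True
        then have "w \<in> A" using lowA w by blast
        moreover have "r w' \<le> 2" using rank_mono[OF wP(2,1) le(1)] True by simp
        ultimately have "w' \<in> A" using closed c wP by blast
        then show ?thesis using refl wP by blast
      next
        case False
        \<comment> \<open>Here \<open>w\<close> has rank at least 3 and lies above an element of
          \<open>A\<close>, so the induction hypothesis applies with \<open>w\<close> in place of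
          \<open>v\<close>.\<close>
        have "r w < r v" using w I by blast
        then show ?thesis using less.hyps[of w p' w'] False wP p' le by auto
      qed
    qed
    then show "w' \<in> ?U" using w' by blast
  qed blast
  moreover have "q \<in> ?I" using I[of q] less.prems strict[of q v] by auto
  ultimately show ?case by blast
qed

text \<open>Thin intervals at the bottom and at the top already contain two atoms and two coatoms.
  These bounds make the coefficients of DCC and CCD nonnegative in rank 5.\<close>

lemma two_atoms_coatoms:
  assumes gor: "gor_graph T (P - {z, t}) (comparable le) n" and n: "1 \<le> n"
  shows "2 \<le> card (level z t 1)" "2 \<le> card (level z t n)"
proof -
  obtain w where w: "w \<in> P" "r w = 2" using between_rank[of z t 2] bot[of t] zt rzt n by auto
  have "card (level z w 1) = 2" using level_thin[OF gor zt(1) w(1) bot[OF w(1)]] w rzt by simp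
  moreover have "level z w 1 \<subseteq> level z t 1"
    using n by (auto simp: rank_level_zt) (auto simp: rank_level_def open_interval_def)
  ultimately show "2 \<le> card (level z t 1)" using card_mono[OF level_subset(2)] by metis
  obtain w where w: "w \<in> P" "r w = n - 1" using between_rank[of z t "n - 1"] bot[of t] zt rzt diff_le_self[of n 1] le_SucI by auto
  have "card (level w t (r w + 1)) = 2" using level_thin[OF gor w(1) zt(2) top[OF w(1)]] w rzt n by simp
  moreover have "level w t (r w + 1) \<subseteq> level z t n"
    using n w by (auto simp: rank_level_zt) (auto simp: rank_level_def open_interval_def)
  ultimately show "2 \<le> card (level z t n)" using card_mono[OF level_subset(2)] by metis
qed

text \<open>The elements of ranks 1 and 2 form a graph of minimum degree at least 2. If it is 2-regular,
  then every element of rank 3 lies above all neighbours of the atoms below it, hence, by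
  connectedness, above all atoms.\<close>

lemma rank_1_2_graph:
  assumes gor: "gor_graph T (P - {z, t}) (comparable le) n" and n: "3 \<le> n"
  shows "card (level z t 1) \<le> card (level z t 2)"
    "card (level z t 2) = card (level z t 1) \<Longrightarrow> p \<in> P \<Longrightarrow> r p = 1 \<Longrightarrow> q \<in> P \<Longrightarrow> 3 \<le> r q \<Longrightarrow> le p q"
proof -
  let ?A = "level z t 1" and ?B = "level z t 2"
  let ?N = "\<lambda>p. {q \<in> P. r q = 2 \<and> le p q}"
  have A: "p \<in> ?A \<longleftrightarrow> p \<in> P \<and> r p = 1" and B: "p \<in> ?B \<longleftrightarrow> p \<in> P \<and> r p = 2" for p
    using rank_level_zt n by auto
  have finA: "finite ?A" "finite ?B" by (rule level_subset(2))+
  have finN: "finite (?N p)" for p using fin by simp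
  have sub: "level p m 2 \<subseteq> ?N p" for p m by (auto simp: rank_level_def open_interval_def)
  have two: "card (level p m 2) = 2" if "p \<in> P" "r p = 1" "m \<in> P" "r m = 3" "le p m" for p m
    using level_thin[OF gor that(1,3,5)] that by (simp add: numeral_2_eq_2)
  have deg: "2 \<le> card (?N p)" if "p \<in> ?A" for p
  proof -
    have p: "p \<in> P" "r p = 1" using that A by auto
    obtain m where m: "m \<in> P" "le p m" "r m = 3"
      using between_rank[of p t 3] top[of p] p zt rzt n by auto
    show ?thesis using two[OF p m(1,3,2)] card_mono[OF finN sub, of p m] by simp
  qed
  have "prod.swap ` Sigma ?A ?N = Sigma ?B (\<lambda>q. level z q 1)"
  proof (intro set_eqI iffI)
    fix e assume "e \<in> prod.swap ` Sigma ?A ?N"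
    then obtain p q where e: "e = (q, p)" "p \<in> ?A" "q \<in> ?N p" by force
    then have pq: "p \<in> P" "r p = 1" "q \<in> P" "r q = 2" "le p q" using A[of p] by blast+
    then have "p \<noteq> z" "p \<noteq> q" using rzt by auto
    then have "p \<in> level z q 1" using pq bot[of p] by (simp add: rank_level_def open_interval_def)
    then show "e \<in> Sigma ?B (\<lambda>q. level z q 1)" using e(1) B[of q] pq by blast
  next
    fix e assume "e \<in> Sigma ?B (\<lambda>q. level z q 1)"
    then obtain p q where e: "e = (q, p)" "q \<in> ?B" "p \<in> level z q 1" by blast
    then have "q \<in> P" "r q = 2" using B[of q] by blast+
    moreover have "p \<in> P" "r p = 1" "le p q" using e(3) by (auto simp: rank_level_def open_interval_def)
    ultimately have "(p, q) \<in> Sigma ?A ?N" using A[of p] by blast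
    then show "e \<in> prod.swap ` Sigma ?A ?N" unfolding e by force
  qed
  moreover have "card (prod.swap ` Sigma ?A ?N) = card (Sigma ?A ?N)" by (rule card_image) (simp add: inj_on_def)
  moreover have "card (level z q 1) = 2" if "q \<in> ?B" for q
    using level_thin[OF gor zt(1) _ bot] that B rzt by simp
  ultimately have sum: "(\<Sum>p\<in>?A. card (?N p)) = 2 * card ?B"
    using finA finN level_subset(2) by (simp add: card_SigmaI)
  have "(\<Sum>p\<in>?A. 2) \<le> (\<Sum>p\<in>?A. card (?N p))" by (rule sum_mono) (rule deg)
  then show "card ?A \<le> card ?B" using sum by simp
  assume eq: "card ?B = card ?A" and p: "p \<in> P" "r p = 1" and q: "q \<in> P" "3 \<le> r q"
  \<comment> \<open>The degrees sum to twice the number of elements of rank 2. If this is twice the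
    number of atoms, the lower bound 2 is attained everywhere.\<close>
  have reg: "card (?N p) = 2" if "p \<in> ?A" for p
  proof (rule ccontr)
    assume "card (?N p) \<noteq> 2"
    then have "2 < card (?N p)" using deg[OF that] by simp
    then have "(\<Sum>p\<in>?A. 2) < (\<Sum>p\<in>?A. card (?N p))"
      using that deg finA by (intro sum_strict_mono_ex1) auto
    then show False using sum eq by simp
  qed
  obtain m where m: "m \<in> P" "le m q" "r m = 3"
    using between_rank[of z q 3] bot[of q] q zt rzt by auto
  \<comment> \<open>\<open>K\<close> is shown to be closed under comparability within ranks 1 and 2;
    spreading it below \<open>t\<close> then puts every atom into \<open>K\<close>.\<close>
  define K where "K = {w \<in> P. 0 < r w \<and> r w \<le> 2 \<and> le w m}"
  have Kclosed: "w' \<in> K" if w: "w \<in> K" "w' \<in> P" "0 < r w'" "r w' \<le> 2" "comparable le w w'" for w w'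
  proof (cases "le w' w")
    case True
    then show ?thesis using w trans[of w' w m] m unfolding K_def by blast
  next
    case False
    then have le: "le w w'" "w \<noteq> w'" using w by (auto simp: comparable_def)
    then have "r w < r w'" using strict w unfolding K_def by blast
    then have rk: "r w = 1" "r w' = 2" using w by (auto simp: K_def)
    have wP: "w \<in> P" "le w m" using w by (auto simp: K_def)
    \<comment> \<open>Two of the neighbours of the atom \<open>w\<close> lie below \<open>m\<close>
      by thinness, and by regularity there are no others.\<close>
    have "level w m 2 = ?N w"
      by (rule card_subset_eq[OF finN sub]) (use two[OF wP(1) rk(1) m(1,3) wP(2)] reg A wP rk in simp)
    then have "w' \<in> level w m 2" using w rk le by blast
    then show ?thesis using w by (auto simp: K_def rank_level_def open_interval_def)
  qed
  obtain p0 where p0: "p0 \<in> P" "le p0 m" "r p0 = 1"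
    using between_rank[of z m 1] bot[of m] m zt rzt by auto
  have KA: "w \<in> P \<and> 0 < r w \<and> r w \<le> 2" if "w \<in> K" for w using that by (simp add: K_def)
  have p0K: "p0 \<in> K" using p0 by (simp add: K_def)
  have rt: "3 \<le> r t" and rp: "0 < r p" and pt: "p \<noteq> t" using p rzt n by auto
  have "\<exists>p'\<in>K. le p' p"
    by (rule closed_low_part_spreads[OF gor KA Kclosed zt(2) rt p0K top[OF p0(1)] p(1) rp pt top[OF p(1)]])
  then obtain p' where p': "p' \<in> K" "le p' p" by blast
  then have "p' = p" using rank_mono[of p' p] rank_eq[of p' p] p by (auto simp: K_def)
  then show "le p q" using p' trans[of p m q] p q m by (auto simp: K_def)
qed

end

section \<open>Inequalities from flag numbers\<close>

lemma cd_words_4: "cd_words 4 = {[C, C, C, C], [D, C, C], [C, D, C], [C, C, D], [D, D]}"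
  by (auto simp: eval_nat_numeral cd_words_Suc_Suc cd_words_0 cd_words_1)

lemma cd_words_5: "cd_words 5 = {[C, C, C, C, C], [D, C, C, C], [C, D, C, C], [C, C, D, C], [C, C, C, D],
    [D, D, C], [D, C, D], [C, D, D]}"
  by (auto simp: eval_nat_numeral cd_words_Suc_Suc cd_words_0 cd_words_1)

lemma four_mult_le_square_sum: "4 * (p * q) \<le> (p + q) ^ 2" for p q :: int
proof -
  have "0 \<le> (p - q) ^ 2" by simp
  then show ?thesis by (simp add: power2_eq_square algebra_simps)
qed

lemma rank6_necessary:
  assumes "is_d_vector_of_gorenstein (T::'k::field itself) 5 [1, int x, int y]"
  shows "real y \<le> (real x)\<^sup>2 / 4"
proof -
  obtain P le z t r \<Phi> where P: "ranked_poset P le z t r 5"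
    and cd: "cd_expands 1 5 (h_transform (flag P le r z t)) \<Phi>"
    and d: "d_coeff 5 \<Phi> 0 = 1" "d_coeff 5 \<Phi> 1 = int x" "d_coeff 5 \<Phi> 2 = int y"
    using gorenstein_d_vectorE[OF assms] by metis
  interpret ranked_poset P le z t r 5 by (rule P)
  let ?f = "flag P le r z t"
  have h: "h_transform ?f S = (\<Sum>w\<in>cd_words 5. if cd_match w 1 S then \<Phi> w else 0)" if "S \<subseteq> {1..<6}" for S
    using cd that by (simp add: cd_expands_def)
  \<comment> \<open>The words with one d are sorted by whether their d covers position 2 or position
    4. Each d in a word of degree 5 covers exactly one of these positions, so every word contributes
    to the flag h-number of {2, 4}; this is why ranks 2 and 4 are used.\<close>
  define p where "p = \<Phi> [D, C, C, C] + \<Phi> [C, D, C, C]"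
  define q where "q = \<Phi> [C, C, D, C] + \<Phi> [C, C, C, D]"
  have d': "\<Phi> [C, C, C, C, C] = 1" "p + q = int x" "\<Phi> [D, D, C] + \<Phi> [D, C, D] + \<Phi> [C, D, D] = int y"
    using d unfolding d_coeff_def cd_words_5 p_def q_def by simp_all
  have "h_transform ?f {2} = 1 + p" "h_transform ?f {4} = 1 + q" "h_transform ?f {2, 4} = 1 + int x + int y"
    using d' unfolding p_def q_def by (simp_all add: h cd_words_5)
  then have "?f {2} = 2 + p" "?f {4} = 2 + q" "?f {2, 4} = 4 + 2 * int x + int y"
    using flag_empty d'(2) by (simp_all add: h_transform_single h_transform_pair)
  then have "4 + 2 * int x + int y \<le> (2 + p) * (2 + q)"
    using flag_pair_le[of 2 4] by simp
  then have "int y \<le> p * q" using d'(2) by (simp add: algebra_simps)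
  then have "4 * int y \<le> (p + q) ^ 2" using four_mult_le_square_sum[of p q] by linarith
  then have "int (4 * y) \<le> int (x ^ 2)" using d'(2) by simp
  then have "real (4 * y) \<le> real (x ^ 2)" by (simp only: of_nat_le_iff)
  then show ?thesis by simp
qed

lemma rank5_necessary:
  assumes "is_d_vector_of_gorenstein (T::'k::field itself) 4 [1, int x, int y]"
  shows "real y \<le> (real x - 1)\<^sup>2 / 4 \<or> (\<exists>a b :: nat. x = a + b \<and> y = a * b)"
proof -
  obtain P le z t r \<Phi> where P: "ranked_poset P le z t r 4" and gor: "gor_graph T (P - {z, t}) (comparable le) 4"
    and cd: "cd_expands 1 4 (h_transform (flag P le r z t)) \<Phi>"
    and d: "d_coeff 4 \<Phi> 0 = 1" "d_coeff 4 \<Phi> 1 = int x" "d_coeff 4 \<Phi> 2 = int y"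
    using gorenstein_d_vectorE[OF assms] by metis
  interpret ranked_poset P le z t r 4 by (rule P)
  let ?f = "flag P le r z t"
  have h: "h_transform ?f S = (\<Sum>w\<in>cd_words 4. if cd_match w 1 S then \<Phi> w else 0)" if "S \<subseteq> {1..<5}" for S
    using cd that by (simp add: cd_expands_def)
  define a1 where "a1 = \<Phi> [D, C, C]"
  define a2 where "a2 = \<Phi> [C, D, C]"
  define a3 where "a3 = \<Phi> [C, C, D]"
  have d': "\<Phi> [C, C, C, C] = 1" "a1 + a2 + a3 = int x" "\<Phi> [D, D] = int y"
    using d unfolding d_coeff_def cd_words_4 a1_def a2_def a3_def by simp_all
  \<comment> \<open>A d at positions 2 and 3 meets neither 1 nor 4, so CDC drops out of the entry
    for {1, 4}, while DD contributes y.\<close>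
  have "h_transform ?f {1} = 1 + a1" "h_transform ?f {2} = 1 + a1 + a2" "h_transform ?f {4} = 1 + a3"
    "h_transform ?f {1, 4} = 1 + a1 + a3 + int y"
    using d' unfolding a1_def a2_def a3_def by (simp_all add: h cd_words_4)
  then have f: "?f {1} = 2 + a1" "?f {2} = 2 + a1 + a2" "?f {4} = 2 + a3" "?f {1, 4} = 4 + 2 * a1 + 2 * a3 + int y"
    using flag_empty by (simp_all add: h_transform_single h_transform_pair)
  have "0 \<le> a1" "0 \<le> a3" using two_atoms_coatoms[OF gor] f flag_single by auto
  \<comment> \<open>By the flag numbers just found, \<open>a2\<close> is the number of elements of
    rank 2 minus the number of atoms.\<close>
  moreover have a2: "0 \<le> a2" using rank_1_2_graph(1)[OF gor] f flag_single by auto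
  have le: "int y \<le> a1 * a3" using flag_pair_le[of 1 4] f by (simp add: algebra_simps)
  show ?thesis
  proof (cases "a2 = 0")
    case True
    then have eq: "card (level z t 2) = card (level z t 1)" using f flag_single by auto
    have "le p q" if "p \<in> level z t 1" "q \<in> level z t 4" for p q
      using rank_1_2_graph(2)[OF gor _ eq, of p q] that rank_level_zt by auto
    then have "{(p, q). p \<in> level z t 1 \<and> q \<in> level z t 4 \<and> le p q} = level z t 1 \<times> level z t 4" by auto
    then have "?f {1, 4} = ?f {1} * ?f {4}"
      using flag_pair[of 1 4] flag_single by (simp add: card_cartesian_product)
    then have "int y = a1 * a3" using f by (simp add: algebra_simps)
    then have "x = nat a1 + nat a3 \<and> y = nat a1 * nat a3"
      using d'(2) True \<open>0 \<le> a1\<close> \<open>0 \<le> a3\<close> by (auto simp flip: nat_mult_distrib nat_add_distrib)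
    then show ?thesis by blast
  next
    case False
    \<comment> \<open>Now \<open>a2\<close> is at least 1, which accounts for the x - 1 in the
      bound; nonnegativity of \<open>a1 + a3\<close> permits squaring.\<close>
    then have "a1 + a3 \<le> int x - 1" "0 \<le> a1 + a3" using a2 d'(2) \<open>0 \<le> a1\<close> \<open>0 \<le> a3\<close> by auto
    then have "(a1 + a3) ^ 2 \<le> (int x - 1) ^ 2" by (rule power_mono)
    then have "4 * int y \<le> (int x - 1) ^ 2" using four_mult_le_square_sum[of a1 a3] le by linarith
    then have "real_of_int (4 * int y) \<le> real_of_int ((int x - 1) ^ 2)" by (simp only: of_int_le_iff)
    then show ?thesis by simp
  qed
qed

theorem theorem1p2:
  fixes x y :: nat
  shows "(is_d_vector_of_gorenstein TYPE('k::field) 4 [1, int x, int y] \<longleftrightarrow>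
            real y \<le> (real x - 1)^2 / 4 \<or> (\<exists>a b :: nat. x = a + b \<and> y = a * b))
       \<and> (is_d_vector_of_gorenstein TYPE('k::field) 5 [1, int x, int y] \<longleftrightarrow>
            real y \<le> (real x)^2 / 4)"
  by (intro conjI iffI)
     (erule rank5_necessary rank5_sufficient rank6_necessary rank6_sufficient)+

end
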